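(* Let $\mathcal{C}$ be a proto-abelian category and let $\mathcal{S}_{\bullet}$ be the corresponding simplicial groupoid of flags in $\mathcal{C}$. The morphisms in $\mathrm{Span}(\mathbf{Grpd})$ represented by the spans $$\mu:\quad \mathcal{S}_{\{0,1\}}\times\mathcal{S}_{\{1,2\}} \xleftarrow{\;G\;} \mathcal{S}_{\{0,1,2\}} \xrightarrow{\;F\;} \mathcal{S}_{\{0,2\}}$$ and $$e:\quad \mathcal{S}_0 \xleftarrow{\;\mathrm{id}\;} \mathcal{S}_0 \xrightarrow{\;0\mapsto 0\;} \mathcal{S}_1$$ make $\mathcal{S}_1$ an algebra object (associative and unital) in the monoidal category $\mathrm{Span}(\mathbf{Grpd})$.
   Context: Monomorphisms are denoted $\hookrightarrow$ and epimorphisms $\twoheadrightarrow$. A category $\mathcal{C}$ is called proto-abelian if: (1) $\mathcal{C}$ is pointed (has a zero object). (2)(a) Every diagram $C \twoheadleftarrow A \hookrightarrow B$ can be completed to a pushout square with $A\hookrightarrow B$, $A \twoheadrightarrow C$, $B \twoheadrightarrow D$, $C \hookrightarrow D$. (b) Every diagram $C \hookrightarrow D \twoheadleftarrow B$ can be completed to a pullback square with $A\hookrightarrow B$, $A \twoheadrightarrow C$, $B \twoheadrightarrow D$, $C \hookrightarrow D$. (3) A commutative square with $A\hookrightarrow B$, $A \twoheadrightarrow C$, $B \twoheadrightarrow D$, $C \hookrightarrow D$ is a pushout square if and only if it is a pullback square; such a square is called biCartesian. Groupoid of flags. Fix a zero object $0$ of $\mathcal{C}$. $\mathcal{S}_n$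 is the maximal groupoid (same objects, only isomorphisms) in the category of commutative triangular diagrams in $\mathcal{C}$ consisting of objects $A_{i,j}$, $0\le i\le j\le n$, with $A_{i,i}=0$, monomorphisms $A_{i,j}\hookrightarrow A_{i,j+1}$ and epimorphisms $A_{i,j}\twoheadrightarrow A_{i+1,j}$, such that all squares are biCartesian. The face functor $\partial_k:\mathcal{S}_n\to\mathcal{S}_{n-1}$ omits the $k$-th row and $k$-th column and composes the remaining morphisms; the degeneracy $\sigma_k:\mathcal{S}_n\to\mathcal{S}_{n+1}$ doubles the $k$-th row and $k$-th column via identity maps. Thus $\mathcal{S}_\bullet$ is a simplicial groupoid; $\mathcal{S}_0$ is the trivial groupoid with single object $0$; $\mathcal{S}_1$ is equivalent to the maximal groupoid of $\mathcal{C}$; $\mathcal{S}_2$ is the groupoid of short exact sequences $A_{0,1}\hookrightarrow A_{0,2}\twoheadrightarrow A_{1,2}$. For a finite nonempty linearly ordered set $I$ one writes $\mathcal{S}_I$ for $\mathcal{S}_{|I|-1}$ via the unique order isomorphism $I\cong[|I|-1]$. The functors $G$ and $F$ are induced by inclusions of vertices: $G$ sends a short exact sequence to $(A_{0,1},A_{1,2})$ and $F$ sends it to $A_{0,2}$. Spans. For functors of groupoids $F:\mathcal{A}\to\mathcal{B}$, $G:\mathcal{A}'\to\mathcal{B}$, the $2$-pullback $\mathcal{A}\times^{(2)}_{\mathcal{B}}\mathcal{A}'$ has objects $(a,a',\varphi)$ with $\varphi:F(a)\cong G(a')$, and morphisms the pairs of morphisms $(f,g)$ compatible with the $\varphi$'s.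 The category $\mathrm{Span}(\mathbf{Grpd})$ has groupoids as objects; a morphism $\mathcal{A}\to\mathcal{B}$ is an equivalence class of spans $\mathcal{A}\leftarrow\mathcal{X}\to\mathcal{B}$, where two spans with apexes $\mathcal{X},\mathcal{X}'$ are equivalent if there is an equivalence $\mathcal{X}\to\mathcal{X}'$ commuting with the legs up to natural isomorphism. The composite of $\mathcal{A}\leftarrow\mathcal{X}\to\mathcal{B}$ and $\mathcal{B}\leftarrow\mathcal{Y}\to\mathcal{D}$ is represented by $\mathcal{A}\leftarrow\mathcal{X}\times^{(2)}_{\mathcal{B}}\mathcal{Y}\to\mathcal{D}$. The monoidal structure is the product of groupoids on objects and the product of spans on morphisms; the unit is the trivial groupoid. *)

theory Defs
  imports Main
begin

section \<open>Categories\<close>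

record ('o, 'a) cat =
  Ob :: "'o set"
  Ar :: "'a set"
  Dom :: "'a \<Rightarrow> 'o"
  Cod :: "'a \<Rightarrow> 'o"
  Idt :: "'o \<Rightarrow> 'a"
  Cmp :: "'a \<Rightarrow> 'a \<Rightarrow> 'a"  (infixr "\<cdot>\<index>" 70)

text \<open>\<open>g \<cdot> f\<close> is ``\<open>g\<close> after \<open>f\<close>''; values outside \<open>Ob\<close>, \<open>Ar\<close> and on
  non-composable pairs are irrelevant.\<close>

definition hom :: "('o, 'a, 'm) cat_scheme \<Rightarrow> 'o \<Rightarrow> 'o \<Rightarrow> 'a set" where
  "hom C a b = {f \<in> Ar C. Dom C f = a \<and> Cod C f = b}"

locale category =
  fixes C :: "('o, 'a, 'm) cat_scheme" (structure)
  assumes dom_Ob: "f \<in> Ar C \<Longrightarrow> Dom C f \<in> Ob C"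
    and cod_Ob: "f \<in> Ar C \<Longrightarrow> Cod C f \<in> Ob C"
    and id_hom: "a \<in> Ob C \<Longrightarrow> Idt C a \<in> hom C a a"
    and comp_hom: "f \<in> hom C a b \<Longrightarrow> g \<in> hom C b c \<Longrightarrow> g \<cdot> f \<in> hom C a c"
    and comp_id: "f \<in> hom C a b \<Longrightarrow> f \<cdot> Idt C a = f"
    and id_comp: "f \<in> hom C a b \<Longrightarrow> Idt C b \<cdot> f = f"
    and comp_assoc: "f \<in> hom C a b \<Longrightarrow> g \<in> hom C b c \<Longrightarrow> h \<in> hom C c d \<Longrightarrow>
      h \<cdot> (g \<cdot> f) = (h \<cdot> g) \<cdot> f"

definition is_iso :: "('o, 'a, 'm) cat_scheme \<Rightarrow> 'a \<Rightarrow> bool" where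
  "is_iso C f \<longleftrightarrow> f \<in> Ar C \<and>
    (\<exists>g \<in> hom C (Cod C f) (Dom C f).
       g \<cdot>\<^bsub>C\<^esub> f = Idt C (Dom C f) \<and> f \<cdot>\<^bsub>C\<^esub> g = Idt C (Cod C f))"

definition monic :: "('o, 'a, 'm) cat_scheme \<Rightarrow> 'a \<Rightarrow> bool" where
  "monic C f \<longleftrightarrow> f \<in> Ar C \<and>
    (\<forall>x. \<forall>g \<in> hom C x (Dom C f). \<forall>h \<in> hom C x (Dom C f).
       f \<cdot>\<^bsub>C\<^esub> g = f \<cdot>\<^bsub>C\<^esub> h \<longrightarrow> g = h)"

definition epic :: "('o, 'a, 'm) cat_scheme \<Rightarrow> 'a \<Rightarrow> bool" where
  "epic C f \<longleftrightarrow> f \<in> Ar C \<and>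
    (\<forall>x. \<forall>g \<in> hom C (Cod C f) x. \<forall>h \<in> hom C (Cod C f) x.
       g \<cdot>\<^bsub>C\<^esub> f = h \<cdot>\<^bsub>C\<^esub> f \<longrightarrow> g = h)"

definition zero_object :: "('o, 'a, 'm) cat_scheme \<Rightarrow> 'o \<Rightarrow> bool" where
  "zero_object C z \<longleftrightarrow> z \<in> Ob C \<and>
    (\<forall>a \<in> Ob C. (\<exists>!f. f \<in> hom C z a) \<and> (\<exists>!f. f \<in> hom C a z))"

text \<open>Squares are written \<open>f p q g\<close> with \<open>f : A \<rightarrow> B\<close>, \<open>p : A \<rightarrow> C\<close>, \<open>q : B \<rightarrow> D\<close>,
  \<open>g : C \<rightarrow> D\<close>.\<close>

definition comm_square :: "('o, 'a, 'm) cat_scheme \<Rightarrow> 'a \<Rightarrow> 'a \<Rightarrow> 'a \<Rightarrow> 'a \<Rightarrow> bool" where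
  "comm_square C f p q g \<longleftrightarrow>
    f \<in> Ar C \<and> p \<in> Ar C \<and> q \<in> Ar C \<and> g \<in> Ar C \<and>
    Dom C f = Dom C p \<and> Cod C f = Dom C q \<and> Cod C p = Dom C g \<and> Cod C q = Cod C g \<and>
    q \<cdot>\<^bsub>C\<^esub> f = g \<cdot>\<^bsub>C\<^esub> p"

definition pushout_square :: "('o, 'a, 'm) cat_scheme \<Rightarrow> 'a \<Rightarrow> 'a \<Rightarrow> 'a \<Rightarrow> 'a \<Rightarrow> bool" where
  "pushout_square C f p q g \<longleftrightarrow> comm_square C f p q g \<and>
    (\<forall>q' g'. comm_square C f p q' g' \<longrightarrow>
      (\<exists>!u. u \<in> hom C (Cod C q) (Cod C q') \<and> u \<cdot>\<^bsub>C\<^esub> q = q' \<and> u \<cdot>\<^bsub>C\<^esub> g = g'))"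

definition pullback_square :: "('o, 'a, 'm) cat_scheme \<Rightarrow> 'a \<Rightarrow> 'a \<Rightarrow> 'a \<Rightarrow> 'a \<Rightarrow> bool" where
  "pullback_square C f p q g \<longleftrightarrow> comm_square C f p q g \<and>
    (\<forall>f' p'. comm_square C f' p' q g \<longrightarrow>
      (\<exists>!u. u \<in> hom C (Dom C f') (Dom C f) \<and> f \<cdot>\<^bsub>C\<^esub> u = f' \<and> p \<cdot>\<^bsub>C\<^esub> u = p'))"

definition mono_epi_square :: "('o, 'a, 'm) cat_scheme \<Rightarrow> 'a \<Rightarrow> 'a \<Rightarrow> 'a \<Rightarrow> 'a \<Rightarrow> bool" where
  "mono_epi_square C f p q g \<longleftrightarrow>
    comm_square C f p q g \<and> monic C f \<and> epic C p \<and> epic C q \<and> monic C g"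

definition bicartesian :: "('o, 'a, 'm) cat_scheme \<Rightarrow> 'a \<Rightarrow> 'a \<Rightarrow> 'a \<Rightarrow> 'a \<Rightarrow> bool" where
  "bicartesian C f p q g \<longleftrightarrow>
    mono_epi_square C f p q g \<and> pushout_square C f p q g \<and> pullback_square C f p q g"

locale proto_abelian = category +
  assumes pointed: "\<exists>z. zero_object C z"
    and pushout_exists: "monic C f \<Longrightarrow> epic C p \<Longrightarrow> Dom C f = Dom C p \<Longrightarrow>
      \<exists>q g. mono_epi_square C f p q g \<and> pushout_square C f p q g"
    and pullback_exists: "monic C g \<Longrightarrow> epic C q \<Longrightarrow> Cod C g = Cod C q \<Longrightarrow>
      \<exists>f p. mono_epi_square C f p q g \<and> pullback_square C f p q g"
    and pushout_iff_pullback: "mono_epi_square C f p q g \<Longrightarrow>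
      pushout_square C f p q g \<longleftrightarrow> pullback_square C f p q g"

section \<open>Groupoids and functors\<close>

locale groupoid = category +
  assumes all_iso: "f \<in> Ar C \<Longrightarrow> is_iso C f"

definition core :: "('o, 'a) cat \<Rightarrow> ('o, 'a) cat" where
  "core C = C\<lparr>Ar := {f. is_iso C f}\<rparr>"

record ('o, 'a, 'p, 'b) func =
  on_Ob :: "'o \<Rightarrow> 'p"
  on_Ar :: "'a \<Rightarrow> 'b"

definition is_functor :: "('o, 'a) cat \<Rightarrow> ('p, 'b) cat \<Rightarrow> ('o, 'a, 'p, 'b) func \<Rightarrow> bool" where
  "is_functor A B F \<longleftrightarrow>
    (\<forall>a \<in> Ob A. on_Ob F a \<in> Ob B) \<and>
    (\<forall>f \<in> Ar A. on_Ar F f \<in> hom B (on_Ob F (Dom A f)) (on_Ob F (Cod A f))) \<and>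
    (\<forall>a \<in> Ob A. on_Ar F (Idt A a) = Idt B (on_Ob F a)) \<and>
    (\<forall>f \<in> Ar A. \<forall>g \<in> Ar A. Cod A f = Dom A g \<longrightarrow>
       on_Ar F (g \<cdot>\<^bsub>A\<^esub> f) = on_Ar F g \<cdot>\<^bsub>B\<^esub> on_Ar F f)"

definition id_func :: "('o, 'a, 'o, 'a) func" where
  "id_func = \<lparr>on_Ob = (\<lambda>a. a), on_Ar = (\<lambda>f. f)\<rparr>"

definition comp_func ::
  "('p, 'b, 'q, 'c) func \<Rightarrow> ('o, 'a, 'p, 'b) func \<Rightarrow> ('o, 'a, 'q, 'c) func" (infixr "\<circ>\<^sub>F" 55) where
  "G \<circ>\<^sub>F F = \<lparr>on_Ob = on_Ob G \<circ> on_Ob F, on_Ar = on_Ar G \<circ> on_Ar F\<rparr>"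

definition nat_isomorphic ::
  "('o, 'a) cat \<Rightarrow> ('p, 'b) cat \<Rightarrow> ('o, 'a, 'p, 'b) func \<Rightarrow> ('o, 'a, 'p, 'b) func \<Rightarrow> bool" where
  "nat_isomorphic A B F G \<longleftrightarrow>
    (\<exists>t. (\<forall>a \<in> Ob A. t a \<in> hom B (on_Ob F a) (on_Ob G a) \<and> is_iso B (t a)) \<and>
         (\<forall>f \<in> Ar A. t (Cod A f) \<cdot>\<^bsub>B\<^esub> on_Ar F f = on_Ar G f \<cdot>\<^bsub>B\<^esub> t (Dom A f)))"

definition cat_equivalence :: "('o, 'a) cat \<Rightarrow> ('p, 'b) cat \<Rightarrow> ('o, 'a, 'p, 'b) func \<Rightarrow> bool" where
  "cat_equivalence A B F \<longleftrightarrow> is_functor A B F \<and>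
    (\<exists>G. is_functor B A G \<and> nat_isomorphic A A (G \<circ>\<^sub>F F) id_func \<and>
         nat_isomorphic B B (F \<circ>\<^sub>F G) id_func)"

section \<open>Monoidal structures and algebra objects\<close>

record ('o, 'a) mon_cat = "('o, 'a) cat" +
  tensor_Ob :: "'o \<Rightarrow> 'o \<Rightarrow> 'o"
  tensor_Ar :: "'a \<Rightarrow> 'a \<Rightarrow> 'a"
  tensor_unit :: 'o
  associator :: "'o \<Rightarrow> 'o \<Rightarrow> 'o \<Rightarrow> 'a"  \<comment> \<open>\<open>(A \<otimes> B) \<otimes> D \<rightarrow> A \<otimes> (B \<otimes> D)\<close>\<close>
  left_unitor :: "'o \<Rightarrow> 'a"  \<comment> \<open>\<open>1 \<otimes> A \<rightarrow> A\<close>\<close>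
  right_unitor :: "'o \<Rightarrow> 'a"  \<comment> \<open>\<open>A \<otimes> 1 \<rightarrow> A\<close>\<close>

definition algebra_object :: "('o, 'a) mon_cat \<Rightarrow> 'o \<Rightarrow> 'a \<Rightarrow> 'a \<Rightarrow> bool" where
  "algebra_object M A m e \<longleftrightarrow>
    A \<in> Ob M \<and>
    m \<in> hom M (tensor_Ob M A A) A \<and>
    e \<in> hom M (tensor_unit M) A \<and>
    m \<cdot>\<^bsub>M\<^esub> tensor_Ar M m (Idt M A) =
      m \<cdot>\<^bsub>M\<^esub> (tensor_Ar M (Idt M A) m \<cdot>\<^bsub>M\<^esub> associator M A A A) \<and>
    m \<cdot>\<^bsub>M\<^esub> tensor_Ar M e (Idt M A) = left_unitor M A \<and>
    m \<cdot>\<^bsub>M\<^esub> tensor_Ar M (Idt M A) e = right_unitor M A"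

section \<open>The monoidal category of spans of groupoids\<close>

text \<open>A universe closed under pairing.  The objects of \<open>span_grpd\<close> below are the groupoids
  whose objects and morphisms lie in this universe, so that products and 2-pullbacks of
  small groupoids are again small.  The atoms 'x are arbitrary.\<close>

datatype 'x univ = Star | Atom (the_Atom: 'x) | Tup (ufst: "'x univ") (usnd: "'x univ")

type_synonym 'x ucat = "('x univ, 'x univ) cat"
type_synonym 'x ufunc = "('x univ, 'x univ, 'x univ, 'x univ) func"

definition unit_grpd :: "'x ucat" where
  "unit_grpd = \<lparr>Ob = {Star}, Ar = {Star}, Dom = (\<lambda>_. Star), Cod = (\<lambda>_. Star),
     Idt = (\<lambda>_. Star), Cmp = (\<lambda>_ _. Star)\<rparr>"

definition prod_grpd :: "'x ucat \<Rightarrow> 'x ucat \<Rightarrow> 'x ucat" where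
  "prod_grpd A B = \<lparr>
     Ob = {Tup a b |a b. a \<in> Ob A \<and> b \<in> Ob B},
     Ar = {Tup f g |f g. f \<in> Ar A \<and> g \<in> Ar B},
     Dom = (\<lambda>t. Tup (Dom A (ufst t)) (Dom B (usnd t))),
     Cod = (\<lambda>t. Tup (Cod A (ufst t)) (Cod B (usnd t))),
     Idt = (\<lambda>t. Tup (Idt A (ufst t)) (Idt B (usnd t))),
     Cmp = (\<lambda>t s. Tup (ufst t \<cdot>\<^bsub>A\<^esub> ufst s) (usnd t \<cdot>\<^bsub>B\<^esub> usnd s))\<rparr>"

definition prod_func :: "'x ufunc \<Rightarrow> 'x ufunc \<Rightarrow> 'x ufunc" where
  "prod_func F G = \<lparr>on_Ob = (\<lambda>t. Tup (on_Ob F (ufst t)) (on_Ob G (usnd t))),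
     on_Ar = (\<lambda>t. Tup (on_Ar F (ufst t)) (on_Ar G (usnd t)))\<rparr>"

definition pair_func :: "'x ufunc \<Rightarrow> 'x ufunc \<Rightarrow> 'x ufunc" where
  "pair_func F G = \<lparr>on_Ob = (\<lambda>t. Tup (on_Ob F t) (on_Ob G t)),
     on_Ar = (\<lambda>t. Tup (on_Ar F t) (on_Ar G t))\<rparr>"

definition fst_func :: "'x ufunc" where
  "fst_func = \<lparr>on_Ob = ufst, on_Ar = ufst\<rparr>"

definition snd_func :: "'x ufunc" where
  "snd_func = \<lparr>on_Ob = usnd, on_Ar = usnd\<rparr>"

definition assoc_func :: "'x ufunc" where
  "assoc_func = pair_func (fst_func \<circ>\<^sub>F fst_func) (pair_func (snd_func \<circ>\<^sub>F fst_func) snd_func)"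

definition to_unit :: "'x ufunc" where
  "to_unit = \<lparr>on_Ob = (\<lambda>_. Star), on_Ar = (\<lambda>_. Star)\<rparr>"

text \<open>The 2-pullback of \<open>F : X \<rightarrow> B\<close> and \<open>G : Y \<rightarrow> B\<close>.  An object \<open>(x, y, \<phi>)\<close> is coded as
  \<open>Tup (Tup x y) \<phi>\<close>; a morphism \<open>(f, g)\<close> from \<open>u\<close> to \<open>v\<close> is coded as
  \<open>Tup (Tup f g) (Tup u v)\<close>, since \<open>(f, g)\<close> alone does not determine \<open>u\<close> and \<open>v\<close>.\<close>

definition pullback2_Ob ::
  "'x ucat \<Rightarrow> 'x ucat \<Rightarrow> 'x ucat \<Rightarrow> 'x ufunc \<Rightarrow> 'x ufunc \<Rightarrow> 'x univ set" where
  "pullback2_Ob X Y B F G = {Tup (Tup x y) \<phi> |x y \<phi>.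
     x \<in> Ob X \<and> y \<in> Ob Y \<and> \<phi> \<in> hom B (on_Ob F x) (on_Ob G y) \<and> is_iso B \<phi>}"

definition pullback2 ::
  "'x ucat \<Rightarrow> 'x ucat \<Rightarrow> 'x ucat \<Rightarrow> 'x ufunc \<Rightarrow> 'x ufunc \<Rightarrow> 'x ucat" where
  "pullback2 X Y B F G = \<lparr>
     Ob = pullback2_Ob X Y B F G,
     Ar = {Tup (Tup f g) (Tup u v) |f g u v.
             u \<in> pullback2_Ob X Y B F G \<and> v \<in> pullback2_Ob X Y B F G \<and>
             f \<in> hom X (ufst (ufst u)) (ufst (ufst v)) \<and>
             g \<in> hom Y (usnd (ufst u)) (usnd (ufst v)) \<and>
             on_Ar G g \<cdot>\<^bsub>B\<^esub> usnd u = usnd v \<cdot>\<^bsub>B\<^esub> on_Ar F f},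
     Dom = (\<lambda>t. ufst (usnd t)),
     Cod = (\<lambda>t. usnd (usnd t)),
     Idt = (\<lambda>u. Tup (Tup (Idt X (ufst (ufst u))) (Idt Y (usnd (ufst u)))) (Tup u u)),
     Cmp = (\<lambda>t s. Tup (Tup (ufst (ufst t) \<cdot>\<^bsub>X\<^esub> ufst (ufst s)) (usnd (ufst t) \<cdot>\<^bsub>Y\<^esub> usnd (ufst s)))
                      (Tup (ufst (usnd s)) (usnd (usnd t))))\<rparr>"

record 'x span =
  apex :: "'x ucat"
  lleg :: "'x ufunc"
  rleg :: "'x ufunc"

definition is_span :: "'x ucat \<Rightarrow> 'x ucat \<Rightarrow> 'x span \<Rightarrow> bool" where
  "is_span A B S \<longleftrightarrow> groupoid (apex S) \<and>
    is_functor (apex S) A (lleg S) \<and> is_functor (apex S) B (rleg S)"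

definition span_equiv :: "'x ucat \<Rightarrow> 'x ucat \<Rightarrow> 'x span \<Rightarrow> 'x span \<Rightarrow> bool" where
  "span_equiv A B S T \<longleftrightarrow> (\<exists>E. cat_equivalence (apex S) (apex T) E \<and>
     nat_isomorphic (apex S) A (lleg T \<circ>\<^sub>F E) (lleg S) \<and>
     nat_isomorphic (apex S) B (rleg T \<circ>\<^sub>F E) (rleg S))"

definition span_comp :: "'x ucat \<Rightarrow> 'x span \<Rightarrow> 'x span \<Rightarrow> 'x span" where
  "span_comp B T S = \<lparr>
     apex = pullback2 (apex S) (apex T) B (rleg S) (lleg T),
     lleg = lleg S \<circ>\<^sub>F (fst_func \<circ>\<^sub>F fst_func),
     rleg = rleg T \<circ>\<^sub>F (snd_func \<circ>\<^sub>F fst_func)\<rparr>"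

definition span_prod :: "'x span \<Rightarrow> 'x span \<Rightarrow> 'x span" where
  "span_prod S T = \<lparr>apex = prod_grpd (apex S) (apex T),
     lleg = prod_func (lleg S) (lleg T), rleg = prod_func (rleg S) (rleg T)\<rparr>"

definition func_span :: "'x ucat \<Rightarrow> 'x ufunc \<Rightarrow> 'x span" where
  "func_span A F = \<lparr>apex = A, lleg = id_func, rleg = F\<rparr>"

text \<open>A morphism of \<open>span_grpd\<close> consists of its source, its target and an equivalence class of
  spans.  Composition and product of morphisms are given on all representatives.\<close>

type_synonym 'x span_mor = "'x ucat \<times> 'x ucat \<times> 'x span set"

definition span_class :: "'x ucat \<Rightarrow> 'x ucat \<Rightarrow> 'x span \<Rightarrow> 'x span set" where
  "span_class A B S = {T. is_span A B T \<and> span_equiv A B S T}"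

definition span_mor :: "'x ucat \<Rightarrow> 'x ucat \<Rightarrow> 'x span \<Rightarrow> 'x span_mor" where
  "span_mor A B S = (A, B, span_class A B S)"

definition span_mor_comp :: "'x span_mor \<Rightarrow> 'x span_mor \<Rightarrow> 'x span_mor" where
  "span_mor_comp = (\<lambda>(B', D, Q) (A, B, P).
     (A, D, \<Union>S\<in>P. \<Union>T\<in>Q. span_class A D (span_comp B T S)))"

definition span_mor_prod :: "'x span_mor \<Rightarrow> 'x span_mor \<Rightarrow> 'x span_mor" where
  "span_mor_prod = (\<lambda>(A, B, P) (A', B', P').
     (prod_grpd A A', prod_grpd B B',
      \<Union>S\<in>P. \<Union>T\<in>P'. span_class (prod_grpd A A') (prod_grpd B B') (span_prod S T)))"

definition span_grpd :: "('x ucat, 'x span_mor) mon_cat" where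
  "span_grpd = \<lparr>
     Ob = {A. groupoid A},
     Ar = {span_mor A B S |A B S. groupoid A \<and> groupoid B \<and> is_span A B S},
     Dom = (\<lambda>m. fst m),
     Cod = (\<lambda>m. fst (snd m)),
     Idt = (\<lambda>A. span_mor A A (func_span A id_func)),
     Cmp = span_mor_comp,
     tensor_Ob = prod_grpd,
     tensor_Ar = span_mor_prod,
     tensor_unit = unit_grpd,
     associator = (\<lambda>A B D.
       span_mor (prod_grpd (prod_grpd A B) D) (prod_grpd A (prod_grpd B D))
         (func_span (prod_grpd (prod_grpd A B) D) assoc_func)),
     left_unitor = (\<lambda>A. span_mor (prod_grpd unit_grpd A) A
       (func_span (prod_grpd unit_grpd A) snd_func)),
     right_unitor = (\<lambda>A. span_mor (prod_grpd A unit_grpd) A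
       (func_span (prod_grpd A unit_grpd) fst_func))\<rparr>"

section \<open>The simplicial groupoid of flags\<close>

record ('o, 'a) diagram =
  vert :: "nat \<Rightarrow> nat \<Rightarrow> 'o"
  hor :: "nat \<Rightarrow> nat \<Rightarrow> 'a"  \<comment> \<open>\<open>hor D i j : A\<^sub>i\<^sub>,\<^sub>j \<rightarrow> A\<^sub>i\<^sub>,\<^sub>j\<^sub>+\<^sub>1\<close>\<close>
  ver :: "nat \<Rightarrow> nat \<Rightarrow> 'a"  \<comment> \<open>\<open>ver D i j : A\<^sub>i\<^sub>,\<^sub>j \<rightarrow> A\<^sub>i\<^sub>+\<^sub>1\<^sub>,\<^sub>j\<close>\<close>

text \<open>Entries outside the triangle are \<open>undefined\<close>, so that equal diagrams are equal records.\<close>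

definition is_flag :: "('o, 'a) cat \<Rightarrow> 'o \<Rightarrow> nat \<Rightarrow> ('o, 'a) diagram \<Rightarrow> bool" where
  "is_flag C z n D \<longleftrightarrow>
    (\<forall>i j. if i \<le> j \<and> j \<le> n then vert D i j \<in> Ob C else vert D i j = undefined) \<and>
    (\<forall>i\<le>n. vert D i i = z) \<and>
    (\<forall>i j. if i \<le> j \<and> j < n
       then hor D i j \<in> hom C (vert D i j) (vert D i (j + 1)) \<and> monic C (hor D i j)
       else hor D i j = undefined) \<and>
    (\<forall>i j. if i < j \<and> j \<le> n
       then ver D i j \<in> hom C (vert D i j) (vert D (i + 1) j) \<and> epic C (ver D i j)
       else ver D i j = undefined) \<and>
    (\<forall>i j. i < j \<and> j < n \<longrightarrow>
       bicartesian C (hor D i j) (ver D i j) (ver D i (j + 1)) (hor D (i + 1) j))"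

record ('o, 'a) transf =
  src :: "('o, 'a) diagram"
  tgt :: "('o, 'a) diagram"
  component :: "nat \<Rightarrow> nat \<Rightarrow> 'a"

definition is_transf :: "('o, 'a) cat \<Rightarrow> nat \<Rightarrow> ('o, 'a) transf \<Rightarrow> bool" where
  "is_transf C n t \<longleftrightarrow>
    (\<forall>i j. if i \<le> j \<and> j \<le> n
       then component t i j \<in> hom C (vert (src t) i j) (vert (tgt t) i j)
       else component t i j = undefined) \<and>
    (\<forall>i j. i \<le> j \<and> j < n \<longrightarrow>
       component t i (j + 1) \<cdot>\<^bsub>C\<^esub> hor (src t) i j = hor (tgt t) i j \<cdot>\<^bsub>C\<^esub> component t i j) \<and>
    (\<forall>i j. i < j \<and> j \<le> n \<longrightarrow>
       component t (i + 1) j \<cdot>\<^bsub>C\<^esub> ver (src t) i j = ver (tgt t) i j \<cdot>\<^bsub>C\<^esub> component t i j)"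

definition flag_cat ::
  "('o, 'a) cat \<Rightarrow> 'o \<Rightarrow> nat \<Rightarrow> (('o, 'a) diagram, ('o, 'a) transf) cat" where
  "flag_cat C z n = \<lparr>
     Ob = {D. is_flag C z n D},
     Ar = {t. is_flag C z n (src t) \<and> is_flag C z n (tgt t) \<and> is_transf C n t},
     Dom = src,
     Cod = tgt,
     Idt = (\<lambda>D. \<lparr>src = D, tgt = D, component =
       (\<lambda>i j. if i \<le> j \<and> j \<le> n then Idt C (vert D i j) else undefined)\<rparr>),
     Cmp = (\<lambda>t s. \<lparr>src = src s, tgt = tgt t, component =
       (\<lambda>i j. if i \<le> j \<and> j \<le> n then component t i j \<cdot>\<^bsub>C\<^esub> component s i j else undefined)\<rparr>)\<rparr>"

definition flag_grpd ::
  "('o, 'a) cat \<Rightarrow> 'o \<Rightarrow> nat \<Rightarrow> (('o, 'a) diagram, ('o, 'a) transf) cat" where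
  "flag_grpd C z n = core (flag_cat C z n)"

text \<open>The composites \<open>A\<^sub>i\<^sub>,\<^sub>j \<rightarrow> A\<^sub>i\<^sub>,\<^sub>j\<^sub>+\<^sub>k\<close> and \<open>A\<^sub>i\<^sub>,\<^sub>j \<rightarrow> A\<^sub>i\<^sub>+\<^sub>k\<^sub>,\<^sub>j\<close>, the identity for \<open>k = 0\<close>.\<close>

primrec hor_path :: "('o, 'a) cat \<Rightarrow> ('o, 'a) diagram \<Rightarrow> nat \<Rightarrow> nat \<Rightarrow> nat \<Rightarrow> 'a" where
  "hor_path C D i j 0 = Idt C (vert D i j)"
| "hor_path C D i j (Suc k) = hor D i (j + k) \<cdot>\<^bsub>C\<^esub> hor_path C D i j k"

primrec ver_path :: "('o, 'a) cat \<Rightarrow> ('o, 'a) diagram \<Rightarrow> nat \<Rightarrow> nat \<Rightarrow> nat \<Rightarrow> 'a" where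
  "ver_path C D i j 0 = Idt C (vert D i j)"
| "ver_path C D i j (Suc k) = ver D (i + k) j \<cdot>\<^bsub>C\<^esub> ver_path C D i j k"

text \<open>The simplicial structure: the functor \<open>S\<^sub>n \<rightarrow> S\<^sub>m\<close> induced by a monotone map
  \<open>\<theta> : [m] \<rightarrow> [n]\<close>, with \<open>(\<theta>\<^sup>* A)\<^sub>i\<^sub>,\<^sub>j\<close> the entry of \<open>A\<close> at \<open>(\<theta> i, \<theta> j)\<close>.  If \<open>\<theta>\<close> omits \<open>k\<close> this
  omits the \<open>k\<close>-th row and column and composes (face \<open>\<partial>\<^sub>k\<close>); if \<open>\<theta>\<close> repeats \<open>k\<close> it doubles
  them via identities (degeneracy \<open>\<sigma>\<^sub>k\<close>).\<close>

definition diagram_pull ::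
  "('o, 'a) cat \<Rightarrow> nat \<Rightarrow> (nat \<Rightarrow> nat) \<Rightarrow> ('o, 'a) diagram \<Rightarrow> ('o, 'a) diagram" where
  "diagram_pull C m \<theta> D = \<lparr>
     vert = (\<lambda>i j. if i \<le> j \<and> j \<le> m then vert D (\<theta> i) (\<theta> j) else undefined),
     hor = (\<lambda>i j. if i \<le> j \<and> j < m
       then hor_path C D (\<theta> i) (\<theta> j) (\<theta> (j + 1) - \<theta> j) else undefined),
     ver = (\<lambda>i j. if i < j \<and> j \<le> m
       then ver_path C D (\<theta> i) (\<theta> j) (\<theta> (i + 1) - \<theta> i) else undefined)\<rparr>"

definition flag_pull ::
  "('o, 'a) cat \<Rightarrow> nat \<Rightarrow> (nat \<Rightarrow> nat) \<Rightarrow>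
   (('o, 'a) diagram, ('o, 'a) transf, ('o, 'a) diagram, ('o, 'a) transf) func" where
  "flag_pull C m \<theta> = \<lparr>
     on_Ob = diagram_pull C m \<theta>,
     on_Ar = (\<lambda>t. \<lparr>src = diagram_pull C m \<theta> (src t), tgt = diagram_pull C m \<theta> (tgt t),
       component = (\<lambda>i j. if i \<le> j \<and> j \<le> m then component t (\<theta> i) (\<theta> j) else undefined)\<rparr>)\<rparr>"

text \<open>Copies of a category and of a functor inside the universe \<open>univ\<close>.\<close>

definition small_cat :: "('o, 'a) cat \<Rightarrow> ('o + 'a) ucat" where
  "small_cat A = \<lparr>
     Ob = (Atom \<circ> Inl) ` Ob A,
     Ar = (Atom \<circ> Inr) ` Ar A,
     Dom = (\<lambda>f. Atom (Inl (Dom A (projr (the_Atom f))))),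
     Cod = (\<lambda>f. Atom (Inl (Cod A (projr (the_Atom f))))),
     Idt = (\<lambda>a. Atom (Inr (Idt A (projl (the_Atom a))))),
     Cmp = (\<lambda>g f. Atom (Inr (projr (the_Atom g) \<cdot>\<^bsub>A\<^esub> projr (the_Atom f))))\<rparr>"

definition small_func :: "('o, 'a, 'o, 'a) func \<Rightarrow> ('o + 'a) ufunc" where
  "small_func F = \<lparr>
     on_Ob = (\<lambda>a. Atom (Inl (on_Ob F (projl (the_Atom a))))),
     on_Ar = (\<lambda>f. Atom (Inr (on_Ar F (projr (the_Atom f)))))\<rparr>"

type_synonym ('o, 'a) flag_atom = "('o, 'a) diagram + ('o, 'a) transf"

text \<open>\<open>S\<^sub>I\<close> for a finite nonempty set \<open>I\<close> of natural numbers, and the functor \<open>S\<^sub>J \<rightarrow> S\<^sub>I\<close> induced by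
  an inclusion \<open>I \<subseteq> J\<close>, where \<open>vertex_incl\<close> is the inclusion under the order isomorphisms with
  \<open>[card I - 1]\<close> and \<open>[card J - 1]\<close>.\<close>

definition S_on :: "('o, 'a) cat \<Rightarrow> 'o \<Rightarrow> nat set \<Rightarrow> ('o, 'a) flag_atom ucat" where
  "S_on C z I = small_cat (flag_grpd C z (card I - 1))"

definition vertex_incl :: "nat set \<Rightarrow> nat set \<Rightarrow> nat \<Rightarrow> nat" where
  "vertex_incl I J i = card {x \<in> J. x < sorted_list_of_set I ! i}"

definition S_restrict :: "('o, 'a) cat \<Rightarrow> nat set \<Rightarrow> nat set \<Rightarrow> ('o, 'a) flag_atom ufunc" where
  "S_restrict C J I = small_func (flag_pull C (card I - 1) (vertex_incl I J))"

definition mult_span :: "('o, 'a) cat \<Rightarrow> 'o \<Rightarrow> ('o, 'a) flag_atom span" where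
  "mult_span C z = \<lparr>
     apex = S_on C z {0, 1, 2},
     lleg = pair_func (S_restrict C {0, 1, 2} {0, 1}) (S_restrict C {0, 1, 2} {1, 2}),
     rleg = S_restrict C {0, 1, 2} {0, 2}\<rparr>"

text \<open>The left leg of the unit is the isomorphism of the trivial groupoid \<open>S\<^sub>0\<close> with the monoidal
  unit, i.e. the identity once these are identified; the right leg is the degeneracy \<open>\<sigma>\<^sub>0\<close>,
  which sends the unique object to the flag with all entries \<open>0\<close>.\<close>

definition unit_span :: "('o, 'a) cat \<Rightarrow> 'o \<Rightarrow> ('o, 'a) flag_atom span" where
  "unit_span C z = \<lparr>
     apex = small_cat (flag_grpd C z 0),
     lleg = to_unit,
     rleg = small_func (flag_pull C 1 (\<lambda>_. 0))\<rparr>"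

end

theory Submission
  imports Defs
begin

text \<open>Both \<open>\<mu> \<circ> (\<mu> \<otimes> 1)\<close> and \<open>\<mu> \<circ> (1 \<otimes> \<mu>)\<close> are represented by the span with apex \<open>S\<^sub>3\<close> whose legs are
  \<open>(A\<^sub>0\<^sub>1, A\<^sub>1\<^sub>2, A\<^sub>2\<^sub>3)\<close> and \<open>A\<^sub>0\<^sub>3\<close>: cutting a square along either diagonal gives equivalences of \<open>S\<^sub>3\<close>
  with \<open>S\<^sub>0\<^sub>1\<^sub>2 \<times> S\<^sub>0\<^sub>2\<^sub>3\<close> and \<open>S\<^sub>0\<^sub>1\<^sub>3 \<times> S\<^sub>1\<^sub>2\<^sub>3\<close> over the groupoid of the diagonal.  In the first case the
  missing entry \<open>A\<^sub>1\<^sub>3\<close> is the pushout of \<open>A\<^sub>1\<^sub>2 \<leftarrow> A\<^sub>0\<^sub>2 \<rightarrow> A\<^sub>0\<^sub>3\<close>, in the second \<open>A\<^sub>0\<^sub>2\<close> is the pullback of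
  \<open>A\<^sub>1\<^sub>2 \<rightarrow> A\<^sub>1\<^sub>3 \<leftarrow> A\<^sub>0\<^sub>3\<close>; that the other squares are bicartesian follows by cancelling in a pasted
  square.  The unit laws hold because a short exact sequence with one end zero is degenerate.  Composition
  of classes of spans may be computed on representatives because a functor between groupoids is an
  equivalence iff it is fully faithful and essentially surjective, and this is checked directly for
  functors into 2-pullbacks.\<close>

section \<open>Isomorphisms and groupoids\<close>

text \<open>Comparing composites of spans means comparing 2-pullbacks, whose squares commute only up
  to a chosen isomorphism. Flags are rigid enough to avoid most of this: \<open>z\<close> is fixed
  on the diagonal, so a flag of length 1 is determined by one object, and every comparison functor
  out of flags commutes strictly with the legs. Isomorphisms matter only for essential surjectivity,
  where two triangles and an isomorphism \<phi> between their shared edges must come from a single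
  flag. There one triangle is kept unchanged and \<phi> is composed into an adjacent arrow, so that
  the other triangle is met up to isomorphism. The axioms divide evenly: cutting along 02 uses the
  existence of pushouts, cutting along 13 that of pullbacks, and the third axiom makes the squares
  so obtained bicartesian. The arrow that completes the flag is induced by a universal property and
  is epic (or monic) because a composite through it is. The associator never enters the argument
  about flags: precomposing with an invertible functor only rebrackets a left leg.\<close>

lemma homI: "f \<in> Ar A \<Longrightarrow> Dom A f = a \<Longrightarrow> Cod A f = b \<Longrightarrow> f \<in> hom A a b"
  by (simp add: hom_def)

lemma homD:
  assumes "f \<in> hom A a b"
  shows "f \<in> Ar A" "Dom A f = a" "Cod A f = b"
  using assms by (auto simp: hom_def)

definition inv_arr :: "('o, 'a, 'm) cat_scheme \<Rightarrow> 'a \<Rightarrow> 'a" where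
  "inv_arr C f = (SOME g. g \<in> hom C (Cod C f) (Dom C f) \<and>
     g \<cdot>\<^bsub>C\<^esub> f = Idt C (Dom C f) \<and> f \<cdot>\<^bsub>C\<^esub> g = Idt C (Cod C f))"

context category
begin

lemma hom_Ob:
  assumes "f \<in> hom C a b" shows "a \<in> Ob C" "b \<in> Ob C"
  using assms dom_Ob cod_Ob by (auto simp: hom_def)

lemma inv_arr:
  assumes "is_iso C f" and "f \<in> hom C a b"
  shows "inv_arr C f \<in> hom C b a" "inv_arr C f \<cdot> f = Idt C a" "f \<cdot> inv_arr C f = Idt C b"
proof -
  have "\<exists>g. g \<in> hom C (Cod C f) (Dom C f) \<and>
      g \<cdot> f = Idt C (Dom C f) \<and> f \<cdot> g = Idt C (Cod C f)"
    using assms(1) by (auto simp: is_iso_def)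
  from someI_ex[OF this, folded inv_arr_def]
  show "inv_arr C f \<in> hom C b a" "inv_arr C f \<cdot> f = Idt C a" "f \<cdot> inv_arr C f = Idt C b"
    using assms(2) by (auto simp: homD)
qed

lemma is_isoI:
  assumes "f \<in> hom C a b" "g \<in> hom C b a" "g \<cdot> f = Idt C a" "f \<cdot> g = Idt C b"
  shows "is_iso C f"
  using assms by (auto simp: is_iso_def hom_def)

lemma is_iso_Idt: "a \<in> Ob C \<Longrightarrow> is_iso C (Idt C a)"
  by (rule is_isoI) (auto intro: id_hom comp_id)

lemma is_iso_inv_arr:
  assumes "is_iso C f" shows "is_iso C (inv_arr C f)"
proof -
  have "f \<in> hom C (Dom C f) (Cod C f)" using assms by (auto simp: is_iso_def hom_def)
  then show ?thesis using inv_arr[OF assms] is_isoI by blast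
qed

lemma comp_inv_cancel:
  assumes "is_iso C f" and "f \<in> hom C a b"
  shows "g \<in> hom C x b \<Longrightarrow> f \<cdot> (inv_arr C f \<cdot> g) = g"
    and "g \<in> hom C x a \<Longrightarrow> inv_arr C f \<cdot> (f \<cdot> g) = g"
    and "h \<in> hom C a x \<Longrightarrow> (h \<cdot> inv_arr C f) \<cdot> f = h"
    and "h \<in> hom C b x \<Longrightarrow> (h \<cdot> f) \<cdot> inv_arr C f = h"
proof -
  note i = inv_arr[OF assms]
  show "f \<cdot> (inv_arr C f \<cdot> g) = g" if "g \<in> hom C x b"
    by (simp add: comp_assoc[OF that i(1) assms(2)] i id_comp[OF that])
  show "inv_arr C f \<cdot> (f \<cdot> g) = g" if "g \<in> hom C x a"
    by (simp add: comp_assoc[OF that assms(2) i(1)] i id_comp[OF that])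
  show "(h \<cdot> inv_arr C f) \<cdot> f = h" if "h \<in> hom C a x"
    by (simp add: comp_assoc[OF assms(2) i(1) that, symmetric] i comp_id[OF that])
  show "(h \<cdot> f) \<cdot> inv_arr C f = h" if "h \<in> hom C b x"
    by (simp add: comp_assoc[OF i(1) assms(2) that, symmetric] i comp_id[OF that])
qed

lemma iso_cancel_left:
  assumes "is_iso C f" and "f \<in> hom C a b" and "g \<in> hom C x a" and "h \<in> hom C x a"
    and "f \<cdot> g = f \<cdot> h"
  shows "g = h"
  using comp_inv_cancel(2)[OF assms(1,2)] assms(3-5) by metis

lemma iso_cancel_right:
  assumes "is_iso C f" and "f \<in> hom C a b" and "g \<in> hom C b x" and "h \<in> hom C b x"
    and "g \<cdot> f = h \<cdot> f"
  shows "g = h"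
  using comp_inv_cancel(4)[OF assms(1,2)] assms(3-5) by metis

lemma is_iso_comp:
  assumes "is_iso C f" "f \<in> hom C a b" "is_iso C g" "g \<in> hom C b c"
  shows "is_iso C (g \<cdot> f)"
proof (rule is_isoI)
  note i = inv_arr[OF assms(1,2)] and j = inv_arr[OF assms(3,4)]
  show gf: "g \<cdot> f \<in> hom C a c" by (rule comp_hom[OF assms(2,4)])
  show h: "inv_arr C f \<cdot> inv_arr C g \<in> hom C c a" by (rule comp_hom[OF j(1) i(1)])
  show "(inv_arr C f \<cdot> inv_arr C g) \<cdot> (g \<cdot> f) = Idt C a"
    by (simp add: comp_assoc[OF gf j(1) i(1), symmetric] comp_inv_cancel(2)[OF assms(3,4) assms(2)] i)
  show "(g \<cdot> f) \<cdot> (inv_arr C f \<cdot> inv_arr C g) = Idt C c"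
    by (simp add: comp_assoc[OF h assms(2,4), symmetric] comp_inv_cancel(1)[OF assms(1,2) j(1)] j)
qed

text \<open>The inverses of a family of isomorphisms are natural again. This is used for natural
  isomorphisms, for arrows of 2-pullbacks, for maps of pushouts and for morphisms of flags.\<close>

lemma inv_natural:
  assumes "is_iso C s" "s \<in> hom C a a'" "is_iso C t" "t \<in> hom C b b'"
    and "f \<in> hom C a b" "g \<in> hom C a' b'" and eq: "t \<cdot> f = g \<cdot> s"
  shows "inv_arr C t \<cdot> g = f \<cdot> inv_arr C s"
proof -
  note i = inv_arr[OF assms(1,2)] and j = inv_arr[OF assms(3,4)]
  have "inv_arr C t \<cdot> g = inv_arr C t \<cdot> ((g \<cdot> s) \<cdot> inv_arr C s)"
    by (simp add: comp_inv_cancel(4)[OF assms(1,2) assms(6)])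
  also have "\<dots> = inv_arr C t \<cdot> (t \<cdot> (f \<cdot> inv_arr C s))"
    by (simp add: eq[symmetric] comp_assoc[OF i(1) assms(5,4)])
  also have "\<dots> = f \<cdot> inv_arr C s"
    by (rule comp_inv_cancel(2)[OF assms(3,4)]) (rule comp_hom[OF i(1) assms(5)])
  finally show ?thesis .
qed

end

lemma (in groupoid) iso: "f \<in> hom C a b \<Longrightarrow> is_iso C f"
  by (simp add: all_iso homD)

section \<open>Functors and natural isomorphisms\<close>

lemma is_functorI:
  assumes "category A"
    and "\<And>a. a \<in> Ob A \<Longrightarrow> on_Ob F a \<in> Ob B"
    and "\<And>a b f. f \<in> hom A a b \<Longrightarrow> on_Ar F f \<in> hom B (on_Ob F a) (on_Ob F b)"
    and "\<And>a. a \<in> Ob A \<Longrightarrow> on_Ar F (Idt A a) = Idt B (on_Ob F a)"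
    and "\<And>a b c f g. f \<in> hom A a b \<Longrightarrow> g \<in> hom A b c \<Longrightarrow>
      on_Ar F (g \<cdot>\<^bsub>A\<^esub> f) = on_Ar F g \<cdot>\<^bsub>B\<^esub> on_Ar F f"
  shows "is_functor A B F"
  using assms by (auto simp: is_functor_def hom_def)

lemma is_functorD:
  assumes "is_functor A B F"
  shows functor_Ob: "a \<in> Ob A \<Longrightarrow> on_Ob F a \<in> Ob B"
    and functor_hom: "f \<in> hom A a b \<Longrightarrow> on_Ar F f \<in> hom B (on_Ob F a) (on_Ob F b)"
    and functor_id: "a \<in> Ob A \<Longrightarrow> on_Ar F (Idt A a) = Idt B (on_Ob F a)"
    and functor_comp: "f \<in> hom A a b \<Longrightarrow> g \<in> hom A b c \<Longrightarrow>
      on_Ar F (g \<cdot>\<^bsub>A\<^esub> f) = on_Ar F g \<cdot>\<^bsub>B\<^esub> on_Ar F f"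
  using assms by (auto simp: is_functor_def hom_def)

lemma comp_func_simps [simp]:
  "on_Ob (G \<circ>\<^sub>F F) a = on_Ob G (on_Ob F a)" "on_Ar (G \<circ>\<^sub>F F) f = on_Ar G (on_Ar F f)"
  by (simp_all add: comp_func_def)

lemma id_func_simps [simp]: "on_Ob id_func a = a" "on_Ar id_func f = f"
  by (simp_all add: id_func_def)

lemma is_functor_id: "category A \<Longrightarrow> is_functor A A id_func"
  by (rule is_functorI) (auto)

lemma is_functor_comp:
  assumes "category A" "is_functor A B F" "is_functor B D G"
  shows "is_functor A D (G \<circ>\<^sub>F F)"
proof (rule is_functorI)
  show "category A" by fact
  fix a b c f g
  show "a \<in> Ob A \<Longrightarrow> on_Ob (G \<circ>\<^sub>F F) a \<in> Ob D"
    using assms by (auto simp: functor_Ob)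
  show "f \<in> hom A a b \<Longrightarrow> on_Ar (G \<circ>\<^sub>F F) f \<in> hom D (on_Ob (G \<circ>\<^sub>F F) a) (on_Ob (G \<circ>\<^sub>F F) b)"
    using assms by (auto simp: functor_hom)
  show "a \<in> Ob A \<Longrightarrow> on_Ar (G \<circ>\<^sub>F F) (Idt A a) = Idt D (on_Ob (G \<circ>\<^sub>F F) a)"
    using assms by (auto simp: functor_Ob functor_id)
  assume fg: "f \<in> hom A a b" "g \<in> hom A b c"
  show "on_Ar (G \<circ>\<^sub>F F) (g \<cdot>\<^bsub>A\<^esub> f) = on_Ar (G \<circ>\<^sub>F F) g \<cdot>\<^bsub>D\<^esub> on_Ar (G \<circ>\<^sub>F F) f"
    by (simp add: functor_comp[OF assms(2) fg]
        functor_comp[OF assms(3) functor_hom[OF assms(2) fg(1)] functor_hom[OF assms(2) fg(2)]])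
qed

text \<open>The target being a groupoid supplies the invertibility of the components.\<close>

lemma nat_isomorphicI:
  assumes "category A" "groupoid B"
    and "\<And>a. a \<in> Ob A \<Longrightarrow> t a \<in> hom B (on_Ob F a) (on_Ob G a)"
    and "\<And>a b f. f \<in> hom A a b \<Longrightarrow> t b \<cdot>\<^bsub>B\<^esub> on_Ar F f = on_Ar G f \<cdot>\<^bsub>B\<^esub> t a"
  shows "nat_isomorphic A B F G"
  unfolding nat_isomorphic_def
proof (intro exI[of _ t] conjI ballI)
  show "t a \<in> hom B (on_Ob F a) (on_Ob G a)" "is_iso B (t a)" if "a \<in> Ob A" for a
    using assms(3)[OF that] groupoid.iso[OF assms(2)] by auto
  show "t (Cod A f) \<cdot>\<^bsub>B\<^esub> on_Ar F f = on_Ar G f \<cdot>\<^bsub>B\<^esub> t (Dom A f)" if "f \<in> Ar A" for f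
    using assms(4)[OF homI[OF that refl refl]] .
qed

lemma nat_isomorphicE:
  assumes "nat_isomorphic A B F G"
  obtains t where "\<And>a. a \<in> Ob A \<Longrightarrow> t a \<in> hom B (on_Ob F a) (on_Ob G a)"
    and "\<And>a b f. f \<in> hom A a b \<Longrightarrow> t b \<cdot>\<^bsub>B\<^esub> on_Ar F f = on_Ar G f \<cdot>\<^bsub>B\<^esub> t a"
  using assms unfolding nat_isomorphic_def by (force simp: hom_def)

lemma nat_isomorphic_eqI:
  assumes "category A" "groupoid B" "is_functor A B F"
    and "\<And>a. a \<in> Ob A \<Longrightarrow> on_Ob F a = on_Ob G a"
    and "\<And>a b f. f \<in> hom A a b \<Longrightarrow> on_Ar F f = on_Ar G f"
  shows "nat_isomorphic A B F G"
proof (rule nat_isomorphicI[where t = "\<lambda>a. Idt B (on_Ob F a)"])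
  interpret B: groupoid B by fact
  show "Idt B (on_Ob F a) \<in> hom B (on_Ob F a) (on_Ob G a)" if "a \<in> Ob A" for a
    using that by (simp add: assms(4)[symmetric] B.id_hom functor_Ob[OF assms(3)])
  show "Idt B (on_Ob F b) \<cdot>\<^bsub>B\<^esub> on_Ar F f = on_Ar G f \<cdot>\<^bsub>B\<^esub> Idt B (on_Ob F a)"
    if "f \<in> hom A a b" for a b f
    using functor_hom[OF assms(3) that] by (simp add: assms(5)[OF that, symmetric] B.id_comp B.comp_id)
qed fact+

lemma nat_isomorphic_refl:
  "category A \<Longrightarrow> groupoid B \<Longrightarrow> is_functor A B F \<Longrightarrow> nat_isomorphic A B F F"
  by (rule nat_isomorphic_eqI) auto

lemma nat_isomorphic_sym:
  assumes "category A" "groupoid B" "is_functor A B F" "is_functor A B G" "nat_isomorphic A B F G"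
  shows "nat_isomorphic A B G F"
proof -
  interpret A: category A by fact
  interpret B: groupoid B by fact
  obtain t where t: "\<And>a. a \<in> Ob A \<Longrightarrow> t a \<in> hom B (on_Ob F a) (on_Ob G a)"
    "\<And>a b f. f \<in> hom A a b \<Longrightarrow> t b \<cdot>\<^bsub>B\<^esub> on_Ar F f = on_Ar G f \<cdot>\<^bsub>B\<^esub> t a"
    using assms(5) by (rule nat_isomorphicE) blast
  show ?thesis
  proof (rule nat_isomorphicI[where t = "\<lambda>a. inv_arr B (t a)"])
    show "inv_arr B (t a) \<in> hom B (on_Ob G a) (on_Ob F a)" if "a \<in> Ob A" for a
      using B.inv_arr(1)[OF B.iso t(1)] t(1) that by blast
    show "inv_arr B (t b) \<cdot>\<^bsub>B\<^esub> on_Ar G f = on_Ar F f \<cdot>\<^bsub>B\<^esub> inv_arr B (t a)"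
      if f: "f \<in> hom A a b" for a b f
    proof -
      note a = t(1)[OF A.hom_Ob(1)[OF f]] and b = t(1)[OF A.hom_Ob(2)[OF f]]
      show ?thesis
        using B.inv_natural[OF B.iso[OF a] a B.iso[OF b] b functor_hom[OF assms(3) f]
            functor_hom[OF assms(4) f] t(2)[OF f]] .
    qed
  qed fact+
qed

lemma nat_isomorphic_trans:
  assumes "category A" "groupoid B" "is_functor A B F" "is_functor A B G" "is_functor A B H"
    and "nat_isomorphic A B F G" "nat_isomorphic A B G H"
  shows "nat_isomorphic A B F H"
proof -
  interpret A: category A by fact
  interpret B: groupoid B by fact
  obtain s where s: "\<And>a. a \<in> Ob A \<Longrightarrow> s a \<in> hom B (on_Ob F a) (on_Ob G a)"
    "\<And>a b f. f \<in> hom A a b \<Longrightarrow> s b \<cdot>\<^bsub>B\<^esub> on_Ar F f = on_Ar G f \<cdot>\<^bsub>B\<^esub> s a"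
    using assms(6) by (rule nat_isomorphicE) blast
  obtain t where t: "\<And>a. a \<in> Ob A \<Longrightarrow> t a \<in> hom B (on_Ob G a) (on_Ob H a)"
    "\<And>a b f. f \<in> hom A a b \<Longrightarrow> t b \<cdot>\<^bsub>B\<^esub> on_Ar G f = on_Ar H f \<cdot>\<^bsub>B\<^esub> t a"
    using assms(7) by (rule nat_isomorphicE) blast
  show ?thesis
  proof (rule nat_isomorphicI[where t = "\<lambda>a. t a \<cdot>\<^bsub>B\<^esub> s a"])
    show "t a \<cdot>\<^bsub>B\<^esub> s a \<in> hom B (on_Ob F a) (on_Ob H a)" if "a \<in> Ob A" for a
      using s(1)[OF that] t(1)[OF that] by (rule B.comp_hom)
    show "(t b \<cdot>\<^bsub>B\<^esub> s b) \<cdot>\<^bsub>B\<^esub> on_Ar F f = on_Ar H f \<cdot>\<^bsub>B\<^esub> (t a \<cdot>\<^bsub>B\<^esub> s a)"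
      if f: "f \<in> hom A a b" for a b f
    proof -
      note a = A.hom_Ob(1)[OF f] and b = A.hom_Ob(2)[OF f]
      note F = functor_hom[OF assms(3) f] and G = functor_hom[OF assms(4) f]
        and H = functor_hom[OF assms(5) f]
      show ?thesis
        using B.comp_assoc[OF F s(1)[OF b] t(1)[OF b]] B.comp_assoc[OF s(1)[OF a] G t(1)[OF b]]
          B.comp_assoc[OF s(1)[OF a] t(1)[OF a] H] s(2)[OF f] t(2)[OF f] by simp
    qed
  qed fact+
qed

lemma nat_isomorphic_whisker_right:
  assumes "category A" "groupoid D" "is_functor A B F" "nat_isomorphic B D G H"
  shows "nat_isomorphic A D (G \<circ>\<^sub>F F) (H \<circ>\<^sub>F F)"
proof -
  obtain t where t: "\<And>a. a \<in> Ob B \<Longrightarrow> t a \<in> hom D (on_Ob G a) (on_Ob H a)"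
    "\<And>a b f. f \<in> hom B a b \<Longrightarrow> t b \<cdot>\<^bsub>D\<^esub> on_Ar G f = on_Ar H f \<cdot>\<^bsub>D\<^esub> t a"
    using assms(4) by (rule nat_isomorphicE) blast
  show ?thesis
    by (rule nat_isomorphicI[where t = "\<lambda>a. t (on_Ob F a)"])
      (use assms t functor_Ob[OF assms(3)] functor_hom[OF assms(3)] in auto)
qed

lemma nat_isomorphic_whisker_left:
  assumes "category A" "groupoid D" "is_functor A B F" "is_functor A B G" "is_functor B D H"
    "nat_isomorphic A B F G"
  shows "nat_isomorphic A D (H \<circ>\<^sub>F F) (H \<circ>\<^sub>F G)"
proof -
  interpret A: category A by fact
  obtain t where t: "\<And>a. a \<in> Ob A \<Longrightarrow> t a \<in> hom B (on_Ob F a) (on_Ob G a)"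
    "\<And>a b f. f \<in> hom A a b \<Longrightarrow> t b \<cdot>\<^bsub>B\<^esub> on_Ar F f = on_Ar G f \<cdot>\<^bsub>B\<^esub> t a"
    using assms(6) by (rule nat_isomorphicE) blast
  show ?thesis
  proof (rule nat_isomorphicI[where t = "\<lambda>a. on_Ar H (t a)"])
    show "on_Ar H (t a) \<in> hom D (on_Ob (H \<circ>\<^sub>F F) a) (on_Ob (H \<circ>\<^sub>F G) a)" if "a \<in> Ob A" for a
      using functor_hom[OF assms(5) t(1)[OF that]] by simp
    show "on_Ar H (t b) \<cdot>\<^bsub>D\<^esub> on_Ar (H \<circ>\<^sub>F F) f = on_Ar (H \<circ>\<^sub>F G) f \<cdot>\<^bsub>D\<^esub> on_Ar H (t a)"
      if f: "f \<in> hom A a b" for a b f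
      using functor_comp[OF assms(5) functor_hom[OF assms(3) f] t(1)[OF A.hom_Ob(2)[OF f]]]
        functor_comp[OF assms(5) t(1)[OF A.hom_Ob(1)[OF f]] functor_hom[OF assms(4) f]]
        t(2)[OF f] by simp
  qed fact+
qed

lemma comp_func_assoc: "(H \<circ>\<^sub>F G) \<circ>\<^sub>F F = H \<circ>\<^sub>F (G \<circ>\<^sub>F F)"
  by (simp add: comp_func_def comp_assoc)

lemma comp_func_id [simp]: "F \<circ>\<^sub>F id_func = F" "id_func \<circ>\<^sub>F F = F"
  by (simp_all add: comp_func_def id_func_def o_def)

section \<open>Equivalences of groupoids\<close>

definition fully_faithful :: "('o, 'a) cat \<Rightarrow> ('p, 'b) cat \<Rightarrow> ('o, 'a, 'p, 'b) func \<Rightarrow> bool" where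
  "fully_faithful A B F \<longleftrightarrow> (\<forall>a \<in> Ob A. \<forall>b \<in> Ob A. \<forall>g \<in> hom B (on_Ob F a) (on_Ob F b).
     \<exists>!f. f \<in> hom A a b \<and> on_Ar F f = g)"

text \<open>No invertibility is asked of \<open>g\<close>, because in a groupoid target every arrow
  is invertible.\<close>

definition ess_surj :: "('o, 'a) cat \<Rightarrow> ('p, 'b) cat \<Rightarrow> ('o, 'a, 'p, 'b) func \<Rightarrow> bool" where
  "ess_surj A B F \<longleftrightarrow> (\<forall>b \<in> Ob B. \<exists>a \<in> Ob A. \<exists>g. g \<in> hom B (on_Ob F a) b)"

text \<open>\<open>fully_faithful\<close> does not include functoriality, so the faithful half has
  to be told that the image of \<open>f\<close> lies in the right hom set.\<close>

lemma fully_faithfulD: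
  assumes "fully_faithful A B F" "a \<in> Ob A" "b \<in> Ob A"
  shows fully_faithful_full: "g \<in> hom B (on_Ob F a) (on_Ob F b) \<Longrightarrow>
      \<exists>f. f \<in> hom A a b \<and> on_Ar F f = g"
    and fully_faithful_faithful: "f \<in> hom A a b \<Longrightarrow> f' \<in> hom A a b \<Longrightarrow>
      on_Ar F f \<in> hom B (on_Ob F a) (on_Ob F b) \<Longrightarrow> on_Ar F f = on_Ar F f' \<Longrightarrow> f = f'"
proof -
  have *: "\<exists>!f. f \<in> hom A a b \<and> on_Ar F f = g" if "g \<in> hom B (on_Ob F a) (on_Ob F b)" for g
    using assms that by (simp add: fully_faithful_def)
  show "\<exists>f. f \<in> hom A a b \<and> on_Ar F f = g" if "g \<in> hom B (on_Ob F a) (on_Ob F b)"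
    using *[OF that] by (rule ex1_implies_ex)
  show "f = f'" if "f \<in> hom A a b" "f' \<in> hom A a b"
    "on_Ar F f \<in> hom B (on_Ob F a) (on_Ob F b)" "on_Ar F f = on_Ar F f'"
    using *[OF that(3)] that(1,2,4) by metis
qed

text \<open>The quasi-inverse is built by choice: \<open>p b\<close> comes with an arrow
  \<open>e b\<close> from its image to \<open>b\<close>, and \<open>q g\<close> is the lift of
  \<open>g\<close> conjugated by \<open>e\<close>. Then \<open>e\<close> is one of the two natural
  isomorphisms, and lifting the arrows \<open>e (on_Ob F a)\<close> gives the other.\<close>

lemma cat_equivalenceI:
  assumes "groupoid A" "groupoid B" "is_functor A B F" "fully_faithful A B F" "ess_surj A B F"
  shows "cat_equivalence A B F"
proof -
  interpret A: groupoid A by fact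
  interpret B: groupoid B by fact
  note FO = functor_Ob[OF assms(3)] and FH = functor_hom[OF assms(3)]
    and FC = functor_comp[OF assms(3)] and FI = functor_id[OF assms(3)]
  have faith: "f = f'" if "f \<in> hom A a b" "f' \<in> hom A a b" "on_Ar F f = on_Ar F f'" for f f' a b
    using fully_faithful_faithful[OF assms(4) A.hom_Ob[OF that(1)] that(1,2) FH[OF that(1)] that(3)] .
  obtain p where p: "\<And>b. b \<in> Ob B \<Longrightarrow> p b \<in> Ob A \<and> (\<exists>g. g \<in> hom B (on_Ob F (p b)) b)"
    using assms(5) unfolding ess_surj_def by metis
  then obtain e where e: "\<And>b. b \<in> Ob B \<Longrightarrow> e b \<in> hom B (on_Ob F (p b)) b" by metis
  have ei: "inv_arr B (e b) \<in> hom B b (on_Ob F (p b))" if "b \<in> Ob B" for b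
    using B.inv_arr(1)[OF B.iso e] e that by blast
  have "\<exists>f. f \<in> hom A (p (Dom B g)) (p (Cod B g)) \<and>
      on_Ar F f = inv_arr B (e (Cod B g)) \<cdot>\<^bsub>B\<^esub> (g \<cdot>\<^bsub>B\<^esub> e (Dom B g))" if "g \<in> Ar B" for g
  proof (rule fully_faithful_full[OF assms(4)])
    have d: "Dom B g \<in> Ob B" "Cod B g \<in> Ob B" using that by (auto simp: B.dom_Ob B.cod_Ob)
    then show "p (Dom B g) \<in> Ob A" "p (Cod B g) \<in> Ob A" using p by auto
    show "inv_arr B (e (Cod B g)) \<cdot>\<^bsub>B\<^esub> (g \<cdot>\<^bsub>B\<^esub> e (Dom B g))
        \<in> hom B (on_Ob F (p (Dom B g))) (on_Ob F (p (Cod B g)))"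
      by (rule B.comp_hom[OF B.comp_hom[OF e[OF d(1)] homI[OF that refl refl]] ei[OF d(2)]])
  qed
  then obtain q where q: "\<And>g. g \<in> Ar B \<Longrightarrow> q g \<in> hom A (p (Dom B g)) (p (Cod B g)) \<and>
      on_Ar F (q g) = inv_arr B (e (Cod B g)) \<cdot>\<^bsub>B\<^esub> (g \<cdot>\<^bsub>B\<^esub> e (Dom B g))" by metis
  have qh: "q g \<in> hom A (p a) (p b)" if "g \<in> hom B a b" for g a b
    using q[of g] that by (auto simp: homD)
  have eq: "e b \<cdot>\<^bsub>B\<^esub> on_Ar F (q g) = g \<cdot>\<^bsub>B\<^esub> e a" if g: "g \<in> hom B a b" for g a b
  proof -
    note ab = B.hom_Ob[OF g]
    have "on_Ar F (q g) = inv_arr B (e b) \<cdot>\<^bsub>B\<^esub> (g \<cdot>\<^bsub>B\<^esub> e a)"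
      using q[of g] g by (auto simp: homD)
    then show ?thesis
      using B.comp_inv_cancel(1)[OF B.iso[OF e[OF ab(2)]] e[OF ab(2)] B.comp_hom[OF e[OF ab(1)] g]]
      by simp
  qed
  \<comment> \<open>The naturality square of \<open>e\<close> at \<open>g\<close> pins down
    \<open>q g\<close>, since \<open>e b\<close> can be cancelled and the functor is faithful.
    Functoriality of the quasi-inverse reduces to checking this square.\<close>
  have qI: "q g = f" if "f \<in> hom A (p a) (p b)" "e b \<cdot>\<^bsub>B\<^esub> on_Ar F f = g \<cdot>\<^bsub>B\<^esub> e a" "g \<in> hom B a b" for f g a b
  proof (rule faith[OF qh[OF that(3)] that(1)])
    note eb = e[OF B.hom_Ob(2)[OF that(3)]]
    show "on_Ar F (q g) = on_Ar F f"
      using eq[OF that(3)] that(2)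
      by (intro B.iso_cancel_left[OF B.iso[OF eb] eb FH[OF qh[OF that(3)]] FH[OF that(1)]]) simp
  qed
  define G where "G = \<lparr>on_Ob = p, on_Ar = q\<rparr>"
  have G: "is_functor B A G"
  proof (rule is_functorI)
    show "category B" by unfold_locales
    fix a b c f g
    show "a \<in> Ob B \<Longrightarrow> on_Ob G a \<in> Ob A" using p by (auto simp: G_def)
    show "f \<in> hom B a b \<Longrightarrow> on_Ar G f \<in> hom A (on_Ob G a) (on_Ob G b)"
      by (simp add: G_def qh)
    show "on_Ar G (Idt B a) = Idt A (on_Ob G a)" if a: "a \<in> Ob B"
      unfolding G_def using p[OF a] e[OF a]
      by (auto intro!: qI[OF A.id_hom _ B.id_hom[OF a]] simp: FI B.comp_id B.id_comp)
    assume f: "f \<in> hom B a b" and g: "g \<in> hom B b c"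
    have "e c \<cdot>\<^bsub>B\<^esub> on_Ar F (q g \<cdot>\<^bsub>A\<^esub> q f) = (e c \<cdot>\<^bsub>B\<^esub> on_Ar F (q g)) \<cdot>\<^bsub>B\<^esub> on_Ar F (q f)"
      using FC[OF qh[OF f] qh[OF g]] B.comp_assoc[OF FH[OF qh[OF f]] FH[OF qh[OF g]] e[OF B.hom_Ob(2)[OF g]]]
      by simp
    also have "\<dots> = g \<cdot>\<^bsub>B\<^esub> (f \<cdot>\<^bsub>B\<^esub> e a)"
      using B.comp_assoc[OF FH[OF qh[OF f]] e[OF B.hom_Ob(2)[OF f]] g] eq[OF f] eq[OF g] by simp
    also have "\<dots> = (g \<cdot>\<^bsub>B\<^esub> f) \<cdot>\<^bsub>B\<^esub> e a"
      by (rule B.comp_assoc[OF e[OF B.hom_Ob(1)[OF f]] f g])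
    finally show "on_Ar G (g \<cdot>\<^bsub>B\<^esub> f) = on_Ar G g \<cdot>\<^bsub>A\<^esub> on_Ar G f"
      by (auto simp: G_def intro!: qI[OF A.comp_hom[OF qh[OF f] qh[OF g]] _ B.comp_hom[OF f g]])
  qed
  have "\<exists>f. f \<in> hom A (p (on_Ob F a)) a \<and> on_Ar F f = e (on_Ob F a)" if "a \<in> Ob A" for a
    by (rule fully_faithful_full[OF assms(4)]) (use p[OF FO[OF that]] e[OF FO[OF that]] that in auto)
  then obtain h where h: "\<And>a. a \<in> Ob A \<Longrightarrow> h a \<in> hom A (p (on_Ob F a)) a \<and> on_Ar F (h a) = e (on_Ob F a)"
    by metis
  have "nat_isomorphic A A (G \<circ>\<^sub>F F) id_func"
  proof (rule nat_isomorphicI[where t = h])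
    show "h a \<in> hom A (on_Ob (G \<circ>\<^sub>F F) a) (on_Ob id_func a)" if "a \<in> Ob A" for a
      using h[OF that] by (simp add: G_def)
    show "h b \<cdot>\<^bsub>A\<^esub> on_Ar (G \<circ>\<^sub>F F) f = on_Ar id_func f \<cdot>\<^bsub>A\<^esub> h a" if f: "f \<in> hom A a b" for a b f
    proof -
      note a = conjunct1[OF h[OF A.hom_Ob(1)[OF f]]] and b = conjunct1[OF h[OF A.hom_Ob(2)[OF f]]]
      note a' = conjunct2[OF h[OF A.hom_Ob(1)[OF f]]] and b' = conjunct2[OF h[OF A.hom_Ob(2)[OF f]]]
      \<comment> \<open>Naturality of \<open>h\<close> is tested after applying the faithful
        functor, where it becomes naturality of \<open>e\<close>.\<close>
      have "h b \<cdot>\<^bsub>A\<^esub> q (on_Ar F f) = f \<cdot>\<^bsub>A\<^esub> h a"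
        by (rule faith[OF A.comp_hom[OF qh[OF FH[OF f]] b] A.comp_hom[OF a f]])
          (simp add: FC[OF qh[OF FH[OF f]] b] FC[OF a f] a' b' eq[OF FH[OF f]])
      then show ?thesis by (simp add: G_def)
    qed
  qed (unfold_locales)
  moreover have "nat_isomorphic B B (F \<circ>\<^sub>F G) id_func"
  proof (rule nat_isomorphicI[where t = e])
    show "e b \<in> hom B (on_Ob (F \<circ>\<^sub>F G) b) (on_Ob id_func b)" if "b \<in> Ob B" for b
      using e[OF that] by (simp add: G_def)
    show "e b \<cdot>\<^bsub>B\<^esub> on_Ar (F \<circ>\<^sub>F G) f = on_Ar id_func f \<cdot>\<^bsub>B\<^esub> e a" if "f \<in> hom B a b" for a b f
      using eq[OF that] by (simp add: G_def)
  qed unfold_locales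
  ultimately show ?thesis
    unfolding cat_equivalence_def using G assms(3) by blast
qed

section \<open>Equivalences are fully faithful and essentially surjective\<close>

lemma cat_equivalence_inverse:
  assumes "cat_equivalence A B F"
  obtains G where "cat_equivalence B A G" "is_functor A B F" "is_functor B A G"
    "nat_isomorphic A A (G \<circ>\<^sub>F F) id_func" "nat_isomorphic B B (F \<circ>\<^sub>F G) id_func"
  using assms unfolding cat_equivalence_def by blast

text \<open>Conjugating by the natural isomorphism recovers \<open>f\<close> from its image under
  both functors, so the first functor is injective on hom sets. Applied to the other round trip, it
  makes the quasi-inverse faithful.\<close>

lemma faithful_of_retraction:
  assumes "groupoid A" "nat_isomorphic A A (G \<circ>\<^sub>F F) id_func"
    and f: "f \<in> hom A a b" "f' \<in> hom A a b" and eq: "on_Ar F f = on_Ar F f'"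
  shows "f = f'"
proof -
  interpret A: groupoid A by fact
  obtain t where t: "\<And>a. a \<in> Ob A \<Longrightarrow> t a \<in> hom A (on_Ob G (on_Ob F a)) a"
    "\<And>a b f. f \<in> hom A a b \<Longrightarrow> t b \<cdot>\<^bsub>A\<^esub> on_Ar G (on_Ar F f) = f \<cdot>\<^bsub>A\<^esub> t a"
    using assms(2) by (rule nat_isomorphicE) (simp, blast)
  note ta = t(1)[OF A.hom_Ob(1)[OF f(1)]]
  show ?thesis
    by (rule A.iso_cancel_right[OF A.iso[OF ta] ta f]) (simp add: t(2)[OF f(1), symmetric] t(2)[OF f(2), symmetric] eq)
qed

lemma cat_equivalence_fully_faithful:
  assumes "groupoid A" "groupoid B" "cat_equivalence A B F"
  shows "fully_faithful A B F"
proof -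
  interpret A: groupoid A by fact
  interpret B: groupoid B by fact
  obtain G where F: "is_functor A B F" and G: "is_functor B A G"
    and GF: "nat_isomorphic A A (G \<circ>\<^sub>F F) id_func" and FG: "nat_isomorphic B B (F \<circ>\<^sub>F G) id_func"
    using assms(3) by (rule cat_equivalence_inverse)
  obtain t where t: "\<And>a. a \<in> Ob A \<Longrightarrow> t a \<in> hom A (on_Ob G (on_Ob F a)) a"
    "\<And>a b f. f \<in> hom A a b \<Longrightarrow> t b \<cdot>\<^bsub>A\<^esub> on_Ar G (on_Ar F f) = f \<cdot>\<^bsub>A\<^esub> t a"
    using GF by (rule nat_isomorphicE) (simp, blast)
  have full: "\<exists>f. f \<in> hom A a b \<and> on_Ar F f = g"
    if a: "a \<in> Ob A" and b: "b \<in> Ob A" and g: "g \<in> hom B (on_Ob F a) (on_Ob F b)" for a b g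
  proof -
    note ia = A.inv_arr[OF A.iso[OF t(1)[OF a]] t(1)[OF a]] and Gg = functor_hom[OF G g]
    note tG = A.comp_hom[OF Gg t(1)[OF b]]
    \<comment> \<open>The preimage of \<open>g\<close> is the image of \<open>g\<close> under the
      quasi-inverse, conjugated by \<open>t\<close>. That it maps to \<open>g\<close> is checked
      after applying the quasi-inverse, which is faithful.\<close>
    define f where "f = (t b \<cdot>\<^bsub>A\<^esub> on_Ar G g) \<cdot>\<^bsub>A\<^esub> inv_arr A (t a)"
    have f: "f \<in> hom A a b" unfolding f_def by (intro A.comp_hom[OF ia(1) tG])
    have "t b \<cdot>\<^bsub>A\<^esub> on_Ar G (on_Ar F f) = t b \<cdot>\<^bsub>A\<^esub> on_Ar G g"
      using t(2)[OF f] A.comp_inv_cancel(3)[OF A.iso[OF t(1)[OF a]] t(1)[OF a] tG] by (simp add: f_def)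
    then have "on_Ar G (on_Ar F f) = on_Ar G g"
      by (rule A.iso_cancel_left[OF A.iso[OF t(1)[OF b]] t(1)[OF b] functor_hom[OF G functor_hom[OF F f]] Gg])
    then have "on_Ar F f = g"
      by (rule faithful_of_retraction[OF assms(2) FG functor_hom[OF F f] g])
    with f show ?thesis by blast
  qed
  show ?thesis
    unfolding fully_faithful_def
    using full faithful_of_retraction[OF assms(1) GF] by (intro ballI ex_ex1I) blast+
qed

lemma cat_equivalence_ess_surj:
  assumes "cat_equivalence A B F"
  shows "ess_surj A B F"
proof -
  obtain G where F: "is_functor A B F" and G: "is_functor B A G"
    and FG: "nat_isomorphic B B (F \<circ>\<^sub>F G) id_func"
    using assms(1) by (rule cat_equivalence_inverse)
  from FG obtain t where t: "\<And>a. a \<in> Ob B \<Longrightarrow> t a \<in> hom B (on_Ob F (on_Ob G a)) a"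
    by (rule nat_isomorphicE) (simp, blast)
  show ?thesis
    unfolding ess_surj_def using functor_Ob[OF G] t by blast
qed

lemma cat_equivalence_functor: "cat_equivalence A B F \<Longrightarrow> is_functor A B F"
  by (simp add: cat_equivalence_def)

text \<open>Going through full faithfulness and essential surjectivity avoids pasting two
  quasi-inverses together with their natural isomorphisms.\<close>

lemma cat_equivalence_comp:
  assumes "groupoid A" "groupoid B" "groupoid D" "cat_equivalence A B F" "cat_equivalence B D G"
  shows "cat_equivalence A D (G \<circ>\<^sub>F F)"
proof (rule cat_equivalenceI)
  interpret A: groupoid A by fact
  interpret B: groupoid B by fact
  interpret D: groupoid D by fact
  note F = cat_equivalence_functor[OF assms(4)] and G = cat_equivalence_functor[OF assms(5)]
  note ffF = cat_equivalence_fully_faithful[OF assms(1,2,4)]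
    and ffG = cat_equivalence_fully_faithful[OF assms(2,3,5)]
  note eF = cat_equivalence_ess_surj[OF assms(4)] and eG = cat_equivalence_ess_surj[OF assms(5)]
  show "is_functor A D (G \<circ>\<^sub>F F)" by (rule is_functor_comp[OF _ F G]) unfold_locales
  show "fully_faithful A D (G \<circ>\<^sub>F F)"
    unfolding fully_faithful_def
  proof (intro ballI)
    fix a b g assume ab: "a \<in> Ob A" "b \<in> Ob A"
      and g: "g \<in> hom D (on_Ob (G \<circ>\<^sub>F F) a) (on_Ob (G \<circ>\<^sub>F F) b)"
    have "\<exists>!k. k \<in> hom B (on_Ob F a) (on_Ob F b) \<and> on_Ar G k = g"
      using ffG g functor_Ob[OF F ab(1)] functor_Ob[OF F ab(2)] by (simp add: fully_faithful_def)
    then obtain k where k: "k \<in> hom B (on_Ob F a) (on_Ob F b)" "on_Ar G k = g"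
      "\<And>k'. k' \<in> hom B (on_Ob F a) (on_Ob F b) \<Longrightarrow> on_Ar G k' = g \<Longrightarrow> k' = k" by blast
    have "\<exists>!f. f \<in> hom A a b \<and> on_Ar F f = k"
      using ffF ab k(1) by (simp add: fully_faithful_def)
    then obtain f where f: "f \<in> hom A a b" "on_Ar F f = k"
      "\<And>f'. f' \<in> hom A a b \<Longrightarrow> on_Ar F f' = k \<Longrightarrow> f' = f" by blast
    show "\<exists>!f. f \<in> hom A a b \<and> on_Ar (G \<circ>\<^sub>F F) f = g"
    proof (rule ex1I[of _ f])
      show "f' = f" if "f' \<in> hom A a b \<and> on_Ar (G \<circ>\<^sub>F F) f' = g" for f'
        using that by (intro f(3) k(3) functor_hom[OF F]) auto
    qed (simp add: f k)
  qed
  show "ess_surj A D (G \<circ>\<^sub>F F)"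
    unfolding ess_surj_def
  proof
    fix d assume "d \<in> Ob D"
    then obtain b g where b: "b \<in> Ob B" "g \<in> hom D (on_Ob G b) d"
      using eG unfolding ess_surj_def by blast
    then obtain a f where a: "a \<in> Ob A" "f \<in> hom B (on_Ob F a) b"
      using eF unfolding ess_surj_def by blast
    show "\<exists>a\<in>Ob A. \<exists>g. g \<in> hom D (on_Ob (G \<circ>\<^sub>F F) a) d"
      using a(1) D.comp_hom[OF functor_hom[OF G a(2)] b(2)] by auto
  qed
qed fact+

lemma cat_equivalence_id:
  assumes "groupoid A" shows "cat_equivalence A A id_func"
proof -
  interpret A: groupoid A by fact
  have "is_functor A A id_func" by (rule is_functor_id) unfold_locales
  moreover have "nat_isomorphic A A id_func id_func"
    by (rule nat_isomorphic_refl) (unfold_locales, fact)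
  ultimately show ?thesis unfolding cat_equivalence_def by (metis comp_func_id(1))
qed

section \<open>Products and 2-pullbacks\<close>

lemma (in category) square_paste:
  assumes "s \<in> hom C a a'" "t \<in> hom C b b'" "s' \<in> hom C a' a''" "t' \<in> hom C b' b''"
    "f \<in> hom C a b" "g \<in> hom C a' b'" "h \<in> hom C a'' b''"
    and "t \<cdot> f = g \<cdot> s" "t' \<cdot> g = h \<cdot> s'"
  shows "(t' \<cdot> t) \<cdot> f = h \<cdot> (s' \<cdot> s)"
  using comp_assoc[OF assms(5,2,4)] comp_assoc[OF assms(1,6,4)] comp_assoc[OF assms(1,3,7)] assms(8,9)
  by simp

lemma groupoidI:
  assumes "category A"
    and "\<And>a b f. f \<in> hom A a b \<Longrightarrow>
      \<exists>g. g \<in> hom A b a \<and> g \<cdot>\<^bsub>A\<^esub> f = Idt A a \<and> f \<cdot>\<^bsub>A\<^esub> g = Idt A b"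
  shows "groupoid A"
proof -
  interpret category A by fact
  show ?thesis
    by unfold_locales (use assms(2)[OF homI[OF _ refl refl]] in \<open>auto simp: is_iso_def\<close>)
qed

section \<open>Product groupoids and the unit groupoid\<close>

lemma prod_Ob [simp]: "Tup a b \<in> Ob (prod_grpd A B) \<longleftrightarrow> a \<in> Ob A \<and> b \<in> Ob B"
  by (auto simp: prod_grpd_def)

lemma prod_ObE:
  assumes "u \<in> Ob (prod_grpd A B)"
  obtains a b where "u = Tup a b" "a \<in> Ob A" "b \<in> Ob B"
  using assms by (auto simp: prod_grpd_def)

lemma prod_hom [simp]:
  "Tup f g \<in> hom (prod_grpd A B) (Tup a b) (Tup a' b') \<longleftrightarrow> f \<in> hom A a a' \<and> g \<in> hom B b b'"
  by (auto simp: prod_grpd_def hom_def)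

lemma prod_homE:
  assumes "t \<in> hom (prod_grpd A B) u v"
  obtains f g a b a' b' where "t = Tup f g" "u = Tup a b" "v = Tup a' b'"
    "f \<in> hom A a a'" "g \<in> hom B b b'"
  using assms by (auto simp: prod_grpd_def hom_def)

lemma prod_Idt [simp]: "Idt (prod_grpd A B) (Tup a b) = Tup (Idt A a) (Idt B b)"
  by (simp add: prod_grpd_def)

lemma prod_Cmp [simp]: "Tup f g \<cdot>\<^bsub>prod_grpd A B\<^esub> Tup f' g' = Tup (f \<cdot>\<^bsub>A\<^esub> f') (g \<cdot>\<^bsub>B\<^esub> g')"
  by (simp add: prod_grpd_def)

lemma groupoid_prod:
  assumes "groupoid A" "groupoid B"
  shows "groupoid (prod_grpd A B)"
proof -
  interpret A: groupoid A by fact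
  interpret B: groupoid B by fact
  show ?thesis
  proof (rule groupoidI)
    show "category (prod_grpd A B)"
    proof
      fix f assume "f \<in> Ar (prod_grpd A B)"
      then show "Dom (prod_grpd A B) f \<in> Ob (prod_grpd A B)" "Cod (prod_grpd A B) f \<in> Ob (prod_grpd A B)"
        by (auto simp: prod_grpd_def A.dom_Ob B.dom_Ob A.cod_Ob B.cod_Ob)
    qed (auto elim!: prod_homE prod_ObE intro: A.id_hom B.id_hom A.comp_hom B.comp_hom
        A.id_comp B.id_comp A.comp_id B.comp_id A.comp_assoc B.comp_assoc)
    fix t u v assume "t \<in> hom (prod_grpd A B) u v"
    then obtain f g a b a' b' where *: "t = Tup f g" "u = Tup a b" "v = Tup a' b'"
      and f: "f \<in> hom A a a'" and g: "g \<in> hom B b b'" by (rule prod_homE)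
    show "\<exists>s. s \<in> hom (prod_grpd A B) v u \<and> s \<cdot>\<^bsub>prod_grpd A B\<^esub> t = Idt (prod_grpd A B) u \<and>
        t \<cdot>\<^bsub>prod_grpd A B\<^esub> s = Idt (prod_grpd A B) v"
      by (rule exI[of _ "Tup (inv_arr A f) (inv_arr B g)"])
        (simp add: * A.inv_arr[OF A.iso[OF f] f] B.inv_arr[OF B.iso[OF g] g])
  qed
qed

lemma unit_grpd_simps [simp]:
  "a \<in> Ob unit_grpd \<longleftrightarrow> a = Star" "f \<in> hom unit_grpd a b \<longleftrightarrow> f = Star \<and> a = Star \<and> b = Star"
  "Idt unit_grpd a = Star" "f \<cdot>\<^bsub>unit_grpd\<^esub> g = Star"
  by (auto simp: unit_grpd_def hom_def)

lemma groupoid_unit: "groupoid unit_grpd"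
proof (rule groupoidI)
  show "category unit_grpd" by unfold_locales (auto simp: unit_grpd_def hom_def)
qed auto

lemma univ_func_simps [simp]:
  "on_Ob (prod_func F G) (Tup a b) = Tup (on_Ob F a) (on_Ob G b)"
  "on_Ar (prod_func F G) (Tup f g) = Tup (on_Ar F f) (on_Ar G g)"
  "on_Ob (pair_func F G) t = Tup (on_Ob F t) (on_Ob G t)"
  "on_Ar (pair_func F G) t = Tup (on_Ar F t) (on_Ar G t)"
  "on_Ob fst_func t = ufst t" "on_Ar fst_func t = ufst t"
  "on_Ob snd_func t = usnd t" "on_Ar snd_func t = usnd t"
  "on_Ob to_unit t = Star" "on_Ar to_unit t = Star"
  by (simp_all add: prod_func_def pair_func_def fst_func_def snd_func_def to_unit_def)

lemma prod_func_comp: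
  "prod_func F G \<circ>\<^sub>F prod_func F' G' = prod_func (F \<circ>\<^sub>F F') (G \<circ>\<^sub>F G')"
  by (simp add: prod_func_def comp_func_def o_def)

lemma is_functor_prod:
  assumes "groupoid A" "groupoid A'" "is_functor A B F" "is_functor A' B' F'"
  shows "is_functor (prod_grpd A A') (prod_grpd B B') (prod_func F F')"
proof (rule is_functorI)
  show "category (prod_grpd A A')"
    using groupoid_prod[OF assms(1,2)] by (simp add: groupoid_def)
qed (auto elim!: prod_homE prod_ObE simp: is_functorD[OF assms(3)] is_functorD[OF assms(4)])

lemma is_functor_pair:
  assumes "category A" "is_functor A B F" "is_functor A B' G"
  shows "is_functor A (prod_grpd B B') (pair_func F G)"
  using assms(1) by (rule is_functorI) (auto simp: is_functorD[OF assms(2)] is_functorD[OF assms(3)])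

lemma is_functor_fst: "groupoid A \<Longrightarrow> groupoid B \<Longrightarrow> is_functor (prod_grpd A B) A fst_func"
  by (rule is_functorI) (auto elim!: prod_homE prod_ObE intro: groupoid.axioms(1) groupoid_prod)

lemma is_functor_snd: "groupoid A \<Longrightarrow> groupoid B \<Longrightarrow> is_functor (prod_grpd A B) B snd_func"
  by (rule is_functorI) (auto elim!: prod_homE prod_ObE intro: groupoid.axioms(1) groupoid_prod)

lemma is_functor_to_unit: "category A \<Longrightarrow> is_functor A unit_grpd to_unit"
  by (rule is_functorI) auto

lemma nat_isomorphic_prod:
  assumes "groupoid A" "groupoid A'" "groupoid B" "groupoid B'"
    and "nat_isomorphic A B F G" "nat_isomorphic A' B' F' G'"
  shows "nat_isomorphic (prod_grpd A A') (prod_grpd B B') (prod_func F F') (prod_func G G')"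
proof -
  obtain t where t: "\<And>a. a \<in> Ob A \<Longrightarrow> t a \<in> hom B (on_Ob F a) (on_Ob G a)"
    "\<And>a b f. f \<in> hom A a b \<Longrightarrow> t b \<cdot>\<^bsub>B\<^esub> on_Ar F f = on_Ar G f \<cdot>\<^bsub>B\<^esub> t a"
    using assms(5) by (rule nat_isomorphicE) blast
  obtain t' where t': "\<And>a. a \<in> Ob A' \<Longrightarrow> t' a \<in> hom B' (on_Ob F' a) (on_Ob G' a)"
    "\<And>a b f. f \<in> hom A' a b \<Longrightarrow> t' b \<cdot>\<^bsub>B'\<^esub> on_Ar F' f = on_Ar G' f \<cdot>\<^bsub>B'\<^esub> t' a"
    using assms(6) by (rule nat_isomorphicE) blast
  show ?thesis
    by (rule nat_isomorphicI[where t = "\<lambda>u. Tup (t (ufst u)) (t' (usnd u))"])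
      (use t t' groupoid_prod[OF assms(1,2)] groupoid_prod[OF assms(3,4)]
        in \<open>auto elim!: prod_homE prod_ObE simp: groupoid_def\<close>)
qed

lemma cat_equivalence_prod:
  assumes "groupoid A" "groupoid A'" "groupoid B" "groupoid B'"
    and "cat_equivalence A B F" "cat_equivalence A' B' F'"
  shows "cat_equivalence (prod_grpd A A') (prod_grpd B B') (prod_func F F')"
proof -
  obtain G where G: "is_functor A B F" "is_functor B A G" "nat_isomorphic A A (G \<circ>\<^sub>F F) id_func"
    "nat_isomorphic B B (F \<circ>\<^sub>F G) id_func"
    using assms(5) by (rule cat_equivalence_inverse)
  obtain G' where G': "is_functor A' B' F'" "is_functor B' A' G'"
    "nat_isomorphic A' A' (G' \<circ>\<^sub>F F') id_func" "nat_isomorphic B' B' (F' \<circ>\<^sub>F G') id_func"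
    using assms(6) by (rule cat_equivalence_inverse)
  \<comment> \<open>Stated for arbitrary data, so that it serves for both round trips.\<close>
  have *: "nat_isomorphic (prod_grpd A A') (prod_grpd A A') (prod_func G G' \<circ>\<^sub>F prod_func F F') id_func"
    if "groupoid A" "groupoid A'" "groupoid B" "groupoid B'" "is_functor A B F" "is_functor B A G"
      "nat_isomorphic A A (G \<circ>\<^sub>F F) id_func" "is_functor A' B' F'" "is_functor B' A' G'"
      "nat_isomorphic A' A' (G' \<circ>\<^sub>F F') id_func"
    for A A' B B' :: "'x ucat" and F F' G G'
  proof -
    note gA = groupoid_prod[OF that(1,2)]
    have cA: "category (prod_grpd A A')" "category A" "category A'"
      using gA that by (simp_all add: groupoid_def)
    have "is_functor (prod_grpd A A') (prod_grpd A A') (prod_func (G \<circ>\<^sub>F F) (G' \<circ>\<^sub>F F'))"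
      by (rule is_functor_prod) (use that cA is_functor_comp in blast)+
    \<comment> \<open>\<open>prod_func id_func id_func\<close> agrees with \<open>id_func\<close>
      only on pairs, so the two are linked by a natural isomorphism and not by an equation of
      functors.\<close>
    moreover have i: "is_functor (prod_grpd A A') (prod_grpd A A') (prod_func id_func id_func)"
      by (rule is_functor_prod) (use that cA is_functor_id in blast)+
    ultimately show ?thesis
      unfolding prod_func_comp
      by (rule nat_isomorphic_trans[OF cA(1) gA _ _ is_functor_id[OF cA(1)] nat_isomorphic_prod[OF that(1,2,1,2,7,10)]])
        (rule nat_isomorphic_eqI[OF cA(1) gA i], auto elim!: prod_homE prod_ObE)
  qed
  show ?thesis
    unfolding cat_equivalence_def
  proof (intro conjI exI[of _ "prod_func G G'"])
    show "nat_isomorphic (prod_grpd A A') (prod_grpd A A') (prod_func G G' \<circ>\<^sub>F prod_func F F') id_func"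
      by (rule *[OF assms(1-4)]) (fact G G')+
    show "nat_isomorphic (prod_grpd B B') (prod_grpd B B') (prod_func F F' \<circ>\<^sub>F prod_func G G') id_func"
      by (rule *[OF assms(3,4,1,2)]) (fact G G')+
  qed (intro is_functor_prod assms G G')+
qed

section \<open>2-pullbacks of groupoids\<close>

lemma pullback2_Ob_eq [simp]: "Ob (pullback2 X Y B F G) = pullback2_Ob X Y B F G"
  by (simp add: pullback2_def)

lemma pullback2_Ob_iff:
  assumes "groupoid B"
  shows "Tup (Tup x y) \<phi> \<in> pullback2_Ob X Y B F G \<longleftrightarrow>
    x \<in> Ob X \<and> y \<in> Ob Y \<and> \<phi> \<in> hom B (on_Ob F x) (on_Ob G y)"
  using groupoid.iso[OF assms] by (auto simp: pullback2_Ob_def)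

lemma pullback2_ObE:
  assumes "u \<in> pullback2_Ob X Y B F G"
  obtains x y \<phi> where "u = Tup (Tup x y) \<phi>" "x \<in> Ob X" "y \<in> Ob Y"
    "\<phi> \<in> hom B (on_Ob F x) (on_Ob G y)"
  using assms by (auto simp: pullback2_Ob_def)

lemma pullback2_hom_iff:
  "Tup (Tup f g) (Tup u v) \<in> hom (pullback2 X Y B F G) u' v' \<longleftrightarrow> u' = u \<and> v' = v \<and>
    u \<in> pullback2_Ob X Y B F G \<and> v \<in> pullback2_Ob X Y B F G \<and>
    f \<in> hom X (ufst (ufst u)) (ufst (ufst v)) \<and> g \<in> hom Y (usnd (ufst u)) (usnd (ufst v)) \<and>
    on_Ar G g \<cdot>\<^bsub>B\<^esub> usnd u = usnd v \<cdot>\<^bsub>B\<^esub> on_Ar F f"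
  by (auto simp: pullback2_def hom_def)

lemma pullback2_homE:
  assumes "t \<in> hom (pullback2 X Y B F G) u v"
  obtains f g x y \<phi> x' y' \<phi>' where "t = Tup (Tup f g) (Tup u v)"
    "u = Tup (Tup x y) \<phi>" "x \<in> Ob X" "y \<in> Ob Y" "\<phi> \<in> hom B (on_Ob F x) (on_Ob G y)"
    "v = Tup (Tup x' y') \<phi>'" "x' \<in> Ob X" "y' \<in> Ob Y" "\<phi>' \<in> hom B (on_Ob F x') (on_Ob G y')"
    "u \<in> pullback2_Ob X Y B F G" "v \<in> pullback2_Ob X Y B F G"
    "f \<in> hom X x x'" "g \<in> hom Y y y'" "on_Ar G g \<cdot>\<^bsub>B\<^esub> \<phi> = \<phi>' \<cdot>\<^bsub>B\<^esub> on_Ar F f"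
proof -
  obtain f g where *: "t = Tup (Tup f g) (Tup u v)" "u \<in> pullback2_Ob X Y B F G" "v \<in> pullback2_Ob X Y B F G"
    "f \<in> hom X (ufst (ufst u)) (ufst (ufst v))" "g \<in> hom Y (usnd (ufst u)) (usnd (ufst v))"
    "on_Ar G g \<cdot>\<^bsub>B\<^esub> usnd u = usnd v \<cdot>\<^bsub>B\<^esub> on_Ar F f"
    using assms by (auto simp: pullback2_def hom_def)
  show thesis
    using *(2)
  proof (rule pullback2_ObE)
    fix x y \<phi> assume u: "u = Tup (Tup x y) \<phi>" "x \<in> Ob X" "y \<in> Ob Y" "\<phi> \<in> hom B (on_Ob F x) (on_Ob G y)"
    show thesis
      using *(3)
    proof (rule pullback2_ObE)
      fix x' y' \<phi>' assume v: "v = Tup (Tup x' y') \<phi>'" "x' \<in> Ob X" "y' \<in> Ob Y"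
        "\<phi>' \<in> hom B (on_Ob F x') (on_Ob G y')"
      show thesis
        using that[OF *(1) u v *(2,3)] *(4-6) u(1) v(1) by simp
    qed
  qed
qed

lemma pullback2_Idt [simp]:
  "Idt (pullback2 X Y B F G) (Tup (Tup x y) \<phi>) =
    Tup (Tup (Idt X x) (Idt Y y)) (Tup (Tup (Tup x y) \<phi>) (Tup (Tup x y) \<phi>))"
  by (simp add: pullback2_def)

lemma pullback2_Cmp [simp]:
  "Tup (Tup f g) (Tup u v) \<cdot>\<^bsub>pullback2 X Y B F G\<^esub> Tup (Tup f' g') (Tup u' v') =
    Tup (Tup (f \<cdot>\<^bsub>X\<^esub> f') (g \<cdot>\<^bsub>Y\<^esub> g')) (Tup u' v)"
  by (simp add: pullback2_def)

lemma groupoid_pullback2: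
  assumes "groupoid X" "groupoid Y" "groupoid B" "is_functor X B F" "is_functor Y B G"
  shows "groupoid (pullback2 X Y B F G)"
proof -
  interpret X: groupoid X by fact
  interpret Y: groupoid Y by fact
  interpret B: groupoid B by fact
  let ?P = "pullback2 X Y B F G"
  note F = is_functorD[OF assms(4)] and G = is_functorD[OF assms(5)]
  show ?thesis
  proof (rule groupoidI)
    show "category ?P"
    proof
      fix f assume "f \<in> Ar ?P"
      then show "Dom ?P f \<in> Ob ?P" "Cod ?P f \<in> Ob ?P"
        by (auto simp: pullback2_def)
    next
      fix a assume "a \<in> Ob ?P"
      then have a: "a \<in> pullback2_Ob X Y B F G" by simp
      then show "Idt ?P a \<in> hom ?P a a"
        by (rule pullback2_ObE)
          (use a in \<open>auto simp: pullback2_hom_iff F G X.id_hom Y.id_hom B.id_comp B.comp_id\<close>)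
    next
      fix f g a b c assume f: "f \<in> hom ?P a b" and g: "g \<in> hom ?P b c"
      obtain f1 f2 x y \<phi> x' y' \<phi>' where f1: "f = Tup (Tup f1 f2) (Tup a b)"
        "a = Tup (Tup x y) \<phi>" "x \<in> Ob X" "y \<in> Ob Y" "\<phi> \<in> hom B (on_Ob F x) (on_Ob G y)"
        "b = Tup (Tup x' y') \<phi>'" "x' \<in> Ob X" "y' \<in> Ob Y" "\<phi>' \<in> hom B (on_Ob F x') (on_Ob G y')"
        "a \<in> pullback2_Ob X Y B F G" "b \<in> pullback2_Ob X Y B F G"
        "f1 \<in> hom X x x'" "f2 \<in> hom Y y y'" "on_Ar G f2 \<cdot>\<^bsub>B\<^esub> \<phi> = \<phi>' \<cdot>\<^bsub>B\<^esub> on_Ar F f1"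
        using f by (rule pullback2_homE)
      obtain g1 g2 x'' y'' \<phi>'' where g1: "g = Tup (Tup g1 g2) (Tup b c)"
        "c = Tup (Tup x'' y'') \<phi>''" "\<phi>'' \<in> hom B (on_Ob F x'') (on_Ob G y'')"
        "c \<in> pullback2_Ob X Y B F G"
        "g1 \<in> hom X x' x''" "g2 \<in> hom Y y' y''" "on_Ar G g2 \<cdot>\<^bsub>B\<^esub> \<phi>' = \<phi>'' \<cdot>\<^bsub>B\<^esub> on_Ar F g1"
        using g by (rule pullback2_homE) (use f1(6) in auto)
      have "(on_Ar G g2 \<cdot>\<^bsub>B\<^esub> on_Ar G f2) \<cdot>\<^bsub>B\<^esub> \<phi> = \<phi>'' \<cdot>\<^bsub>B\<^esub> (on_Ar F g1 \<cdot>\<^bsub>B\<^esub> on_Ar F f1)"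
        by (rule B.square_paste[OF F(2)[OF f1(12)] G(2)[OF f1(13)] F(2)[OF g1(5)] G(2)[OF g1(6)]
              f1(5) f1(9) g1(3) f1(14) g1(7)])
      then show "g \<cdot>\<^bsub>?P\<^esub> f \<in> hom ?P a c"
        using f1 g1 by (auto simp: pullback2_hom_iff F(4)[OF f1(12) g1(5)] G(4)[OF f1(13) g1(6)]
            intro: X.comp_hom Y.comp_hom)
    qed (auto elim!: pullback2_homE intro: X.id_comp Y.id_comp X.comp_id Y.comp_id
        X.comp_assoc Y.comp_assoc)
    fix t u v assume "t \<in> hom ?P u v"
    then obtain f g x y \<phi> x' y' \<phi>' where *: "t = Tup (Tup f g) (Tup u v)"
      "u = Tup (Tup x y) \<phi>" "x \<in> Ob X" "y \<in> Ob Y" "\<phi> \<in> hom B (on_Ob F x) (on_Ob G y)"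
      "v = Tup (Tup x' y') \<phi>'" "x' \<in> Ob X" "y' \<in> Ob Y" "\<phi>' \<in> hom B (on_Ob F x') (on_Ob G y')"
      "u \<in> pullback2_Ob X Y B F G" "v \<in> pullback2_Ob X Y B F G"
      "f \<in> hom X x x'" "g \<in> hom Y y y'" "on_Ar G g \<cdot>\<^bsub>B\<^esub> \<phi> = \<phi>' \<cdot>\<^bsub>B\<^esub> on_Ar F f"
      by (rule pullback2_homE)
    note fi = X.inv_arr[OF X.iso[OF *(12)] *(12)] and gi = Y.inv_arr[OF Y.iso[OF *(13)] *(13)]
    \<comment> \<open>\<open>inv_arr\<close> is a choice of inverse, so its compatibility with a
      functor is obtained by cancelling the image of \<open>f\<close>.\<close>
    have Ff: "on_Ar F (inv_arr X f) = inv_arr B (on_Ar F f)"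
      using F(4)[OF *(12) fi(1)] fi F(3)[OF *(3)] B.inv_arr[OF B.iso F(2)[OF *(12)]] F(2)[OF *(12)]
      by (intro B.iso_cancel_right[OF B.iso[OF F(2)[OF *(12)]] F(2)[OF *(12)] F(2)[OF fi(1)]]) auto
    have Gg: "on_Ar G (inv_arr Y g) = inv_arr B (on_Ar G g)"
      using G(4)[OF *(13) gi(1)] gi G(3)[OF *(4)] B.inv_arr[OF B.iso G(2)[OF *(13)]] G(2)[OF *(13)]
      by (intro B.iso_cancel_right[OF B.iso[OF G(2)[OF *(13)]] G(2)[OF *(13)] G(2)[OF gi(1)]]) auto
    have "on_Ar G (inv_arr Y g) \<cdot>\<^bsub>B\<^esub> \<phi>' = \<phi> \<cdot>\<^bsub>B\<^esub> on_Ar F (inv_arr X f)"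
      unfolding Ff Gg using F(2)[OF *(12)] G(2)[OF *(13)] * B.iso
      by (intro B.inv_natural) auto
    then show "\<exists>s. s \<in> hom ?P v u \<and> s \<cdot>\<^bsub>?P\<^esub> t = Idt ?P u \<and> t \<cdot>\<^bsub>?P\<^esub> s = Idt ?P v"
      using * fi gi
      by (intro exI[of _ "Tup (Tup (inv_arr X f) (inv_arr Y g)) (Tup v u)"])
        (auto simp: pullback2_hom_iff)
  qed
qed

lemma is_functor_pullback2_fst:
  assumes "groupoid X" "groupoid Y" "groupoid B" "is_functor X B F" "is_functor Y B G"
  shows "is_functor (pullback2 X Y B F G) X (fst_func \<circ>\<^sub>F fst_func)"
proof (rule is_functorI)
  show "category (pullback2 X Y B F G)"
    using groupoid_pullback2[OF assms] by (simp add: groupoid_def)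
qed (auto elim!: pullback2_ObE pullback2_homE)

lemma is_functor_pullback2_snd:
  assumes "groupoid X" "groupoid Y" "groupoid B" "is_functor X B F" "is_functor Y B G"
  shows "is_functor (pullback2 X Y B F G) Y (snd_func \<circ>\<^sub>F fst_func)"
proof (rule is_functorI)
  show "category (pullback2 X Y B F G)"
    using groupoid_pullback2[OF assms] by (simp add: groupoid_def)
qed (auto elim!: pullback2_ObE pullback2_homE)

text \<open>The functor into a 2-pullback induced by \<open>P\<close>, \<open>Q\<close> and a
  natural isomorphism \<theta>. Arrows of the 2-pullback carry their end points, which are read off
  from \<open>Dom\<close> and \<open>Cod\<close> in \<open>Z\<close>.\<close>

definition pullback2_func ::
  "'x ucat \<Rightarrow> 'x ufunc \<Rightarrow> 'x ufunc \<Rightarrow> ('x univ \<Rightarrow> 'x univ) \<Rightarrow> 'x ufunc" where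
  "pullback2_func Z P Q \<theta> = (let ob = (\<lambda>z. Tup (Tup (on_Ob P z) (on_Ob Q z)) (\<theta> z)) in
     \<lparr>on_Ob = ob, on_Ar = (\<lambda>h. Tup (Tup (on_Ar P h) (on_Ar Q h)) (Tup (ob (Dom Z h)) (ob (Cod Z h))))\<rparr>)"

text \<open>\<open>full\<close>, \<open>faithful\<close> and \<open>es\<close> express that the
  induced functor is fully faithful and essentially surjective. They are phrased with separate
  arrows \<open>f\<close> and \<open>g\<close>, so that applications never meet the coded
  tuples.\<close>

lemma cat_equivalence_pullback2_func:
  assumes gr: "groupoid X" "groupoid Y" "groupoid B" "groupoid Z"
    and FG: "is_functor X B F" "is_functor Y B G" and PQ: "is_functor Z X P" "is_functor Z Y Q"
    and \<theta>: "\<And>z. z \<in> Ob Z \<Longrightarrow> \<theta> z \<in> hom B (on_Ob F (on_Ob P z)) (on_Ob G (on_Ob Q z))"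
      "\<And>z z' h. h \<in> hom Z z z' \<Longrightarrow>
        on_Ar G (on_Ar Q h) \<cdot>\<^bsub>B\<^esub> \<theta> z = \<theta> z' \<cdot>\<^bsub>B\<^esub> on_Ar F (on_Ar P h)"
    and full: "\<And>z z' f g. z \<in> Ob Z \<Longrightarrow> z' \<in> Ob Z \<Longrightarrow>
        f \<in> hom X (on_Ob P z) (on_Ob P z') \<Longrightarrow> g \<in> hom Y (on_Ob Q z) (on_Ob Q z') \<Longrightarrow>
        on_Ar G g \<cdot>\<^bsub>B\<^esub> \<theta> z = \<theta> z' \<cdot>\<^bsub>B\<^esub> on_Ar F f \<Longrightarrow>
        \<exists>h. h \<in> hom Z z z' \<and> on_Ar P h = f \<and> on_Ar Q h = g"
    and faithful: "\<And>z z' h h'. h \<in> hom Z z z' \<Longrightarrow> h' \<in> hom Z z z' \<Longrightarrow>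
        on_Ar P h = on_Ar P h' \<Longrightarrow> on_Ar Q h = on_Ar Q h' \<Longrightarrow> h = h'"
    and es: "\<And>x y \<phi>. x \<in> Ob X \<Longrightarrow> y \<in> Ob Y \<Longrightarrow> \<phi> \<in> hom B (on_Ob F x) (on_Ob G y) \<Longrightarrow>
        \<exists>z f g. z \<in> Ob Z \<and> f \<in> hom X (on_Ob P z) x \<and> g \<in> hom Y (on_Ob Q z) y \<and>
          on_Ar G g \<cdot>\<^bsub>B\<^esub> \<theta> z = \<phi> \<cdot>\<^bsub>B\<^esub> on_Ar F f"
  shows "cat_equivalence Z (pullback2 X Y B F G) (pullback2_func Z P Q \<theta>)"
proof (rule cat_equivalenceI)
  interpret Z: groupoid Z by fact
  interpret B: groupoid B by fact
  let ?P = "pullback2 X Y B F G" and ?E = "pullback2_func Z P Q \<theta>"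
  show "groupoid ?P" by (rule groupoid_pullback2[OF gr(1-3) FG])
  have EO: "on_Ob ?E z = Tup (Tup (on_Ob P z) (on_Ob Q z)) (\<theta> z)" for z
    by (simp add: pullback2_func_def Let_def)
  have EA: "on_Ar ?E h = Tup (Tup (on_Ar P h) (on_Ar Q h)) (Tup (on_Ob ?E z) (on_Ob ?E z'))"
    if "h \<in> hom Z z z'" for h z z'
    using that by (simp add: pullback2_func_def Let_def homD)
  have EOb: "on_Ob ?E z \<in> pullback2_Ob X Y B F G" if "z \<in> Ob Z" for z
    by (simp add: EO pullback2_Ob_iff[OF gr(3)] functor_Ob[OF PQ(1) that] functor_Ob[OF PQ(2) that]
        \<theta>(1) that)
  show "is_functor Z ?P ?E"
  proof (rule is_functorI)
    show "category Z" by unfold_locales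
    fix a b c f g
    show "a \<in> Ob Z \<Longrightarrow> on_Ob ?E a \<in> Ob ?P" by (simp add: EOb)
    show "on_Ar ?E f \<in> hom ?P (on_Ob ?E a) (on_Ob ?E b)" if f: "f \<in> hom Z a b"
      using Z.hom_Ob[OF f] f EOb
      by (simp add: EA[OF f] pullback2_hom_iff, simp add: EO functor_hom[OF PQ(1)] functor_hom[OF PQ(2)] \<theta>)
    show "on_Ar ?E (Idt Z a) = Idt ?P (on_Ob ?E a)" if a: "a \<in> Ob Z"
      by (simp add: EA[OF Z.id_hom[OF a]] EO functor_id[OF PQ(1) a] functor_id[OF PQ(2) a])
    show "on_Ar ?E (g \<cdot>\<^bsub>Z\<^esub> f) = on_Ar ?E g \<cdot>\<^bsub>?P\<^esub> on_Ar ?E f" if f: "f \<in> hom Z a b" and g: "g \<in> hom Z b c"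
      by (simp add: EA[OF f] EA[OF g] EA[OF Z.comp_hom[OF f g]] functor_comp[OF PQ(1) f g]
          functor_comp[OF PQ(2) f g])
  qed
  show "fully_faithful Z ?P ?E"
    unfolding fully_faithful_def
  proof (intro ballI)
    fix z z' k assume z: "z \<in> Ob Z" "z' \<in> Ob Z" and k: "k \<in> hom ?P (on_Ob ?E z) (on_Ob ?E z')"
    from k obtain f g where kfg: "k = Tup (Tup f g) (Tup (on_Ob ?E z) (on_Ob ?E z'))"
      and fg: "f \<in> hom X (on_Ob P z) (on_Ob P z')" "g \<in> hom Y (on_Ob Q z) (on_Ob Q z')"
      "on_Ar G g \<cdot>\<^bsub>B\<^esub> \<theta> z = \<theta> z' \<cdot>\<^bsub>B\<^esub> on_Ar F f"
      by (rule pullback2_homE) (auto simp: EO)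
    obtain h where h: "h \<in> hom Z z z'" "on_Ar P h = f" "on_Ar Q h = g"
      using full[OF z fg] by blast
    show "\<exists>!h. h \<in> hom Z z z' \<and> on_Ar ?E h = k"
    proof (rule ex1I[of _ h])
      show "h \<in> hom Z z z' \<and> on_Ar ?E h = k"
        using h by (simp add: EA[OF h(1)] kfg)
      show "h' = h" if "h' \<in> hom Z z z' \<and> on_Ar ?E h' = k" for h'
        using that h by (intro faithful[of h' z z' h]) (auto simp: EA kfg)
    qed
  qed
  show "ess_surj Z ?P ?E"
    unfolding ess_surj_def
  proof
    fix b assume "b \<in> Ob ?P"
    then have b: "b \<in> pullback2_Ob X Y B F G" by simp
    then obtain x y \<phi> where xy: "b = Tup (Tup x y) \<phi>" "x \<in> Ob X" "y \<in> Ob Y"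
      "\<phi> \<in> hom B (on_Ob F x) (on_Ob G y)" by (rule pullback2_ObE)
    obtain z f g where z: "z \<in> Ob Z" and "f \<in> hom X (on_Ob P z) x" "g \<in> hom Y (on_Ob Q z) y"
      "on_Ar G g \<cdot>\<^bsub>B\<^esub> \<theta> z = \<phi> \<cdot>\<^bsub>B\<^esub> on_Ar F f" using es[OF xy(2-4)] by blast
    then have "Tup (Tup f g) (Tup (on_Ob ?E z) b) \<in> hom ?P (on_Ob ?E z) b"
      using b EOb[OF z] xy(1) by (simp add: pullback2_hom_iff EO)
    with z show "\<exists>a\<in>Ob Z. \<exists>g. g \<in> hom ?P (on_Ob ?E a) b" by blast
  qed
qed fact+

section \<open>Spans\<close>

lemma is_spanD:
  assumes "is_span A B S"
  shows "groupoid (apex S)" "category (apex S)" "is_functor (apex S) A (lleg S)" "is_functor (apex S) B (rleg S)"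
  using assms by (auto simp: is_span_def intro: groupoid.axioms(1))

section \<open>Span equivalence as an equivalence relation\<close>

lemma span_equivI:
  "cat_equivalence (apex S) (apex T) E \<Longrightarrow> nat_isomorphic (apex S) A (lleg T \<circ>\<^sub>F E) (lleg S) \<Longrightarrow>
    nat_isomorphic (apex S) B (rleg T \<circ>\<^sub>F E) (rleg S) \<Longrightarrow> span_equiv A B S T"
  by (auto simp: span_equiv_def)

lemma span_equiv_refl:
  assumes "groupoid A" "groupoid B" "is_span A B S"
  shows "span_equiv A B S S"
  by (rule span_equivI[OF cat_equivalence_id])
    (use assms is_spanD[OF assms(3)] in \<open>auto intro: nat_isomorphic_refl\<close>)

text \<open>With \<open>G\<close> a quasi-inverse of \<open>E\<close>, the leg \<open>l\<close>
  after \<open>G\<close> is isomorphic to \<open>l'\<close> after \<open>E\<close> after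
  \<open>G\<close>, hence to \<open>l'\<close>. This turns the comparison of legs around for the
  symmetry of span equivalence.\<close>

lemma leg_inverse:
  assumes "groupoid A" "groupoid X" "groupoid Y" "is_functor X A l" "is_functor Y A l'"
    and "is_functor X Y E" "is_functor Y X G" "nat_isomorphic Y Y (E \<circ>\<^sub>F G) id_func"
    and "nat_isomorphic X A (l' \<circ>\<^sub>F E) l"
  shows "nat_isomorphic Y A (l \<circ>\<^sub>F G) l'"
proof -
  have c: "category X" "category Y" "category A" using assms(1-3) by (auto intro: groupoid.axioms(1))
  note fEG = is_functor_comp[OF c(2) assms(7,6)] and flE = is_functor_comp[OF c(1) assms(6,5)]
  have f1: "is_functor Y A (l \<circ>\<^sub>F G)" by (rule is_functor_comp[OF c(2) assms(7,4)])
  have f2: "is_functor Y A ((l' \<circ>\<^sub>F E) \<circ>\<^sub>F G)"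
    by (rule is_functor_comp[OF c(2) assms(7) flE])
  have "nat_isomorphic Y A ((l' \<circ>\<^sub>F E) \<circ>\<^sub>F G) (l \<circ>\<^sub>F G)"
    by (rule nat_isomorphic_whisker_right[OF c(2) assms(1,7,9)])
  then have "nat_isomorphic Y A (l \<circ>\<^sub>F G) ((l' \<circ>\<^sub>F E) \<circ>\<^sub>F G)"
    by (rule nat_isomorphic_sym[OF c(2) assms(1) f2 f1])
  moreover have "nat_isomorphic Y A ((l' \<circ>\<^sub>F E) \<circ>\<^sub>F G) l'"
    using nat_isomorphic_whisker_left[OF c(2) assms(1) fEG is_functor_id[OF c(2)] assms(5,8)]
    by (simp add: comp_func_assoc)
  ultimately show ?thesis
    by (rule nat_isomorphic_trans[OF c(2) assms(1) f1 f2 assms(5)])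
qed

lemma span_equiv_sym:
  assumes "groupoid A" "groupoid B" "is_span A B S" "is_span A B T" "span_equiv A B S T"
  shows "span_equiv A B T S"
proof -
  obtain E where E: "cat_equivalence (apex S) (apex T) E"
    "nat_isomorphic (apex S) A (lleg T \<circ>\<^sub>F E) (lleg S)"
    "nat_isomorphic (apex S) B (rleg T \<circ>\<^sub>F E) (rleg S)"
    using assms(5) by (auto simp: span_equiv_def)
  obtain G where G: "cat_equivalence (apex T) (apex S) G" "is_functor (apex S) (apex T) E"
    "is_functor (apex T) (apex S) G" "nat_isomorphic (apex T) (apex T) (E \<circ>\<^sub>F G) id_func"
    using E(1) by (rule cat_equivalence_inverse)
  note S = is_spanD[OF assms(3)] and T = is_spanD[OF assms(4)]
  show ?thesis
    using G(1) leg_inverse[OF assms(1) S(1) T(1) S(3) T(3) G(2-4) E(2)]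
      leg_inverse[OF assms(2) S(1) T(1) S(4) T(4) G(2-4) E(3)] by (rule span_equivI)
qed

lemma span_equiv_trans:
  assumes "groupoid A" "groupoid B" "is_span A B S" "is_span A B T" "is_span A B U"
    and "span_equiv A B S T" "span_equiv A B T U"
  shows "span_equiv A B S U"
proof -
  note S = is_spanD[OF assms(3)] and T = is_spanD[OF assms(4)] and U = is_spanD[OF assms(5)]
  obtain E where E: "cat_equivalence (apex S) (apex T) E"
    "nat_isomorphic (apex S) A (lleg T \<circ>\<^sub>F E) (lleg S)"
    "nat_isomorphic (apex S) B (rleg T \<circ>\<^sub>F E) (rleg S)"
    using assms(6) by (auto simp: span_equiv_def)
  obtain G where G: "cat_equivalence (apex T) (apex U) G"
    "nat_isomorphic (apex T) A (lleg U \<circ>\<^sub>F G) (lleg T)"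
    "nat_isomorphic (apex T) B (rleg U \<circ>\<^sub>F G) (rleg T)"
    using assms(7) by (auto simp: span_equiv_def)
  note fE = cat_equivalence_functor[OF E(1)] and fG = cat_equivalence_functor[OF G(1)]
  have leg: "nat_isomorphic (apex S) D (u \<circ>\<^sub>F (G \<circ>\<^sub>F E)) s"
    if "groupoid D" "is_functor (apex S) D s" "is_functor (apex T) D t" "is_functor (apex U) D u"
      "nat_isomorphic (apex S) D (t \<circ>\<^sub>F E) s" "nat_isomorphic (apex T) D (u \<circ>\<^sub>F G) t" for D s t u
  proof -
    note tE = is_functor_comp[OF S(2) fE that(3)]
    have uGE: "is_functor (apex S) D ((u \<circ>\<^sub>F G) \<circ>\<^sub>F E)"
      by (rule is_functor_comp[OF S(2) fE is_functor_comp[OF T(2) fG that(4)]])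
    show ?thesis
      using nat_isomorphic_trans[OF S(2) that(1) uGE tE that(2)
          nat_isomorphic_whisker_right[OF S(2) that(1) fE that(6)] that(5)]
      by (simp add: comp_func_assoc)
  qed
  show ?thesis
    using cat_equivalence_comp[OF S(1) T(1) U(1) E(1) G(1)]
      leg[OF assms(1) S(3) T(3) U(3) E(2) G(2)] leg[OF assms(2) S(4) T(4) U(4) E(3) G(3)]
    by (rule span_equivI)
qed

lemma span_class_eqI:
  assumes "groupoid A" "groupoid B" "is_span A B S" "is_span A B T" "span_equiv A B S T"
  shows "span_class A B S = span_class A B T"
  unfolding span_class_def
  using span_equiv_trans[OF assms(1,2,3,4) _ assms(5)]
    span_equiv_trans[OF assms(1,2,4,3) _ span_equiv_sym[OF assms]] by blast

lemma span_mor_eqI: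
  assumes "groupoid A" "groupoid B" "is_span A B S" "is_span A B T" "span_equiv A B S T"
  shows "span_mor A B S = span_mor A B T"
  unfolding span_mor_def using span_class_eqI[OF assms] by simp

section \<open>Composites and products of spans\<close>

lemma span_comp_simps [simp]:
  "apex (span_comp B T S) = pullback2 (apex S) (apex T) B (rleg S) (lleg T)"
  "lleg (span_comp B T S) = lleg S \<circ>\<^sub>F (fst_func \<circ>\<^sub>F fst_func)"
  "rleg (span_comp B T S) = rleg T \<circ>\<^sub>F (snd_func \<circ>\<^sub>F fst_func)"
  by (simp_all add: span_comp_def)

lemma span_prod_simps [simp]:
  "apex (span_prod S T) = prod_grpd (apex S) (apex T)"
  "lleg (span_prod S T) = prod_func (lleg S) (lleg T)"
  "rleg (span_prod S T) = prod_func (rleg S) (rleg T)"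
  by (simp_all add: span_prod_def)

lemma is_span_comp:
  assumes "groupoid B" "is_span A B S" "is_span B D T"
  shows "is_span A D (span_comp B T S)"
proof -
  note S = is_spanD[OF assms(2)] and T = is_spanD[OF assms(3)]
  note P = groupoid_pullback2[OF S(1) T(1) assms(1) S(4) T(3)]
  note c = groupoid.axioms(1)[OF P]
  show ?thesis
    unfolding is_span_def span_comp_simps
    using P is_functor_comp[OF c is_functor_pullback2_fst[OF S(1) T(1) assms(1) S(4) T(3)] S(3)]
      is_functor_comp[OF c is_functor_pullback2_snd[OF S(1) T(1) assms(1) S(4) T(3)] T(4)] by blast
qed

lemma is_span_prod:
  assumes "is_span A B S" "is_span A' B' T"
  shows "is_span (prod_grpd A A') (prod_grpd B B') (span_prod S T)"
  unfolding is_span_def span_prod_simps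
  using assms by (auto simp: is_span_def intro: groupoid_prod is_functor_prod)

lemma is_span_func: "groupoid A \<Longrightarrow> is_functor A B F \<Longrightarrow> is_span A B (func_span A F)"
  by (auto simp: is_span_def func_span_def intro: is_functor_id groupoid.axioms(1))

lemma func_span_simps [simp]:
  "apex (func_span A F) = A" "lleg (func_span A F) = id_func" "rleg (func_span A F) = F"
  by (simp_all add: func_span_def)

text \<open>A span is a composite as soon as its apex has the universal property of the 2-pullback.\<close>

lemma span_equiv_comp:
  assumes gr: "groupoid A" "groupoid B" "groupoid D" and ST: "is_span A B S" "is_span B D T"
    and Z: "groupoid (apex R)"
    and PQ: "is_functor (apex R) (apex S) P" "is_functor (apex R) (apex T) Q"
    and legs: "nat_isomorphic (apex R) A (lleg S \<circ>\<^sub>F P) (lleg R)"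
      "nat_isomorphic (apex R) D (rleg T \<circ>\<^sub>F Q) (rleg R)"
    and \<theta>: "\<And>z. z \<in> Ob (apex R) \<Longrightarrow>
        \<theta> z \<in> hom B (on_Ob (rleg S) (on_Ob P z)) (on_Ob (lleg T) (on_Ob Q z))"
      "\<And>z z' h. h \<in> hom (apex R) z z' \<Longrightarrow>
        on_Ar (lleg T) (on_Ar Q h) \<cdot>\<^bsub>B\<^esub> \<theta> z = \<theta> z' \<cdot>\<^bsub>B\<^esub> on_Ar (rleg S) (on_Ar P h)"
    and full: "\<And>z z' f g. z \<in> Ob (apex R) \<Longrightarrow> z' \<in> Ob (apex R) \<Longrightarrow>
        f \<in> hom (apex S) (on_Ob P z) (on_Ob P z') \<Longrightarrow> g \<in> hom (apex T) (on_Ob Q z) (on_Ob Q z') \<Longrightarrow>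
        on_Ar (lleg T) g \<cdot>\<^bsub>B\<^esub> \<theta> z = \<theta> z' \<cdot>\<^bsub>B\<^esub> on_Ar (rleg S) f \<Longrightarrow>
        \<exists>h. h \<in> hom (apex R) z z' \<and> on_Ar P h = f \<and> on_Ar Q h = g"
    and faithful: "\<And>z z' h h'. h \<in> hom (apex R) z z' \<Longrightarrow> h' \<in> hom (apex R) z z' \<Longrightarrow>
        on_Ar P h = on_Ar P h' \<Longrightarrow> on_Ar Q h = on_Ar Q h' \<Longrightarrow> h = h'"
    and es: "\<And>x y \<phi>. x \<in> Ob (apex S) \<Longrightarrow> y \<in> Ob (apex T) \<Longrightarrow>
        \<phi> \<in> hom B (on_Ob (rleg S) x) (on_Ob (lleg T) y) \<Longrightarrow>
        \<exists>z f g. z \<in> Ob (apex R) \<and> f \<in> hom (apex S) (on_Ob P z) x \<and> g \<in> hom (apex T) (on_Ob Q z) y \<and>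
          on_Ar (lleg T) g \<cdot>\<^bsub>B\<^esub> \<theta> z = \<phi> \<cdot>\<^bsub>B\<^esub> on_Ar (rleg S) f"
  shows "span_equiv A D R (span_comp B T S)"
proof (rule span_equivI)
  note S = is_spanD[OF ST(1)] and T = is_spanD[OF ST(2)]
  let ?E = "pullback2_func (apex R) P Q \<theta>"
  show "cat_equivalence (apex R) (apex (span_comp B T S)) ?E"
    unfolding span_comp_simps
    by (rule cat_equivalence_pullback2_func[OF S(1) T(1) gr(2) Z S(4) T(3) PQ \<theta> full faithful es])
  have "lleg (span_comp B T S) \<circ>\<^sub>F ?E = lleg S \<circ>\<^sub>F P" "rleg (span_comp B T S) \<circ>\<^sub>F ?E = rleg T \<circ>\<^sub>F Q"
    by (simp_all add: pullback2_func_def Let_def comp_func_def o_def)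
  then show "nat_isomorphic (apex R) A (lleg (span_comp B T S) \<circ>\<^sub>F ?E) (lleg R)"
    "nat_isomorphic (apex R) D (rleg (span_comp B T S) \<circ>\<^sub>F ?E) (rleg R)"
    using legs by simp_all
qed

text \<open>The comparisons for associativity and units commute strictly with the legs. The
  isomorphism in the cone is then an identity and disappears from the fullness condition; only
  \<open>es\<close> still faces an arbitrary \<phi>.\<close>

lemma span_equiv_comp_strict:
  assumes gr: "groupoid A" "groupoid B" "groupoid D" and ST: "is_span A B S" "is_span B D T"
    and R: "is_span A D R"
    and PQ: "is_functor (apex R) (apex S) P" "is_functor (apex R) (apex T) Q"
    and Ob: "\<And>u. u \<in> Ob (apex R) \<Longrightarrow> on_Ob (lleg S) (on_Ob P u) = on_Ob (lleg R) u"
      "\<And>u. u \<in> Ob (apex R) \<Longrightarrow> on_Ob (rleg T) (on_Ob Q u) = on_Ob (rleg R) u"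
      "\<And>u. u \<in> Ob (apex R) \<Longrightarrow> on_Ob (lleg T) (on_Ob Q u) = on_Ob (rleg S) (on_Ob P u)"
    and Ar: "\<And>u v h. h \<in> hom (apex R) u v \<Longrightarrow> on_Ar (lleg S) (on_Ar P h) = on_Ar (lleg R) h"
      "\<And>u v h. h \<in> hom (apex R) u v \<Longrightarrow> on_Ar (rleg T) (on_Ar Q h) = on_Ar (rleg R) h"
      "\<And>u v h. h \<in> hom (apex R) u v \<Longrightarrow> on_Ar (lleg T) (on_Ar Q h) = on_Ar (rleg S) (on_Ar P h)"
    and full: "\<And>u v f g. u \<in> Ob (apex R) \<Longrightarrow> v \<in> Ob (apex R) \<Longrightarrow>
        f \<in> hom (apex S) (on_Ob P u) (on_Ob P v) \<Longrightarrow> g \<in> hom (apex T) (on_Ob Q u) (on_Ob Q v) \<Longrightarrow>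
        on_Ar (lleg T) g = on_Ar (rleg S) f \<Longrightarrow>
        \<exists>h. h \<in> hom (apex R) u v \<and> on_Ar P h = f \<and> on_Ar Q h = g"
    and faithful: "\<And>u v h h'. h \<in> hom (apex R) u v \<Longrightarrow> h' \<in> hom (apex R) u v \<Longrightarrow>
        on_Ar P h = on_Ar P h' \<Longrightarrow> on_Ar Q h = on_Ar Q h' \<Longrightarrow> h = h'"
    and es: "\<And>x y \<phi>. x \<in> Ob (apex S) \<Longrightarrow> y \<in> Ob (apex T) \<Longrightarrow>
        \<phi> \<in> hom B (on_Ob (rleg S) x) (on_Ob (lleg T) y) \<Longrightarrow>
        \<exists>u f g. u \<in> Ob (apex R) \<and> f \<in> hom (apex S) (on_Ob P u) x \<and> g \<in> hom (apex T) (on_Ob Q u) y \<and>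
          on_Ar (lleg T) g = \<phi> \<cdot>\<^bsub>B\<^esub> on_Ar (rleg S) f"
  shows "span_equiv A D R (span_comp B T S)"
proof -
  interpret B: groupoid B by fact
  note s = is_spanD[OF ST(1)] and t = is_spanD[OF ST(2)] and r = is_spanD[OF R]
  interpret R: groupoid "apex R" by fact
  \<comment> \<open>Well typed because the third equation of \<open>Ob\<close> identifies the two
    end points.\<close>
  let ?\<theta> = "\<lambda>u. Idt B (on_Ob (lleg T) (on_Ob Q u))"
  have PO: "on_Ob P u \<in> Ob (apex S)" "on_Ob Q u \<in> Ob (apex T)"
    "on_Ob (lleg T) (on_Ob Q u) \<in> Ob B" if "u \<in> Ob (apex R)" for u
    using that by (simp_all add: functor_Ob[OF PQ(1)] functor_Ob[OF PQ(2)] functor_Ob[OF t(3)])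
  show ?thesis
  proof (rule span_equiv_comp[OF gr ST r(1) PQ, where \<theta> = ?\<theta>])
    show "nat_isomorphic (apex R) A (lleg S \<circ>\<^sub>F P) (lleg R)"
      by (rule nat_isomorphic_eqI[OF r(2) gr(1) is_functor_comp[OF r(2) PQ(1) s(3)]]) (simp_all add: Ob Ar)
    show "nat_isomorphic (apex R) D (rleg T \<circ>\<^sub>F Q) (rleg R)"
      by (rule nat_isomorphic_eqI[OF r(2) gr(3) is_functor_comp[OF r(2) PQ(2) t(4)]]) (simp_all add: Ob Ar)
    show "?\<theta> u \<in> hom B (on_Ob (rleg S) (on_Ob P u)) (on_Ob (lleg T) (on_Ob Q u))" if "u \<in> Ob (apex R)" for u
      using B.id_hom[OF PO(3)[OF that]] Ob(3)[OF that] by simp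
    show "on_Ar (lleg T) (on_Ar Q h) \<cdot>\<^bsub>B\<^esub> ?\<theta> u = ?\<theta> v \<cdot>\<^bsub>B\<^esub> on_Ar (rleg S) (on_Ar P h)"
      if h: "h \<in> hom (apex R) u v" for u v h
    proof -
      note l = functor_hom[OF t(3) functor_hom[OF PQ(2) h]]
      show ?thesis using B.comp_id[OF l] B.id_comp[OF l] Ar(3)[OF h] by simp
    qed
    show "\<exists>h. h \<in> hom (apex R) u v \<and> on_Ar P h = f \<and> on_Ar Q h = g"
      if u: "u \<in> Ob (apex R)" "v \<in> Ob (apex R)" and f: "f \<in> hom (apex S) (on_Ob P u) (on_Ob P v)"
        and g: "g \<in> hom (apex T) (on_Ob Q u) (on_Ob Q v)"
        and eq: "on_Ar (lleg T) g \<cdot>\<^bsub>B\<^esub> ?\<theta> u = ?\<theta> v \<cdot>\<^bsub>B\<^esub> on_Ar (rleg S) f" for u v f g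
      using eq B.comp_id[OF functor_hom[OF t(3) g]] B.id_comp[OF functor_hom[OF s(4) f]] Ob(3)[OF u(2)]
      by (intro full u f g) simp
    show "\<exists>u f g. u \<in> Ob (apex R) \<and> f \<in> hom (apex S) (on_Ob P u) x \<and> g \<in> hom (apex T) (on_Ob Q u) y \<and>
          on_Ar (lleg T) g \<cdot>\<^bsub>B\<^esub> ?\<theta> u = \<phi> \<cdot>\<^bsub>B\<^esub> on_Ar (rleg S) f"
      if xy: "x \<in> Ob (apex S)" "y \<in> Ob (apex T)" "\<phi> \<in> hom B (on_Ob (rleg S) x) (on_Ob (lleg T) y)" for x y \<phi>
    proof -
      obtain u f g where u: "u \<in> Ob (apex R)" "f \<in> hom (apex S) (on_Ob P u) x" "g \<in> hom (apex T) (on_Ob Q u) y"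
        "on_Ar (lleg T) g = \<phi> \<cdot>\<^bsub>B\<^esub> on_Ar (rleg S) f"
        using es[OF xy] by blast
      then show ?thesis
        using B.comp_id[OF functor_hom[OF t(3) u(3)]] by (intro exI[of _ u] exI[of _ f] exI[of _ g]) simp
    qed
  qed (fact faithful)
qed

text \<open>Natural isomorphisms \<alpha> and \<beta> on the two inner legs let
  \<open>(x, y, \<phi>)\<close> be sent to the images of \<open>x\<close> and \<open>y\<close>
  together with \<phi> conjugated by \<alpha> and \<beta>. The conjugation is reversible, so full
  faithfulness and essential surjectivity are inherited from \<open>E\<close> and
  \<open>E'\<close>.\<close>

lemma span_equiv_comp_cong:
  assumes gr: "groupoid A" "groupoid B" "groupoid D"
    and S: "is_span A B S" "is_span A B S'" "span_equiv A B S S'"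
    and T: "is_span B D T" "is_span B D T'" "span_equiv B D T T'"
  shows "span_equiv A D (span_comp B T S) (span_comp B T' S')"
proof -
  interpret B: groupoid B by fact
  obtain E where E: "cat_equivalence (apex S) (apex S') E"
    "nat_isomorphic (apex S) A (lleg S' \<circ>\<^sub>F E) (lleg S)"
    "nat_isomorphic (apex S) B (rleg S' \<circ>\<^sub>F E) (rleg S)"
    using S(3) by (auto simp: span_equiv_def)
  obtain E' where E': "cat_equivalence (apex T) (apex T') E'"
    "nat_isomorphic (apex T) B (lleg T' \<circ>\<^sub>F E') (lleg T)"
    "nat_isomorphic (apex T) D (rleg T' \<circ>\<^sub>F E') (rleg T)"
    using T(3) by (auto simp: span_equiv_def)
  note s = is_spanD[OF S(1)] and s' = is_spanD[OF S(2)]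
    and t = is_spanD[OF T(1)] and t' = is_spanD[OF T(2)]
  note fE = cat_equivalence_functor[OF E(1)] and fE' = cat_equivalence_functor[OF E'(1)]
  obtain \<alpha> where \<alpha>: "\<And>x. x \<in> Ob (apex S) \<Longrightarrow>
        \<alpha> x \<in> hom B (on_Ob (rleg S') (on_Ob E x)) (on_Ob (rleg S) x)"
      "\<And>x x' f. f \<in> hom (apex S) x x' \<Longrightarrow>
        \<alpha> x' \<cdot>\<^bsub>B\<^esub> on_Ar (rleg S') (on_Ar E f) = on_Ar (rleg S) f \<cdot>\<^bsub>B\<^esub> \<alpha> x"
    using E(3) by (rule nat_isomorphicE) (simp, blast)
  obtain \<beta> where \<beta>: "\<And>x. x \<in> Ob (apex T) \<Longrightarrow>
        \<beta> x \<in> hom B (on_Ob (lleg T') (on_Ob E' x)) (on_Ob (lleg T) x)"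
      "\<And>x x' f. f \<in> hom (apex T) x x' \<Longrightarrow>
        \<beta> x' \<cdot>\<^bsub>B\<^esub> on_Ar (lleg T') (on_Ar E' f) = on_Ar (lleg T) f \<cdot>\<^bsub>B\<^esub> \<beta> x"
    using E'(2) by (rule nat_isomorphicE) (simp, blast)
  have \<alpha>i: "inv_arr B (\<alpha> x) \<in> hom B (on_Ob (rleg S) x) (on_Ob (rleg S') (on_Ob E x))"
    if "x \<in> Ob (apex S)" for x using B.inv_arr(1)[OF B.iso \<alpha>(1)] \<alpha>(1) that by blast
  have \<beta>i: "inv_arr B (\<beta> x) \<in> hom B (on_Ob (lleg T) x) (on_Ob (lleg T') (on_Ob E' x))"
    if "x \<in> Ob (apex T)" for x using B.inv_arr(1)[OF B.iso \<beta>(1)] \<beta>(1) that by blast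
  have \<alpha>n: "inv_arr B (\<alpha> x') \<cdot>\<^bsub>B\<^esub> on_Ar (rleg S) f = on_Ar (rleg S') (on_Ar E f) \<cdot>\<^bsub>B\<^esub> inv_arr B (\<alpha> x)"
    if f: "f \<in> hom (apex S) x x'" for x x' f
  proof -
    note x = \<alpha>(1)[OF category.hom_Ob(1)[OF s(2) f]] and x' = \<alpha>(1)[OF category.hom_Ob(2)[OF s(2) f]]
    show ?thesis
      by (rule B.inv_natural[OF B.iso[OF x] x B.iso[OF x'] x' functor_hom[OF s'(4) functor_hom[OF fE f]]
            functor_hom[OF s(4) f] \<alpha>(2)[OF f]])
  qed
  have \<beta>n: "inv_arr B (\<beta> x') \<cdot>\<^bsub>B\<^esub> on_Ar (lleg T) f = on_Ar (lleg T') (on_Ar E' f) \<cdot>\<^bsub>B\<^esub> inv_arr B (\<beta> x)"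
    if f: "f \<in> hom (apex T) x x'" for x x' f
  proof -
    note x = \<beta>(1)[OF category.hom_Ob(1)[OF t(2) f]] and x' = \<beta>(1)[OF category.hom_Ob(2)[OF t(2) f]]
    show ?thesis
      by (rule B.inv_natural[OF B.iso[OF x] x B.iso[OF x'] x' functor_hom[OF t'(3) functor_hom[OF fE' f]]
            functor_hom[OF t(3) f] \<beta>(2)[OF f]])
  qed
  define \<theta> where "\<theta> = (\<lambda>u. inv_arr B (\<beta> (usnd (ufst u))) \<cdot>\<^bsub>B\<^esub> (usnd u \<cdot>\<^bsub>B\<^esub> \<alpha> (ufst (ufst u))))"
  let ?R = "span_comp B T S"
  note R = is_spanD[OF is_span_comp[OF gr(2) S(1) T(1)]]
  note p1 = is_functor_pullback2_fst[OF s(1) t(1) gr(2) s(4) t(3)]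
    and p2 = is_functor_pullback2_snd[OF s(1) t(1) gr(2) s(4) t(3)]
  have \<theta>hom: "inv_arr B (\<beta> y) \<cdot>\<^bsub>B\<^esub> (\<phi> \<cdot>\<^bsub>B\<^esub> \<alpha> x) \<in> hom B (on_Ob (rleg S') (on_Ob E x)) (on_Ob (lleg T') (on_Ob E' y))"
    if "x \<in> Ob (apex S)" "y \<in> Ob (apex T)" "\<phi> \<in> hom B (on_Ob (rleg S) x) (on_Ob (lleg T) y)" for x y \<phi>
    using B.comp_hom[OF B.comp_hom[OF \<alpha>(1)[OF that(1)] that(3)] \<beta>i[OF that(2)]] .
  \<comment> \<open>Conjugating back recovers \<phi>. In the fullness step this carries a
    compatibility between the primed spans back to \<open>S\<close> and \<open>T\<close>.\<close>
  have \<phi>eq: "\<beta> y \<cdot>\<^bsub>B\<^esub> ((inv_arr B (\<beta> y) \<cdot>\<^bsub>B\<^esub> (\<phi> \<cdot>\<^bsub>B\<^esub> \<alpha> x)) \<cdot>\<^bsub>B\<^esub> inv_arr B (\<alpha> x)) = \<phi>"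
    if x: "x \<in> Ob (apex S)" and y: "y \<in> Ob (apex T)" and \<phi>: "\<phi> \<in> hom B (on_Ob (rleg S) x) (on_Ob (lleg T) y)" for x y \<phi>
  proof -
    note a = \<alpha>(1)[OF x] and b = \<beta>(1)[OF y]
    have "(inv_arr B (\<beta> y) \<cdot>\<^bsub>B\<^esub> (\<phi> \<cdot>\<^bsub>B\<^esub> \<alpha> x)) \<cdot>\<^bsub>B\<^esub> inv_arr B (\<alpha> x)
        = inv_arr B (\<beta> y) \<cdot>\<^bsub>B\<^esub> \<phi>"
      using B.comp_assoc[OF \<alpha>i[OF x] B.comp_hom[OF a \<phi>] \<beta>i[OF y]]
        B.comp_inv_cancel(4)[OF B.iso[OF a] a \<phi>] by simp
    then show ?thesis using B.comp_inv_cancel(1)[OF B.iso[OF b] b \<phi>] by simp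
  qed
  show ?thesis
  proof (rule span_equiv_comp[OF gr S(2) T(2) R(1), where P = "E \<circ>\<^sub>F (fst_func \<circ>\<^sub>F fst_func)"
        and Q = "E' \<circ>\<^sub>F (snd_func \<circ>\<^sub>F fst_func)" and \<theta> = \<theta>])
    show "is_functor (apex ?R) (apex S') (E \<circ>\<^sub>F (fst_func \<circ>\<^sub>F fst_func))"
      using is_functor_comp[OF R(2)] p1 fE by simp
    show "is_functor (apex ?R) (apex T') (E' \<circ>\<^sub>F (snd_func \<circ>\<^sub>F fst_func))"
      using is_functor_comp[OF R(2)] p2 fE' by simp
    show "nat_isomorphic (apex ?R) A (lleg S' \<circ>\<^sub>F E \<circ>\<^sub>F fst_func \<circ>\<^sub>F fst_func) (lleg ?R)"
      using nat_isomorphic_whisker_right[OF R(2) gr(1) _ E(2)] p1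
      by (simp add: comp_func_assoc)
    show "nat_isomorphic (apex ?R) D (rleg T' \<circ>\<^sub>F E' \<circ>\<^sub>F snd_func \<circ>\<^sub>F fst_func) (rleg ?R)"
      using nat_isomorphic_whisker_right[OF R(2) gr(3) _ E'(3)] p2
      by (simp add: comp_func_assoc)
    show "\<theta> u \<in> hom B (on_Ob (rleg S') (on_Ob (E \<circ>\<^sub>F (fst_func \<circ>\<^sub>F fst_func)) u))
        (on_Ob (lleg T') (on_Ob (E' \<circ>\<^sub>F (snd_func \<circ>\<^sub>F fst_func)) u))" if "u \<in> Ob (apex ?R)" for u
      using that by (auto simp: \<theta>_def intro: \<theta>hom elim!: pullback2_ObE)
    show "on_Ar (lleg T') (on_Ar (E' \<circ>\<^sub>F (snd_func \<circ>\<^sub>F fst_func)) h) \<cdot>\<^bsub>B\<^esub> \<theta> u =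
        \<theta> v \<cdot>\<^bsub>B\<^esub> on_Ar (rleg S') (on_Ar (E \<circ>\<^sub>F (fst_func \<circ>\<^sub>F fst_func)) h)"
      if "h \<in> hom (apex ?R) u v" for u v h
      using that unfolding span_comp_simps
    proof (rule pullback2_homE)
      fix f g x y \<phi> x' y' \<phi>'
      assume *: "h = Tup (Tup f g) (Tup u v)"
        "u = Tup (Tup x y) \<phi>" "x \<in> Ob (apex S)" "y \<in> Ob (apex T)" "\<phi> \<in> hom B (on_Ob (rleg S) x) (on_Ob (lleg T) y)"
        "v = Tup (Tup x' y') \<phi>'" "x' \<in> Ob (apex S)" "y' \<in> Ob (apex T)" "\<phi>' \<in> hom B (on_Ob (rleg S) x') (on_Ob (lleg T) y')"
        "f \<in> hom (apex S) x x'" "g \<in> hom (apex T) y y'"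
        "on_Ar (lleg T) g \<cdot>\<^bsub>B\<^esub> \<phi> = \<phi>' \<cdot>\<^bsub>B\<^esub> on_Ar (rleg S) f"
      note rf = functor_hom[OF s(4) *(10)] and lg = functor_hom[OF t(3) *(11)]
        and rf' = functor_hom[OF s'(4) functor_hom[OF fE *(10)]]
        and lg' = functor_hom[OF t'(3) functor_hom[OF fE' *(11)]]
      note 1 = B.square_paste[OF \<alpha>(1)[OF *(3)] \<alpha>(1)[OF *(7)] *(5) *(9) rf' rf lg \<alpha>(2)[OF *(10)] *(12)[symmetric]]
      show ?thesis
        using B.square_paste[OF B.comp_hom[OF \<alpha>(1)[OF *(3)] *(5)] B.comp_hom[OF \<alpha>(1)[OF *(7)] *(9)]
            \<beta>i[OF *(4)] \<beta>i[OF *(8)] rf' lg lg' 1 \<beta>n[OF *(11)]]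
        by (simp add: \<theta>_def * )
    qed
    show "\<exists>h. h \<in> hom (apex ?R) u v \<and> on_Ar (E \<circ>\<^sub>F (fst_func \<circ>\<^sub>F fst_func)) h = f' \<and>
        on_Ar (E' \<circ>\<^sub>F (snd_func \<circ>\<^sub>F fst_func)) h = g'"
      if u: "u \<in> Ob (apex ?R)" and v: "v \<in> Ob (apex ?R)"
        and f': "f' \<in> hom (apex S') (on_Ob (E \<circ>\<^sub>F (fst_func \<circ>\<^sub>F fst_func)) u) (on_Ob (E \<circ>\<^sub>F (fst_func \<circ>\<^sub>F fst_func)) v)"
        and g': "g' \<in> hom (apex T') (on_Ob (E' \<circ>\<^sub>F (snd_func \<circ>\<^sub>F fst_func)) u) (on_Ob (E' \<circ>\<^sub>F (snd_func \<circ>\<^sub>F fst_func)) v)"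
        and eq: "on_Ar (lleg T') g' \<cdot>\<^bsub>B\<^esub> \<theta> u = \<theta> v \<cdot>\<^bsub>B\<^esub> on_Ar (rleg S') f'" for u v f' g'
    proof -
      obtain x y \<phi> where x: "u = Tup (Tup x y) \<phi>" "x \<in> Ob (apex S)" "y \<in> Ob (apex T)"
        "\<phi> \<in> hom B (on_Ob (rleg S) x) (on_Ob (lleg T) y)"
        using u by (auto elim: pullback2_ObE)
      obtain x' y' \<phi>' where x': "v = Tup (Tup x' y') \<phi>'" "x' \<in> Ob (apex S)" "y' \<in> Ob (apex T)"
        "\<phi>' \<in> hom B (on_Ob (rleg S) x') (on_Ob (lleg T) y')"
        using v by (auto elim: pullback2_ObE)
      obtain f where f: "f \<in> hom (apex S) x x'" "on_Ar E f = f'"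
        using fully_faithful_full[OF cat_equivalence_fully_faithful[OF s(1) s'(1) E(1)] x(2) x'(2)] f'
        by (auto simp: x(1) x'(1))
      obtain g where g: "g \<in> hom (apex T) y y'" "on_Ar E' g = g'"
        using fully_faithful_full[OF cat_equivalence_fully_faithful[OF t(1) t'(1) E'(1)] x(3) x'(3)] g'
        by (auto simp: x(1) x'(1))
      note rf = functor_hom[OF s(4) f(1)] and lg = functor_hom[OF t(3) g(1)]
        and rf' = functor_hom[OF s'(4) functor_hom[OF fE f(1)]]
        and lg' = functor_hom[OF t'(3) functor_hom[OF fE' g(1)]]
      note th = \<theta>hom[OF x(2-4)] and th' = \<theta>hom[OF x'(2-4)]
      have eq': "(inv_arr B (\<beta> y') \<cdot>\<^bsub>B\<^esub> (\<phi>' \<cdot>\<^bsub>B\<^esub> \<alpha> x')) \<cdot>\<^bsub>B\<^esub> on_Ar (rleg S') (on_Ar E f)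
          = on_Ar (lleg T') (on_Ar E' g) \<cdot>\<^bsub>B\<^esub> (inv_arr B (\<beta> y) \<cdot>\<^bsub>B\<^esub> (\<phi> \<cdot>\<^bsub>B\<^esub> \<alpha> x))"
        using eq by (simp add: \<theta>_def x(1) x'(1) f g)
      note 1 = B.square_paste[OF \<alpha>i[OF x(2)] \<alpha>i[OF x'(2)] th th' rf rf' lg' \<alpha>n[OF f(1)] eq']
      have "\<phi>' \<cdot>\<^bsub>B\<^esub> on_Ar (rleg S) f = on_Ar (lleg T) g \<cdot>\<^bsub>B\<^esub> \<phi>"
        using B.square_paste[OF B.comp_hom[OF \<alpha>i[OF x(2)] th] B.comp_hom[OF \<alpha>i[OF x'(2)] th']
            \<beta>(1)[OF x(3)] \<beta>(1)[OF x'(3)] rf lg' lg 1 \<beta>(2)[OF g(1)]]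
        by (simp add: \<phi>eq x x')
      then have "Tup (Tup f g) (Tup u v) \<in> hom (apex ?R) u v"
        using u v f g by (simp add: pullback2_hom_iff x(1) x'(1))
      then show ?thesis using f g by (intro exI[of _ "Tup (Tup f g) (Tup u v)"]) simp
    qed
    show "h = h'" if h: "h \<in> hom (apex ?R) u v" and h': "h' \<in> hom (apex ?R) u v"
      and 1: "on_Ar (E \<circ>\<^sub>F (fst_func \<circ>\<^sub>F fst_func)) h = on_Ar (E \<circ>\<^sub>F (fst_func \<circ>\<^sub>F fst_func)) h'"
      and 2: "on_Ar (E' \<circ>\<^sub>F (snd_func \<circ>\<^sub>F fst_func)) h = on_Ar (E' \<circ>\<^sub>F (snd_func \<circ>\<^sub>F fst_func)) h'" for u v h h'
    proof -
      obtain f g x y x' y' where f: "h = Tup (Tup f g) (Tup u v)" "f \<in> hom (apex S) x x'" "g \<in> hom (apex T) y y'"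
        "ufst (ufst u) = x" "ufst (ufst v) = x'" "usnd (ufst u) = y" "usnd (ufst v) = y'"
        using h unfolding span_comp_simps by (rule pullback2_homE) auto
      obtain f' g' where f': "h' = Tup (Tup f' g') (Tup u v)" "f' \<in> hom (apex S) x x'" "g' \<in> hom (apex T) y y'"
        using h' unfolding span_comp_simps by (rule pullback2_homE) (use f in auto)
      have "f = f'"
        using fully_faithful_faithful[OF cat_equivalence_fully_faithful[OF s(1) s'(1) E(1)]
            category.hom_Ob[OF s(2) f(2)] f(2) f'(2) functor_hom[OF fE f(2)]] 1 f(1) f'(1) by simp
      moreover have "g = g'"
        using fully_faithful_faithful[OF cat_equivalence_fully_faithful[OF t(1) t'(1) E'(1)]
            category.hom_Ob[OF t(2) f(3)] f(3) f'(3) functor_hom[OF fE' f(3)]] 2 f(1) f'(1) by simp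
      ultimately show ?thesis using f(1) f'(1) by simp
    qed
    show "\<exists>u f g. u \<in> Ob (apex ?R) \<and> f \<in> hom (apex S') (on_Ob (E \<circ>\<^sub>F (fst_func \<circ>\<^sub>F fst_func)) u) x' \<and>
        g \<in> hom (apex T') (on_Ob (E' \<circ>\<^sub>F (snd_func \<circ>\<^sub>F fst_func)) u) y' \<and>
        on_Ar (lleg T') g \<cdot>\<^bsub>B\<^esub> \<theta> u = \<phi>' \<cdot>\<^bsub>B\<^esub> on_Ar (rleg S') f"
      if x': "x' \<in> Ob (apex S')" and y': "y' \<in> Ob (apex T')"
        and \<phi>': "\<phi>' \<in> hom B (on_Ob (rleg S') x') (on_Ob (lleg T') y')" for x' y' \<phi>'
    proof -
      obtain x a where x: "x \<in> Ob (apex S)" and a: "a \<in> hom (apex S') (on_Ob E x) x'"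
        using cat_equivalence_ess_surj[OF E(1)] x' by (auto simp: ess_surj_def)
      obtain y b where y: "y \<in> Ob (apex T)" and b: "b \<in> hom (apex T') (on_Ob E' y) y'"
        using cat_equivalence_ess_surj[OF E'(1)] y' by (auto simp: ess_surj_def)
      note ra = functor_hom[OF s'(4) a] and lb = functor_hom[OF t'(3) b]
      note lbi = B.inv_arr(1)[OF B.iso[OF lb] lb] and ra\<phi> = B.comp_hom[OF ra \<phi>']
      \<comment> \<open>\<theta>0 is \<phi>' transported along \<open>a\<close> and \<open>b\<close>
        to the images of \<open>x\<close> and \<open>y\<close>. Undoing \<alpha> and \<beta> then
        gives the \<phi> whose conjugate is \<theta>0.\<close>
      define \<theta>0 where "\<theta>0 = inv_arr B (on_Ar (lleg T') b) \<cdot>\<^bsub>B\<^esub> (\<phi>' \<cdot>\<^bsub>B\<^esub> on_Ar (rleg S') a)"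
      have \<theta>0: "\<theta>0 \<in> hom B (on_Ob (rleg S') (on_Ob E x)) (on_Ob (lleg T') (on_Ob E' y))"
        unfolding \<theta>0_def by (rule B.comp_hom[OF ra\<phi> lbi])
      define \<phi> where "\<phi> = \<beta> y \<cdot>\<^bsub>B\<^esub> (\<theta>0 \<cdot>\<^bsub>B\<^esub> inv_arr B (\<alpha> x))"
      note \<theta>\<alpha> = B.comp_hom[OF \<alpha>i[OF x] \<theta>0]
      have \<phi>: "\<phi> \<in> hom B (on_Ob (rleg S) x) (on_Ob (lleg T) y)"
        unfolding \<phi>_def by (rule B.comp_hom[OF \<theta>\<alpha> \<beta>(1)[OF y]])
      have "inv_arr B (\<beta> y) \<cdot>\<^bsub>B\<^esub> (\<phi> \<cdot>\<^bsub>B\<^esub> \<alpha> x) = \<theta>0"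
        unfolding \<phi>_def
        using B.comp_assoc[OF \<alpha>(1)[OF x] \<theta>\<alpha> \<beta>(1)[OF y]]
          B.comp_inv_cancel(3)[OF B.iso[OF \<alpha>(1)[OF x]] \<alpha>(1)[OF x] \<theta>0]
          B.comp_inv_cancel(2)[OF B.iso[OF \<beta>(1)[OF y]] \<beta>(1)[OF y] \<theta>0] by simp
      then have "on_Ar (lleg T') b \<cdot>\<^bsub>B\<^esub> \<theta> (Tup (Tup x y) \<phi>) = \<phi>' \<cdot>\<^bsub>B\<^esub> on_Ar (rleg S') a"
        using B.comp_inv_cancel(1)[OF B.iso[OF lb] lb ra\<phi>] by (simp add: \<theta>_def \<theta>0_def)
      then show ?thesis
        using x y a b \<phi>
        by (intro exI[of _ "Tup (Tup x y) \<phi>"] exI[of _ a] exI[of _ b]) (simp add: pullback2_Ob_iff[OF gr(2)])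
    qed
  qed
qed

lemma span_equiv_prod_cong:
  assumes gr: "groupoid A" "groupoid B" "groupoid A'" "groupoid B'"
    and S: "is_span A B S" "is_span A B S'" "span_equiv A B S S'"
    and T: "is_span A' B' T" "is_span A' B' T'" "span_equiv A' B' T T'"
  shows "span_equiv (prod_grpd A A') (prod_grpd B B') (span_prod S T) (span_prod S' T')"
proof -
  obtain E where E: "cat_equivalence (apex S) (apex S') E"
    "nat_isomorphic (apex S) A (lleg S' \<circ>\<^sub>F E) (lleg S)"
    "nat_isomorphic (apex S) B (rleg S' \<circ>\<^sub>F E) (rleg S)"
    using S(3) by (auto simp: span_equiv_def)
  obtain E' where E': "cat_equivalence (apex T) (apex T') E'"
    "nat_isomorphic (apex T) A' (lleg T' \<circ>\<^sub>F E') (lleg T)"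
    "nat_isomorphic (apex T) B' (rleg T' \<circ>\<^sub>F E') (rleg T)"
    using T(3) by (auto simp: span_equiv_def)
  note s = is_spanD[OF S(1)] and s' = is_spanD[OF S(2)]
    and t = is_spanD[OF T(1)] and t' = is_spanD[OF T(2)]
  show ?thesis
    by (rule span_equivI[where E = "prod_func E E'"])
      (simp_all add: prod_func_comp cat_equivalence_prod[OF s(1) t(1) s'(1) t'(1) E(1) E'(1)]
        nat_isomorphic_prod[OF s(1) t(1) gr(1,3) E(2) E'(2)]
        nat_isomorphic_prod[OF s(1) t(1) gr(2,4) E(3) E'(3)])
qed

text \<open>Composites and products of classes are unions over all pairs of representatives. By the
  congruence lemmas every pair contributes the same class, and as both index classes are nonempty
  the union is that class.\<close>

lemma UN_constant_pair:
  assumes "x \<in> P" "y \<in> Q" "\<And>x y. x \<in> P \<Longrightarrow> y \<in> Q \<Longrightarrow> f x y = c"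
  shows "(\<Union>x\<in>P. \<Union>y\<in>Q. f x y) = c"
  using assms by blast

lemma span_class_self: "groupoid A \<Longrightarrow> groupoid B \<Longrightarrow> is_span A B S \<Longrightarrow> S \<in> span_class A B S"
  by (simp add: span_class_def span_equiv_refl)

lemma span_mor_comp_span_mor:
  assumes gr: "groupoid A" "groupoid B" "groupoid D" and S: "is_span A B S" and T: "is_span B D T"
  shows "span_mor_comp (span_mor B D T) (span_mor A B S) = span_mor A D (span_comp B T S)"
proof -
  have "span_class A D (span_comp B T' S') = span_class A D (span_comp B T S)"
    if "S' \<in> span_class A B S" "T' \<in> span_class B D T" for S' T'
  proof -
    have s: "is_span A B S'" "span_equiv A B S S'" and t: "is_span B D T'" "span_equiv B D T T'"
      using that by (auto simp: span_class_def)
    show ?thesis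
      by (rule span_class_eqI[symmetric, OF gr(1,3) is_span_comp[OF gr(2) S T] is_span_comp[OF gr(2) s(1) t(1)]
            span_equiv_comp_cong[OF gr S s T t]])
  qed
  from UN_constant_pair[OF span_class_self[OF gr(1,2) S] span_class_self[OF gr(2,3) T] this]
  show ?thesis by (simp add: span_mor_comp_def span_mor_def)
qed

lemma span_mor_prod_span_mor:
  assumes gr: "groupoid A" "groupoid B" "groupoid A'" "groupoid B'"
    and S: "is_span A B S" and T: "is_span A' B' T"
  shows "span_mor_prod (span_mor A B S) (span_mor A' B' T) =
    span_mor (prod_grpd A A') (prod_grpd B B') (span_prod S T)"
proof -
  note grA = groupoid_prod[OF gr(1,3)] and grB = groupoid_prod[OF gr(2,4)]
  have "span_class (prod_grpd A A') (prod_grpd B B') (span_prod S' T') =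
      span_class (prod_grpd A A') (prod_grpd B B') (span_prod S T)"
    if "S' \<in> span_class A B S" "T' \<in> span_class A' B' T" for S' T'
  proof -
    have s: "is_span A B S'" "span_equiv A B S S'" and t: "is_span A' B' T'" "span_equiv A' B' T T'"
      using that by (auto simp: span_class_def)
    show ?thesis
      by (rule span_class_eqI[symmetric, OF grA grB is_span_prod[OF S T] is_span_prod[OF s(1) t(1)]
            span_equiv_prod_cong[OF gr S s T t]])
  qed
  from UN_constant_pair[OF span_class_self[OF gr(1,2) S] span_class_self[OF gr(3,4) T] this]
  show ?thesis by (simp add: span_mor_prod_def span_mor_def)
qed

text \<open>Precomposing a span with an invertible functor only moves the inverse into the left leg.
  The inverse laws are asked on objects and arrows only, since the underlying functions are total on
  the universe and arbitrary elsewhere.\<close>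

lemma span_equiv_comp_func_span:
  assumes gr: "groupoid A" "groupoid B" "groupoid D" and F: "is_functor A B F" "is_functor B A F'"
    and inv: "\<And>a. a \<in> Ob A \<Longrightarrow> on_Ob F' (on_Ob F a) = a" "\<And>b. b \<in> Ob B \<Longrightarrow> on_Ob F (on_Ob F' b) = b"
      "\<And>a a' f. f \<in> hom A a a' \<Longrightarrow> on_Ar F' (on_Ar F f) = f"
      "\<And>b b' f. f \<in> hom B b b' \<Longrightarrow> on_Ar F (on_Ar F' f) = f"
    and T: "is_span B D T"
  shows "span_equiv A D \<lparr>apex = apex T, lleg = F' \<circ>\<^sub>F lleg T, rleg = rleg T\<rparr> (span_comp B T (func_span A F))"
proof -
  interpret B: groupoid B by fact
  note t = is_spanD[OF T] and lO = functor_Ob[OF is_spanD(3)[OF T]] and lA = functor_hom[OF is_spanD(3)[OF T]]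
  interpret X: groupoid "apex T" by fact
  note fl = is_functor_comp[OF t(2) t(3) F(2)]
  show ?thesis
  proof (rule span_equiv_comp_strict[OF gr is_span_func[OF gr(1) F(1)] T,
        where P = "F' \<circ>\<^sub>F lleg T" and Q = id_func], simp_all)
    show "is_span A D \<lparr>apex = apex T, lleg = F' \<circ>\<^sub>F lleg T, rleg = rleg T\<rparr>"
      using t fl by (simp add: is_span_def)
    show "is_functor (apex T) A (F' \<circ>\<^sub>F lleg T)" by fact
    show "is_functor (apex T) (apex T) id_func" by (rule is_functor_id[OF t(2)])
    show "on_Ob (lleg T) u = on_Ob F (on_Ob F' (on_Ob (lleg T) u))" if "u \<in> Ob (apex T)" for u
      by (simp add: inv(2) lO that)
    show "on_Ar (lleg T) h = on_Ar F (on_Ar F' (on_Ar (lleg T) h))" if "h \<in> hom (apex T) u v" for u v h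
      by (simp add: inv(4)[OF lA[OF that]])
    show "on_Ar F' (on_Ar F f) = f" if "f \<in> hom A (on_Ob F' (on_Ob (lleg T) u)) (on_Ob F' (on_Ob (lleg T) v))" for u v f
      by (rule inv(3)[OF that])
    show "\<exists>u. u \<in> Ob (apex T) \<and> (\<exists>f. f \<in> hom A (on_Ob F' (on_Ob (lleg T) u)) x \<and>
        (\<exists>g. g \<in> hom (apex T) u y \<and> on_Ar (lleg T) g = \<phi> \<cdot>\<^bsub>B\<^esub> on_Ar F f))"
      if x: "x \<in> Ob A" and y: "y \<in> Ob (apex T)" and \<phi>: "\<phi> \<in> hom B (on_Ob F x) (on_Ob (lleg T) y)" for x y \<phi>
    proof (intro exI conjI)
      note \<phi>i = B.inv_arr[OF B.iso[OF \<phi>] \<phi>]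
      \<comment> \<open>\<open>y\<close> itself with its identity serves as the object of the apex.
        All of \<phi> is absorbed, inverted, by the component over \<open>A\<close>.\<close>
      show "on_Ar F' (inv_arr B \<phi>) \<in> hom A (on_Ob F' (on_Ob (lleg T) y)) x"
        using functor_hom[OF F(2) \<phi>i(1)] by (simp add: inv(1) x)
      show "on_Ar (lleg T) (Idt (apex T) y) = \<phi> \<cdot>\<^bsub>B\<^esub> on_Ar F (on_Ar F' (inv_arr B \<phi>))"
        using \<phi>i by (simp add: inv(4)[OF \<phi>i(1)] functor_id[OF t(3) y])
    qed (simp_all add: y X.id_hom)
  qed
qed

section \<open>Pushouts and pullbacks\<close>

text \<open>Duality: the pullback lemmas below are instances, in the opposite category, of the
  pushout lemmas.\<close>

definition op_cat :: "('o, 'a, 'm) cat_scheme \<Rightarrow> ('o, 'a, 'm) cat_scheme" where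
  "op_cat C = C\<lparr>Dom := Cod C, Cod := Dom C, Cmp := \<lambda>g f. f \<cdot>\<^bsub>C\<^esub> g\<rparr>"

lemma op_cat_simps [simp]:
  "Ob (op_cat C) = Ob C" "Ar (op_cat C) = Ar C" "Dom (op_cat C) = Cod C" "Cod (op_cat C) = Dom C"
  "Idt (op_cat C) = Idt C" "g \<cdot>\<^bsub>op_cat C\<^esub> f = f \<cdot>\<^bsub>C\<^esub> g" "hom (op_cat C) a b = hom C b a"
  by (auto simp: op_cat_def hom_def)

lemma (in category) category_op: "category (op_cat C)"
  by unfold_locales (auto simp: dom_Ob cod_Ob id_hom comp_id id_comp comp_assoc intro: comp_hom)

lemma is_iso_op [simp]: "is_iso (op_cat C) f \<longleftrightarrow> is_iso C f"
  by (auto simp: is_iso_def)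

text \<open>In the opposite category the square is read from its other corner, so the cospan
  \<open>q\<close>, \<open>g\<close> takes the place of the span.\<close>

lemma pullback_iff_pushout_op: "pullback_square C f p q g \<longleftrightarrow> pushout_square (op_cat C) q g f p"
proof -
  have "comm_square (op_cat C) q g f p \<longleftrightarrow> comm_square C f p q g" for f p
    by (auto simp: comm_square_def)
  then show ?thesis by (simp add: pullback_square_def pushout_square_def)
qed

lemma comm_square_flip: "comm_square C f p q g \<longleftrightarrow> comm_square C p f g q"
  by (auto simp: comm_square_def)

text \<open>Transposition turns the pasting lemmas for horizontal composites into those for vertical
  ones.\<close>

lemma pushout_square_flip: "pushout_square C f p q g \<Longrightarrow> pushout_square C p f g q"
  unfolding pushout_square_def
  by (subst (asm) (1 2) comm_square_flip) (auto simp: comm_square_def conj_commute)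

lemma comm_squareI:
  "f \<in> hom C a b \<Longrightarrow> p \<in> hom C a c \<Longrightarrow> q \<in> hom C b d \<Longrightarrow> g \<in> hom C c d \<Longrightarrow>
    q \<cdot>\<^bsub>C\<^esub> f = g \<cdot>\<^bsub>C\<^esub> p \<Longrightarrow> comm_square C f p q g"
  by (auto simp: comm_square_def hom_def)

lemma comm_squareE:
  assumes "comm_square C f p q g"
  obtains a b c d where "f \<in> hom C a b" "p \<in> hom C a c" "q \<in> hom C b d" "g \<in> hom C c d"
    "q \<cdot>\<^bsub>C\<^esub> f = g \<cdot>\<^bsub>C\<^esub> p"
  using assms by (auto simp: comm_square_def hom_def)

lemma comm_square_leftE:
  assumes "comm_square C f p q g" "p \<in> hom C a c"
  obtains b d where "f \<in> hom C a b" "q \<in> hom C b d" "g \<in> hom C c d" "q \<cdot>\<^bsub>C\<^esub> f = g \<cdot>\<^bsub>C\<^esub> p"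
  using assms by (auto simp: comm_square_def hom_def)

lemma pushout_comm: "pushout_square C f p q g \<Longrightarrow> comm_square C f p q g"
  by (simp add: pushout_square_def)

lemma pushout_ex1:
  assumes "pushout_square C f p q g" "comm_square C f p q' g'"
    and "q \<in> hom C b d" "q' \<in> hom C b x"
  shows "\<exists>!u. u \<in> hom C d x \<and> u \<cdot>\<^bsub>C\<^esub> q = q' \<and> u \<cdot>\<^bsub>C\<^esub> g = g'"
proof -
  have "\<exists>!u. u \<in> hom C (Cod C q) (Cod C q') \<and> u \<cdot>\<^bsub>C\<^esub> q = q' \<and> u \<cdot>\<^bsub>C\<^esub> g = g'"
    using assms(1,2) unfolding pushout_square_def by blast
  then show ?thesis by (simp add: homD(3)[OF assms(3)] homD(3)[OF assms(4)])
qed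

context category
begin

section \<open>Monomorphisms and epimorphisms\<close>

lemma monicI:
  assumes "f \<in> hom C a b" "\<And>x g h. g \<in> hom C x a \<Longrightarrow> h \<in> hom C x a \<Longrightarrow> f \<cdot> g = f \<cdot> h \<Longrightarrow> g = h"
  shows "monic C f"
  using assms by (auto simp: monic_def homD)

lemma monicD:
  assumes "monic C f" "f \<in> hom C a b" "g \<in> hom C x a" "h \<in> hom C x a" "f \<cdot> g = f \<cdot> h"
  shows "g = h"
  using assms by (auto simp: monic_def homD)

lemma epicI:
  assumes "f \<in> hom C a b" "\<And>x g h. g \<in> hom C b x \<Longrightarrow> h \<in> hom C b x \<Longrightarrow> g \<cdot> f = h \<cdot> f \<Longrightarrow> g = h"
  shows "epic C f"
  using assms by (auto simp: epic_def homD)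

lemma epicD:
  assumes "epic C f" "f \<in> hom C a b" "g \<in> hom C b x" "h \<in> hom C b x" "g \<cdot> f = h \<cdot> f"
  shows "g = h"
  using assms by (auto simp: epic_def homD)

lemma iso_monic: "is_iso C f \<Longrightarrow> f \<in> hom C a b \<Longrightarrow> monic C f"
  by (rule monicI) (auto intro: iso_cancel_left)

lemma iso_epic: "is_iso C f \<Longrightarrow> f \<in> hom C a b \<Longrightarrow> epic C f"
  by (rule epicI) (auto intro: iso_cancel_right)

lemma monic_comp:
  assumes "monic C f" "f \<in> hom C a b" "monic C g" "g \<in> hom C b c"
  shows "monic C (g \<cdot> f)"
proof (rule monicI[OF comp_hom[OF assms(2,4)]])
  fix x h k assume h: "h \<in> hom C x a" and k: "k \<in> hom C x a" and "(g \<cdot> f) \<cdot> h = (g \<cdot> f) \<cdot> k"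
  then have "g \<cdot> (f \<cdot> h) = g \<cdot> (f \<cdot> k)"
    by (simp add: comp_assoc[OF h assms(2,4)] comp_assoc[OF k assms(2,4)])
  then have "f \<cdot> h = f \<cdot> k"
    by (rule monicD[OF assms(3,4) comp_hom[OF h assms(2)] comp_hom[OF k assms(2)]])
  then show "h = k" by (rule monicD[OF assms(1,2) h k])
qed

lemma epic_comp:
  assumes "epic C f" "f \<in> hom C a b" "epic C g" "g \<in> hom C b c"
  shows "epic C (g \<cdot> f)"
proof (rule epicI[OF comp_hom[OF assms(2,4)]])
  fix x h k assume h: "h \<in> hom C c x" and k: "k \<in> hom C c x" and "h \<cdot> (g \<cdot> f) = k \<cdot> (g \<cdot> f)"
  then have "(h \<cdot> g) \<cdot> f = (k \<cdot> g) \<cdot> f"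
    by (simp add: comp_assoc[OF assms(2,4) h] comp_assoc[OF assms(2,4) k])
  then have "h \<cdot> g = k \<cdot> g"
    by (rule epicD[OF assms(1,2) comp_hom[OF assms(4) h] comp_hom[OF assms(4) k]])
  then show "h = k" by (rule epicD[OF assms(3,4) h k])
qed

lemma monic_cancel:
  assumes "f \<in> hom C a b" "g \<in> hom C b c" "monic C (g \<cdot> f)"
  shows "monic C f"
proof (rule monicI[OF assms(1)])
  fix x h k assume h: "h \<in> hom C x a" and k: "k \<in> hom C x a" and "f \<cdot> h = f \<cdot> k"
  then have "(g \<cdot> f) \<cdot> h = (g \<cdot> f) \<cdot> k"
    by (simp add: comp_assoc[OF h assms(1,2), symmetric] comp_assoc[OF k assms(1,2), symmetric])
  then show "h = k" by (rule monicD[OF assms(3) comp_hom[OF assms(1,2)] h k])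
qed

lemma epic_cancel:
  assumes "f \<in> hom C a b" "g \<in> hom C b c" "epic C (g \<cdot> f)"
  shows "epic C g"
proof (rule epicI[OF assms(2)])
  fix x h k assume h: "h \<in> hom C c x" and k: "k \<in> hom C c x" and "h \<cdot> g = k \<cdot> g"
  then have "h \<cdot> (g \<cdot> f) = k \<cdot> (g \<cdot> f)"
    by (simp add: comp_assoc[OF assms(1,2) h] comp_assoc[OF assms(1,2) k])
  then show "h = k" by (rule epicD[OF assms(3) comp_hom[OF assms(1,2)] h k])
qed

section \<open>Pushouts: pasting, cancellation, induced isomorphisms\<close>

lemma pushout_squareI:
  assumes "f \<in> hom C a b" "p \<in> hom C a c" "q \<in> hom C b d" "g \<in> hom C c d" "q \<cdot> f = g \<cdot> p"
    and ex: "\<And>x q' g'. q' \<in> hom C b x \<Longrightarrow> g' \<in> hom C c x \<Longrightarrow> q' \<cdot> f = g' \<cdot> p \<Longrightarrow>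
      \<exists>u. u \<in> hom C d x \<and> u \<cdot> q = q' \<and> u \<cdot> g = g'"
    and un: "\<And>x u v. u \<in> hom C d x \<Longrightarrow> v \<in> hom C d x \<Longrightarrow> u \<cdot> q = v \<cdot> q \<Longrightarrow> u \<cdot> g = v \<cdot> g \<Longrightarrow> u = v"
  shows "pushout_square C f p q g"
  unfolding pushout_square_def
proof (intro conjI allI impI)
  show "comm_square C f p q g" by (rule comm_squareI) (fact assms)+
  fix q' g' assume sq: "comm_square C f p q' g'"
  have q': "q' \<in> hom C b (Cod C q')" and g': "g' \<in> hom C c (Cod C q')" and "q' \<cdot> f = g' \<cdot> p"
    using sq assms(1,2) by (auto simp: comm_square_def hom_def)
  then obtain u where "u \<in> hom C d (Cod C q') \<and> u \<cdot> q = q' \<and> u \<cdot> g = g'" using ex by blast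
  then show "\<exists>!u. u \<in> hom C (Cod C q) (Cod C q') \<and> u \<cdot> q = q' \<and> u \<cdot> g = g'"
    using un assms(3) by (auto simp: homD intro!: ex1I[of _ u])
qed

lemma pushout_induced:
  assumes "pushout_square C f p q g" "f \<in> hom C a b" "p \<in> hom C a c" "q \<in> hom C b d" "g \<in> hom C c d"
    and "q' \<in> hom C b x" "g' \<in> hom C c x" "q' \<cdot> f = g' \<cdot> p"
  obtains u where "u \<in> hom C d x" "u \<cdot> q = q'" "u \<cdot> g = g'"
  using pushout_ex1[OF assms(1) comm_squareI[OF assms(2,3,6,7,8)] assms(4,6)] by blast

lemma pushout_unique:
  assumes "pushout_square C f p q g" "f \<in> hom C a b" "p \<in> hom C a c" "q \<in> hom C b d" "g \<in> hom C c d"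
    and "u \<in> hom C d x" "v \<in> hom C d x" "u \<cdot> q = v \<cdot> q" "u \<cdot> g = v \<cdot> g"
  shows "u = v"
proof -
  have "q \<cdot> f = g \<cdot> p" using pushout_comm[OF assms(1)] by (simp add: comm_square_def)
  then have "(u \<cdot> q) \<cdot> f = (u \<cdot> g) \<cdot> p"
    by (simp add: comp_assoc[OF assms(2,4,6), symmetric] comp_assoc[OF assms(3,5,6), symmetric])
  from pushout_ex1[OF assms(1) comm_squareI[OF assms(2,3) comp_hom[OF assms(4,6)] comp_hom[OF assms(5,6)] this]
      assms(4) comp_hom[OF assms(4,6)]]
  show ?thesis using assms(6-9) by metis
qed

lemma pushout_comp:
  assumes 1: "pushout_square C f p q g" and 2: "pushout_square C f' q r g'"
  shows "pushout_square C (f' \<cdot> f) p r (g' \<cdot> g)"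
proof -
  obtain a b c d where h: "f \<in> hom C a b" "p \<in> hom C a c" "q \<in> hom C b d" "g \<in> hom C c d" "q \<cdot> f = g \<cdot> p"
    using pushout_comm[OF 1] by (rule comm_squareE)
  obtain b' d' where h': "f' \<in> hom C b b'" "r \<in> hom C b' d'" "g' \<in> hom C d d'" "r \<cdot> f' = g' \<cdot> q"
    using pushout_comm[OF 2] h(3) by (rule comm_square_leftE)
  show ?thesis
  proof (rule pushout_squareI[OF comp_hom[OF h(1) h'(1)] h(2) h'(2) comp_hom[OF h(4) h'(3)]])
    show "r \<cdot> f' \<cdot> f = (g' \<cdot> g) \<cdot> p"
      by (simp add: comp_assoc[OF h(1) h'(1,2)] h'(4) comp_assoc[OF h(1,3) h'(3), symmetric] h(5)
          comp_assoc[OF h(2,4) h'(3)])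
  next
    fix x r' k assume r': "r' \<in> hom C b' x" and k: "k \<in> hom C c x" and eq: "r' \<cdot> f' \<cdot> f = k \<cdot> p"
    have "(r' \<cdot> f') \<cdot> f = k \<cdot> p" using eq comp_assoc[OF h(1) h'(1) r'] by simp
    then obtain u where u: "u \<in> hom C d x" "u \<cdot> q = r' \<cdot> f'" "u \<cdot> g = k"
      using pushout_induced[OF 1 h(1-4) comp_hom[OF h'(1) r'] k] by blast
    obtain v where v: "v \<in> hom C d' x" "v \<cdot> r = r'" "v \<cdot> g' = u"
      using pushout_induced[OF 2 h'(1) h(3) h'(2,3) r' u(1)] u(2) by metis
    then show "\<exists>u. u \<in> hom C d' x \<and> u \<cdot> r = r' \<and> u \<cdot> g' \<cdot> g = k"
      using comp_assoc[OF h(4) h'(3) v(1)] u(3) by auto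
  next
    fix x u v assume u: "u \<in> hom C d' x" and v: "v \<in> hom C d' x" and eq: "u \<cdot> r = v \<cdot> r" "u \<cdot> g' \<cdot> g = v \<cdot> g' \<cdot> g"
    have "u \<cdot> g' = v \<cdot> g'"
    proof (rule pushout_unique[OF 1 h(1-4) comp_hom[OF h'(3) u] comp_hom[OF h'(3) v]])
      show "(u \<cdot> g') \<cdot> q = (v \<cdot> g') \<cdot> q"
        using comp_assoc[OF h(3) h'(3) u] comp_assoc[OF h(3) h'(3) v] comp_assoc[OF h'(1,2) u]
          comp_assoc[OF h'(1,2) v] h'(4) eq(1) by simp
      show "(u \<cdot> g') \<cdot> g = (v \<cdot> g') \<cdot> g"
        using comp_assoc[OF h(4) h'(3) u] comp_assoc[OF h(4) h'(3) v] eq(2) by simp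
    qed
    then show "u = v" using pushout_unique[OF 2 h'(1) h(3) h'(2,3) u v eq(1)] by simp
  qed
qed

text \<open>A cocone \<open>r'\<close>, \<open>k\<close> under the right square gives one under the
  outer square by restricting \<open>k\<close> along \<open>g\<close>. The arrow so induced agrees
  with \<open>k\<close> because arrows out of the left pushout are determined by their composites
  with \<open>q\<close> and \<open>g\<close>.\<close>

lemma pushout_cancel:
  assumes 1: "pushout_square C f p q g" and 2: "pushout_square C (f' \<cdot> f) p r (g' \<cdot> g)"
    and 3: "comm_square C f' q r g'"
  shows "pushout_square C f' q r g'"
proof -
  obtain a b c d where h: "f \<in> hom C a b" "p \<in> hom C a c" "q \<in> hom C b d" "g \<in> hom C c d" "q \<cdot> f = g \<cdot> p"
    using pushout_comm[OF 1] by (rule comm_squareE)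
  obtain b' d' where h': "f' \<in> hom C b b'" "r \<in> hom C b' d'" "g' \<in> hom C d d'" "r \<cdot> f' = g' \<cdot> q"
    using 3 h(3) by (rule comm_square_leftE)
  show ?thesis
  proof (rule pushout_squareI[OF h'(1) h(3) h'(2-4)])
    fix x r' k assume r': "r' \<in> hom C b' x" and k: "k \<in> hom C d x" and eq: "r' \<cdot> f' = k \<cdot> q"
    have "r' \<cdot> f' \<cdot> f = (k \<cdot> g) \<cdot> p"
      using eq h(5) comp_assoc[OF h(1) h'(1) r'] comp_assoc[OF h(2,4) k] comp_assoc[OF h(1,3) k] by simp
    then obtain u where u: "u \<in> hom C d' x" "u \<cdot> r = r'" "u \<cdot> g' \<cdot> g = k \<cdot> g"
      using pushout_induced[OF 2 comp_hom[OF h(1) h'(1)] h(2) h'(2) comp_hom[OF h(4) h'(3)] r' comp_hom[OF h(4) k]]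
      by blast
    have "u \<cdot> g' = k"
    proof (rule pushout_unique[OF 1 h(1-4) comp_hom[OF h'(3) u(1)] k])
      show "(u \<cdot> g') \<cdot> q = k \<cdot> q"
        using comp_assoc[OF h(3) h'(3) u(1)] comp_assoc[OF h'(1,2) u(1)] h'(4) u(2) eq by simp
      show "(u \<cdot> g') \<cdot> g = k \<cdot> g"
        using comp_assoc[OF h(4) h'(3) u(1)] u(3) by simp
    qed
    with u show "\<exists>u. u \<in> hom C d' x \<and> u \<cdot> r = r' \<and> u \<cdot> g' = k" by blast
  next
    fix x u v assume u: "u \<in> hom C d' x" and v: "v \<in> hom C d' x" and eq: "u \<cdot> r = v \<cdot> r" "u \<cdot> g' = v \<cdot> g'"
    have "u \<cdot> g' \<cdot> g = v \<cdot> g' \<cdot> g"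
      using comp_assoc[OF h(4) h'(3) u] comp_assoc[OF h(4) h'(3) v] eq(2) by simp
    then show "u = v"
      using pushout_unique[OF 2 comp_hom[OF h(1) h'(1)] h(2) h'(2) comp_hom[OF h(4) h'(3)] u v eq(1)] by simp
  qed
qed

text \<open>The induced arrow is forced to be \<open>g'\<close> after the inverse of
  \<open>g\<close>; its compatibility with \<open>q\<close> may be tested after precomposing with
  the isomorphism \<open>f\<close>.\<close>

lemma pushout_iso_square:
  assumes sq: "comm_square C f p q g" and "is_iso C f" "is_iso C g"
  shows "pushout_square C f p q g"
proof -
  obtain a b c d where h: "f \<in> hom C a b" "p \<in> hom C a c" "q \<in> hom C b d" "g \<in> hom C c d" "q \<cdot> f = g \<cdot> p"
    using sq by (rule comm_squareE)
  note gi = inv_arr[OF assms(3) h(4)]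
  show ?thesis
  proof (rule pushout_squareI[OF h])
    fix x q' g' assume q': "q' \<in> hom C b x" and g': "g' \<in> hom C c x" and eq: "q' \<cdot> f = g' \<cdot> p"
    note u = comp_hom[OF gi(1) g']
    have ug: "(g' \<cdot> inv_arr C g) \<cdot> g = g'" by (rule comp_inv_cancel(3)[OF assms(3) h(4) g'])
    have "((g' \<cdot> inv_arr C g) \<cdot> q) \<cdot> f = q' \<cdot> f"
      using comp_assoc[OF h(1,3) u] comp_assoc[OF h(2,4) u] ug eq h(5) by simp
    then have "(g' \<cdot> inv_arr C g) \<cdot> q = q'"
      by (rule iso_cancel_right[OF assms(2) h(1) comp_hom[OF h(3) u] q'])
    with u ug show "\<exists>u. u \<in> hom C d x \<and> u \<cdot> q = q' \<and> u \<cdot> g = g'" by blast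
  qed (rule iso_cancel_right[OF assms(3) h(4)])
qed

text \<open>The identity of \<open>b\<close> and the composite of \<open>f\<close> with the inverse
  of \<open>p\<close> form a cocone, and the arrow it induces is inverse to
  \<open>q\<close>.\<close>

lemma pushout_iso_side:
  assumes po: "pushout_square C f p q g" and p: "is_iso C p"
  shows "is_iso C q"
proof -
  obtain a b c d where h: "f \<in> hom C a b" "p \<in> hom C a c" "q \<in> hom C b d" "g \<in> hom C c d" "q \<cdot> f = g \<cdot> p"
    using pushout_comm[OF po] by (rule comm_squareE)
  note pi = inv_arr[OF p h(2)]
  note b = hom_Ob(1)[OF h(3)] and d = hom_Ob(2)[OF h(3)]
  have "Idt C b \<cdot> f = (f \<cdot> inv_arr C p) \<cdot> p"
    by (simp add: id_comp[OF h(1)] comp_inv_cancel(3)[OF p h(2) h(1)])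
  then obtain u where u: "u \<in> hom C d b" "u \<cdot> q = Idt C b" "u \<cdot> g = f \<cdot> inv_arr C p"
    using pushout_induced[OF po h(1-4) id_hom[OF b] comp_hom[OF pi(1) h(1)]] by blast
  have "q \<cdot> u = Idt C d"
  proof (rule pushout_unique[OF po h(1-4) comp_hom[OF u(1) h(3)] id_hom[OF d]])
    show "(q \<cdot> u) \<cdot> q = Idt C d \<cdot> q"
      by (simp add: comp_assoc[OF h(3) u(1) h(3), symmetric] u(2) comp_id[OF h(3)] id_comp[OF h(3)])
    show "(q \<cdot> u) \<cdot> g = Idt C d \<cdot> g"
      by (simp add: comp_assoc[OF h(4) u(1) h(3), symmetric] u(3) comp_assoc[OF pi(1) h(1) h(3)] h(5)
          comp_inv_cancel(4)[OF p h(2) h(4)] id_comp[OF h(4)])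
  qed
  then show ?thesis using is_isoI[OF h(3) u(1,2)] by blast
qed

lemma pushout_map:
  assumes 1: "pushout_square C f p q g" and 2: "comm_square C f' p' q' g'"
    and h: "f \<in> hom C a b" "p \<in> hom C a c" "q \<in> hom C b d" "g \<in> hom C c d"
    and h': "f' \<in> hom C a' b'" "p' \<in> hom C a' c'" "q' \<in> hom C b' d'" "g' \<in> hom C c' d'"
    and i: "s \<in> hom C a a'" "t \<in> hom C b b'" "u \<in> hom C c c'" "t \<cdot> f = f' \<cdot> s" "u \<cdot> p = p' \<cdot> s"
  obtains v where "v \<in> hom C d d'" "v \<cdot> q = q' \<cdot> t" "v \<cdot> g = g' \<cdot> u"
proof -
  have "q' \<cdot> f' = g' \<cdot> p'" using 2 by (simp add: comm_square_def)
  then have "(q' \<cdot> t) \<cdot> f = (g' \<cdot> u) \<cdot> p"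
    using comp_assoc[OF h(1) i(2) h'(3)] comp_assoc[OF i(1) h'(1,3)] comp_assoc[OF h(2) i(3) h'(4)]
      comp_assoc[OF i(1) h'(2,4)] i(4,5) by simp
  from pushout_induced[OF 1 h comp_hom[OF i(2) h'(3)] comp_hom[OF i(3) h'(4)] this] that
  show thesis by blast
qed

text \<open>The inverses of \<open>s\<close>, \<open>t\<close> and \<open>u\<close> induce an arrow
  back, and both round trips are identities by the uniqueness part of the universal
  property.\<close>

lemma pushout_map_iso:
  assumes 1: "pushout_square C f p q g" and 2: "pushout_square C f' p' q' g'"
    and h: "f \<in> hom C a b" "p \<in> hom C a c" "q \<in> hom C b d" "g \<in> hom C c d"
    and h': "f' \<in> hom C a' b'" "p' \<in> hom C a' c'" "q' \<in> hom C b' d'" "g' \<in> hom C c' d'"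
    and i: "s \<in> hom C a a'" "t \<in> hom C b b'" "u \<in> hom C c c'" "t \<cdot> f = f' \<cdot> s" "u \<cdot> p = p' \<cdot> s"
    and iso: "is_iso C s" "is_iso C t" "is_iso C u"
  obtains v where "v \<in> hom C d d'" "is_iso C v" "v \<cdot> q = q' \<cdot> t" "v \<cdot> g = g' \<cdot> u"
proof -
  note s' = inv_arr[OF iso(1) i(1)] and t' = inv_arr[OF iso(2) i(2)] and u' = inv_arr[OF iso(3) i(3)]
  note d = hom_Ob(2)[OF h(3)] and d' = hom_Ob(2)[OF h'(3)]
  obtain v where v: "v \<in> hom C d d'" "v \<cdot> q = q' \<cdot> t" "v \<cdot> g = g' \<cdot> u"
    by (rule pushout_map[OF 1 pushout_comm[OF 2] h h' i])
  obtain w where w: "w \<in> hom C d' d" "w \<cdot> q' = q \<cdot> inv_arr C t" "w \<cdot> g' = g \<cdot> inv_arr C u"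
    by (rule pushout_map[OF 2 pushout_comm[OF 1] h' h s'(1) t'(1) u'(1)
          inv_natural[OF iso(1) i(1) iso(2) i(2) h(1) h'(1) i(4)]
          inv_natural[OF iso(1) i(1) iso(3) i(3) h(2) h'(2) i(5)]])
  have "w \<cdot> v = Idt C d"
  proof (rule pushout_unique[OF 1 h comp_hom[OF v(1) w(1)] id_hom[OF d]])
    show "(w \<cdot> v) \<cdot> q = Idt C d \<cdot> q"
      by (simp add: comp_assoc[OF h(3) v(1) w(1), symmetric] v(2) comp_assoc[OF i(2) h'(3) w(1)] w(2)
          comp_inv_cancel(3)[OF iso(2) i(2) h(3)] id_comp[OF h(3)])
    show "(w \<cdot> v) \<cdot> g = Idt C d \<cdot> g"
      by (simp add: comp_assoc[OF h(4) v(1) w(1), symmetric] v(3) comp_assoc[OF i(3) h'(4) w(1)] w(3)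
          comp_inv_cancel(3)[OF iso(3) i(3) h(4)] id_comp[OF h(4)])
  qed
  moreover have "v \<cdot> w = Idt C d'"
  proof (rule pushout_unique[OF 2 h' comp_hom[OF w(1) v(1)] id_hom[OF d']])
    show "(v \<cdot> w) \<cdot> q' = Idt C d' \<cdot> q'"
      by (simp add: comp_assoc[OF h'(3) w(1) v(1), symmetric] w(2) comp_assoc[OF t'(1) h(3) v(1)] v(2)
          comp_inv_cancel(4)[OF iso(2) i(2) h'(3)] id_comp[OF h'(3)])
    show "(v \<cdot> w) \<cdot> g' = Idt C d' \<cdot> g'"
      by (simp add: comp_assoc[OF h'(4) w(1) v(1), symmetric] w(3) comp_assoc[OF u'(1) h(4) v(1)] v(3)
          comp_inv_cancel(4)[OF iso(3) i(3) h'(4)] id_comp[OF h'(4)])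
  qed
  ultimately have "is_iso C v" by (rule is_isoI[OF v(1) w(1)])
  with v that show thesis by blast
qed

text \<open>In the opposite category \<open>s\<close>, \<open>t\<close> and \<open>u\<close> lead
  from the primed square to the unprimed one, so the two squares exchange their roles.\<close>

lemma pullback_map_iso:
  assumes 1: "pullback_square C f p q g" and 2: "pullback_square C f' p' q' g'"
    and h: "f \<in> hom C a b" "p \<in> hom C a c" "q \<in> hom C b d" "g \<in> hom C c d"
    and h': "f' \<in> hom C a' b'" "p' \<in> hom C a' c'" "q' \<in> hom C b' d'" "g' \<in> hom C c' d'"
    and i: "s \<in> hom C d d'" "t \<in> hom C b b'" "u \<in> hom C c c'" "q' \<cdot> t = s \<cdot> q" "g' \<cdot> u = s \<cdot> g"
    and iso: "is_iso C s" "is_iso C t" "is_iso C u"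
  obtains v where "v \<in> hom C a a'" "is_iso C v" "f' \<cdot> v = t \<cdot> f" "p' \<cdot> v = u \<cdot> p"
  by (rule category.pushout_map_iso[OF category_op
        2[unfolded pullback_iff_pushout_op] 1[unfolded pullback_iff_pushout_op],
        where a = d' and b = b' and c = c' and d = a' and a' = d and b' = b and c' = c and d' = a
          and s = s and t = t and u = u])
    (use h h' i iso that in auto)

lemma pullback_induced:
  assumes "pullback_square C f p q g" "f \<in> hom C a b" "p \<in> hom C a c" "q \<in> hom C b d" "g \<in> hom C c d"
    and "f' \<in> hom C x b" "p' \<in> hom C x c" "q \<cdot> f' = g \<cdot> p'"
  obtains u where "u \<in> hom C x a" "f \<cdot> u = f'" "p \<cdot> u = p'"
  by (rule category.pushout_induced[OF category_op assms(1)[unfolded pullback_iff_pushout_op],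
        where a = d and b = b and c = c and d = a and q' = f' and g' = p' and x = x])
    (use assms that in auto)

text \<open>In the opposite category the composites occupy the vertical positions, hence the
  transpositions before and after \<open>pushout_cancel\<close>.\<close>

lemma pullback_cancel:
  assumes "pullback_square C f' q r g'" "pullback_square C (f' \<cdot> f) p r (g' \<cdot> g)"
    and "comm_square C f p q g"
  shows "pullback_square C f p q g"
proof -
  have "pushout_square (op_cat C) r g' f' q" "pushout_square (op_cat C) r (g' \<cdot> g) (f' \<cdot> f) p"
    using assms(1,2) by (simp_all add: pullback_iff_pushout_op)
  then have "pushout_square (op_cat C) g' r q f'"
    "pushout_square (op_cat C) (g \<cdot>\<^bsub>op_cat C\<^esub> g') r p (f \<cdot>\<^bsub>op_cat C\<^esub> f')"
    by (auto intro: pushout_square_flip)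
  moreover have "comm_square (op_cat C) g q p f" using assms(3) by (auto simp: comm_square_def)
  ultimately have "pushout_square (op_cat C) g q p f"
    by (rule category.pushout_cancel[OF category_op])
  then show ?thesis
    by (auto simp: pullback_iff_pushout_op intro: pushout_square_flip)
qed

lemma pullback_iso_side:
  assumes "pullback_square C f p q g" "is_iso C g"
  shows "is_iso C f"
  using category.pushout_iso_side[OF category_op] assms by (auto simp: pullback_iff_pushout_op)

lemma zero_unique:
  assumes "zero_object C z"
  shows "f \<in> hom C z a \<Longrightarrow> g \<in> hom C z a \<Longrightarrow> f = g"
    and "f \<in> hom C a z \<Longrightarrow> g \<in> hom C a z \<Longrightarrow> f = g"
  using assms hom_Ob unfolding zero_object_def by metis+

end

section \<open>Bicartesian squares\<close>

lemma bicartesianD: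
  assumes "bicartesian C f p q g"
  shows "comm_square C f p q g" "monic C f" "epic C p" "epic C q" "monic C g"
    "pushout_square C f p q g" "pullback_square C f p q g"
  using assms by (auto simp: bicartesian_def mono_epi_square_def)

context proto_abelian
begin

text \<open>The third axiom of a proto-abelian category supplies the pullback property.\<close>

lemma bicartesianI:
  assumes "pushout_square C f p q g" "monic C f" "epic C p" "epic C q" "monic C g"
  shows "bicartesian C f p q g"
proof -
  have "mono_epi_square C f p q g"
    using assms pushout_comm by (simp add: mono_epi_square_def)
  then show ?thesis
    using assms(1) pushout_iff_pullback by (simp add: bicartesian_def)
qed

lemma bicartesianI_pullback:
  assumes "pullback_square C f p q g" "monic C f" "epic C p" "epic C q" "monic C g"
  shows "bicartesian C f p q g"
proof -
  have "mono_epi_square C f p q g"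
    using assms by (simp add: mono_epi_square_def pullback_square_def)
  then show ?thesis
    using assms(1) pushout_iff_pullback by (simp add: bicartesian_def)
qed

lemma bicartesian_comp_hor:
  assumes "bicartesian C f p q g" and "bicartesian C f' q r g'"
  shows "bicartesian C (f' \<cdot> f) p r (g' \<cdot> g)"
proof (rule bicartesianI)
  note 1 = bicartesianD[OF assms(1)] and 2 = bicartesianD[OF assms(2)]
  show "pushout_square C (f' \<cdot> f) p r (g' \<cdot> g)" by (rule pushout_comp[OF 1(6) 2(6)])
  show "monic C (f' \<cdot> f)" "monic C (g' \<cdot> g)"
    using 1 2 by (auto intro!: monic_comp[OF _ homI[OF _ refl refl] _ homI[OF _ _ refl]] simp: comm_square_def)
  show "epic C p" "epic C r" using 1 2 by simp_all
qed

lemma bicartesian_comp_ver: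
  assumes "bicartesian C f p q g" and "bicartesian C g p' q' h"
  shows "bicartesian C f (p' \<cdot> p) (q' \<cdot> q) h"
proof (rule bicartesianI)
  note 1 = bicartesianD[OF assms(1)] and 2 = bicartesianD[OF assms(2)]
  show "pushout_square C f (p' \<cdot> p) (q' \<cdot> q) h"
    by (rule pushout_square_flip[OF pushout_comp[OF pushout_square_flip[OF 1(6)] pushout_square_flip[OF 2(6)]]])
  show "epic C (p' \<cdot> p)" "epic C (q' \<cdot> q)"
    using 1 2 by (auto intro!: epic_comp[OF _ homI[OF _ refl refl] _ homI[OF _ _ refl]] simp: comm_square_def)
  show "monic C f" "monic C h" using 1 2 by simp_all
qed

text \<open>A path of length zero is an identity. This and its vertical variant are the base cases
  when squares are pasted along paths.\<close>

lemma bicartesian_id_hor: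
  assumes "epic C p" "p \<in> hom C a b"
  shows "bicartesian C (Idt C a) p p (Idt C b)"
proof (rule bicartesianI)
  note ab = hom_Ob[OF assms(2)]
  note i = is_iso_Idt[OF ab(1)] is_iso_Idt[OF ab(2)]
  show "monic C (Idt C a)" "monic C (Idt C b)" using i iso_monic id_hom ab by blast+
  show "pushout_square C (Idt C a) p p (Idt C b)"
    by (rule pushout_iso_square[OF comm_squareI i])
      (use assms ab in \<open>auto intro: id_hom simp: comp_id id_comp\<close>)
qed fact+

lemma bicartesian_id_ver:
  assumes "monic C f" "f \<in> hom C a b"
  shows "bicartesian C f (Idt C a) (Idt C b) f"
proof (rule bicartesianI[OF pushout_square_flip])
  note ab = hom_Ob[OF assms(2)]
  note i = is_iso_Idt[OF ab(1)] is_iso_Idt[OF ab(2)]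
  show "epic C (Idt C a)" "epic C (Idt C b)" using i iso_epic id_hom ab by blast+
  show "pushout_square C (Idt C a) f f (Idt C b)"
    by (rule pushout_iso_square[OF comm_squareI i])
      (use assms ab in \<open>auto intro: id_hom simp: comp_id id_comp\<close>)
qed fact+

end

section \<open>Cores and small copies\<close>

lemma core_simps [simp]:
  "Ob (core A) = Ob A" "Ar (core A) = {f. is_iso A f}" "Dom (core A) = Dom A" "Cod (core A) = Cod A"
  "Idt (core A) = Idt A" "g \<cdot>\<^bsub>core A\<^esub> f = g \<cdot>\<^bsub>A\<^esub> f"
  by (simp_all add: core_def)

lemma hom_core [simp]: "f \<in> hom (core A) a b \<longleftrightarrow> f \<in> hom A a b \<and> is_iso A f"
  by (auto simp: hom_def is_iso_def)

lemma groupoid_core: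
  assumes "category A"
  shows "groupoid (core A)"
proof -
  interpret category A by fact
  have c: "category (core A)"
  proof
    show "Dom (core A) f \<in> Ob (core A)" "Cod (core A) f \<in> Ob (core A)" if "f \<in> Ar (core A)" for f
      using that by (auto simp: is_iso_def dom_Ob cod_Ob)
  qed (auto intro: id_hom comp_id id_comp comp_assoc comp_hom is_iso_comp is_iso_Idt)
  show ?thesis
  proof (rule groupoidI[OF c])
    fix a b f assume "f \<in> hom (core A) a b"
    then have f: "is_iso A f" "f \<in> hom A a b" by auto
    show "\<exists>g. g \<in> hom (core A) b a \<and> g \<cdot>\<^bsub>core A\<^esub> f = Idt (core A) a \<and> f \<cdot>\<^bsub>core A\<^esub> g = Idt (core A) b"
      by (rule exI[of _ "inv_arr A f"]) (simp add: inv_arr[OF f] is_iso_inv_arr[OF f(1)])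
  qed
qed

lemma functor_iso:
  assumes "category A" "category B" "is_functor A B F" "is_iso A f" "f \<in> hom A a b"
  shows "is_iso B (on_Ar F f)"
proof -
  interpret A: category A by fact
  interpret B: category B by fact
  note F = is_functorD[OF assms(3)] and i = A.inv_arr[OF assms(4,5)]
  show ?thesis
    by (rule B.is_isoI[OF F(2)[OF assms(5)] F(2)[OF i(1)]])
      (simp_all add: F(4)[OF assms(5) i(1), symmetric] F(4)[OF i(1) assms(5), symmetric] i
        F(3) A.hom_Ob[OF assms(5)])
qed

lemma is_functor_core:
  assumes "category A" "category B" "is_functor A B F"
  shows "is_functor (core A) (core B) F"
proof (rule is_functorI)
  show "category (core A)" by (rule groupoid.axioms(1)[OF groupoid_core[OF assms(1)]])
qed (auto simp: is_functorD[OF assms(3)] functor_iso[OF assms])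

abbreviation obj :: "'o \<Rightarrow> ('o + 'a) univ" where "obj a \<equiv> Atom (Inl a)"
abbreviation arr :: "'a \<Rightarrow> ('o + 'a) univ" where "arr f \<equiv> Atom (Inr f)"

lemma small_cat_simps [simp]:
  "obj a \<in> Ob (small_cat A) \<longleftrightarrow> a \<in> Ob A"
  "arr f \<in> hom (small_cat A) (obj a) (obj b) \<longleftrightarrow> f \<in> hom A a b"
  "Idt (small_cat A) (obj a) = arr (Idt A a)"
  "arr g \<cdot>\<^bsub>small_cat A\<^esub> arr f = arr (g \<cdot>\<^bsub>A\<^esub> f)"
  by (auto simp: small_cat_def hom_def)

lemma small_ObE:
  assumes "u \<in> Ob (small_cat A)"
  obtains a where "u = obj a" "a \<in> Ob A"
  using assms by (auto simp: small_cat_def)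

lemma small_homE:
  assumes "t \<in> hom (small_cat A) u v"
  obtains f a b where "t = arr f" "u = obj a" "v = obj b" "f \<in> hom A a b"
  using assms by (auto simp: small_cat_def hom_def)

lemma small_func_simps [simp]:
  "on_Ob (small_func F) (obj a) = obj (on_Ob F a)" "on_Ar (small_func F) (arr f) = arr (on_Ar F f)"
  by (simp_all add: small_func_def)

lemma category_small:
  assumes "category A"
  shows "category (small_cat A)"
proof -
  interpret category A by fact
  show ?thesis
  proof
    fix f assume "f \<in> Ar (small_cat A)"
    then show "Dom (small_cat A) f \<in> Ob (small_cat A)" "Cod (small_cat A) f \<in> Ob (small_cat A)"
      by (auto simp: small_cat_def dom_Ob cod_Ob)
  qed (auto elim!: small_homE small_ObE intro: id_hom comp_hom simp: comp_id id_comp comp_assoc)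
qed

lemma groupoid_small:
  assumes "groupoid A"
  shows "groupoid (small_cat A)"
proof (rule groupoidI)
  interpret groupoid A by fact
  show "category (small_cat A)" by (rule category_small) unfold_locales
  fix t u v assume "t \<in> hom (small_cat A) u v"
  then obtain f a b where *: "t = arr f" "u = obj a" "v = obj b" and f: "f \<in> hom A a b" by (rule small_homE)
  show "\<exists>s. s \<in> hom (small_cat A) v u \<and> s \<cdot>\<^bsub>small_cat A\<^esub> t = Idt (small_cat A) u \<and>
      t \<cdot>\<^bsub>small_cat A\<^esub> s = Idt (small_cat A) v"
    by (rule exI[of _ "arr (inv_arr A f)"]) (simp add: * inv_arr[OF iso[OF f] f])
qed

lemma is_functor_small:
  assumes "category A" "is_functor A B F"
  shows "is_functor (small_cat A) (small_cat B) (small_func F)"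
  using category_small[OF assms(1)]
  by (rule is_functorI) (auto elim!: small_homE small_ObE simp: is_functorD[OF assms(2)])

section \<open>Flags\<close>

lemma flagD:
  assumes "is_flag C z n D"
  shows flag_vert: "i \<le> j \<Longrightarrow> j \<le> n \<Longrightarrow> vert D i j \<in> Ob C"
    and flag_diag: "i \<le> n \<Longrightarrow> vert D i i = z"
    and flag_hor: "i \<le> j \<Longrightarrow> j < n \<Longrightarrow> hor D i j \<in> hom C (vert D i j) (vert D i (Suc j))"
    and flag_monic: "i \<le> j \<Longrightarrow> j < n \<Longrightarrow> monic C (hor D i j)"
    and flag_ver: "i < j \<Longrightarrow> j \<le> n \<Longrightarrow> ver D i j \<in> hom C (vert D i j) (vert D (Suc i) j)"
    and flag_epic: "i < j \<Longrightarrow> j \<le> n \<Longrightarrow> epic C (ver D i j)"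
    and flag_bicartesian: "i < j \<Longrightarrow> j < n \<Longrightarrow>
      bicartesian C (hor D i j) (ver D i j) (ver D i (Suc j)) (hor D (Suc i) j)"
    and flag_vert_undefined: "\<not> (i \<le> j \<and> j \<le> n) \<Longrightarrow> vert D i j = undefined"
    and flag_hor_undefined: "\<not> (i \<le> j \<and> j < n) \<Longrightarrow> hor D i j = undefined"
    and flag_ver_undefined: "\<not> (i < j \<and> j \<le> n) \<Longrightarrow> ver D i j = undefined"
proof -
  have *: "if i \<le> j \<and> j \<le> n then vert D i j \<in> Ob C else vert D i j = undefined"
    "if i \<le> j \<and> j < n
       then hor D i j \<in> hom C (vert D i j) (vert D i (j + 1)) \<and> monic C (hor D i j)
       else hor D i j = undefined"
    "if i < j \<and> j \<le> n
       then ver D i j \<in> hom C (vert D i j) (vert D (i + 1) j) \<and> epic C (ver D i j)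
       else ver D i j = undefined" for i j
    using assms unfolding is_flag_def by blast+
  have **: "i < j \<Longrightarrow> j < n \<Longrightarrow> bicartesian C (hor D i j) (ver D i j) (ver D i (j + 1)) (hor D (i + 1) j)"
    "i \<le> n \<Longrightarrow> vert D i i = z"
    using assms unfolding is_flag_def by blast+
  note *[of i j]
  show "i \<le> j \<Longrightarrow> j \<le> n \<Longrightarrow> vert D i j \<in> Ob C" "i \<le> n \<Longrightarrow> vert D i i = z"
    "i \<le> j \<Longrightarrow> j < n \<Longrightarrow> hor D i j \<in> hom C (vert D i j) (vert D i (Suc j))"
    "i \<le> j \<Longrightarrow> j < n \<Longrightarrow> monic C (hor D i j)"
    "i < j \<Longrightarrow> j \<le> n \<Longrightarrow> ver D i j \<in> hom C (vert D i j) (vert D (Suc i) j)"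
    "i < j \<Longrightarrow> j \<le> n \<Longrightarrow> epic C (ver D i j)"
    "i < j \<Longrightarrow> j < n \<Longrightarrow> bicartesian C (hor D i j) (ver D i j) (ver D i (Suc j)) (hor D (Suc i) j)"
    "\<not> (i \<le> j \<and> j \<le> n) \<Longrightarrow> vert D i j = undefined"
    "\<not> (i \<le> j \<and> j < n) \<Longrightarrow> hor D i j = undefined"
    "\<not> (i < j \<and> j \<le> n) \<Longrightarrow> ver D i j = undefined"
    using *[of i j] ** by (simp_all split: if_splits)
qed

lemma transfD:
  assumes "is_transf C n t"
  shows transf_component: "i \<le> j \<Longrightarrow> j \<le> n \<Longrightarrow> component t i j \<in> hom C (vert (src t) i j) (vert (tgt t) i j)"
    and transf_hor: "i \<le> j \<Longrightarrow> j < n \<Longrightarrow>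
      component t i (Suc j) \<cdot>\<^bsub>C\<^esub> hor (src t) i j = hor (tgt t) i j \<cdot>\<^bsub>C\<^esub> component t i j"
    and transf_ver: "i < j \<Longrightarrow> j \<le> n \<Longrightarrow>
      component t (Suc i) j \<cdot>\<^bsub>C\<^esub> ver (src t) i j = ver (tgt t) i j \<cdot>\<^bsub>C\<^esub> component t i j"
    and transf_undefined: "\<not> (i \<le> j \<and> j \<le> n) \<Longrightarrow> component t i j = undefined"
proof -
  have *: "if i \<le> j \<and> j \<le> n
       then component t i j \<in> hom C (vert (src t) i j) (vert (tgt t) i j)
       else component t i j = undefined" for i j
    using assms unfolding is_transf_def by blast
  show "i \<le> j \<Longrightarrow> j \<le> n \<Longrightarrow> component t i j \<in> hom C (vert (src t) i j) (vert (tgt t) i j)"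
    "\<not> (i \<le> j \<and> j \<le> n) \<Longrightarrow> component t i j = undefined"
    using *[of i j] by (simp_all split: if_splits)
  show "i \<le> j \<Longrightarrow> j < n \<Longrightarrow>
      component t i (Suc j) \<cdot>\<^bsub>C\<^esub> hor (src t) i j = hor (tgt t) i j \<cdot>\<^bsub>C\<^esub> component t i j"
    "i < j \<Longrightarrow> j \<le> n \<Longrightarrow>
      component t (Suc i) j \<cdot>\<^bsub>C\<^esub> ver (src t) i j = ver (tgt t) i j \<cdot>\<^bsub>C\<^esub> component t i j"
    using assms unfolding is_transf_def by simp_all
qed

lemma flag_cat_simps [simp]:
  "D \<in> Ob (flag_cat C z n) \<longleftrightarrow> is_flag C z n D"
  "Dom (flag_cat C z n) = src" "Cod (flag_cat C z n) = tgt"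
  "i \<le> j \<Longrightarrow> j \<le> n \<Longrightarrow> component (Idt (flag_cat C z n) D) i j = Idt C (vert D i j)"
  "i \<le> j \<Longrightarrow> j \<le> n \<Longrightarrow> component (t \<cdot>\<^bsub>flag_cat C z n\<^esub> s) i j = component t i j \<cdot>\<^bsub>C\<^esub> component s i j"
  "src (Idt (flag_cat C z n) D) = D" "tgt (Idt (flag_cat C z n) D) = D"
  "src (t \<cdot>\<^bsub>flag_cat C z n\<^esub> s) = src s" "tgt (t \<cdot>\<^bsub>flag_cat C z n\<^esub> s) = tgt t"
  by (simp_all add: flag_cat_def)

lemma flag_hom_iff:
  "t \<in> hom (flag_cat C z n) D D' \<longleftrightarrow>
    is_flag C z n D \<and> is_flag C z n D' \<and> src t = D \<and> tgt t = D' \<and> is_transf C n t"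
  by (auto simp: flag_cat_def hom_def)

lemma flag_homD:
  assumes "t \<in> hom (flag_cat C z n) D D'"
  shows "is_flag C z n D" "is_flag C z n D'" "is_transf C n t" "src t = D" "tgt t = D'"
    and flag_hom_component: "i \<le> j \<Longrightarrow> j \<le> n \<Longrightarrow> component t i j \<in> hom C (vert D i j) (vert D' i j)"
    and flag_hom_hor: "i \<le> j \<Longrightarrow> j < n \<Longrightarrow>
      component t i (Suc j) \<cdot>\<^bsub>C\<^esub> hor D i j = hor D' i j \<cdot>\<^bsub>C\<^esub> component t i j"
    and flag_hom_ver: "i < j \<Longrightarrow> j \<le> n \<Longrightarrow>
      component t (Suc i) j \<cdot>\<^bsub>C\<^esub> ver D i j = ver D' i j \<cdot>\<^bsub>C\<^esub> component t i j"
  using assms transfD[of C n t] by (auto simp: flag_hom_iff)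

lemma transf_eqI:
  assumes "is_transf C n t" "is_transf C n t'" "src t = src t'" "tgt t = tgt t'"
    and "\<And>i j. i \<le> j \<Longrightarrow> j \<le> n \<Longrightarrow> component t i j = component t' i j"
  shows "t = t'"
proof (rule transf.equality)
  show "component t = component t'"
  proof (intro ext)
    show "component t i j = component t' i j" for i j
      using assms(5) transf_undefined[OF assms(1)] transf_undefined[OF assms(2)]
      by (cases "i \<le> j \<and> j \<le> n") auto
  qed
qed (use assms in simp_all)

locale flags = proto_abelian C for C :: "('o, 'a) cat" (structure) +
  fixes z :: 'o
  assumes zero: "zero_object C z"
begin

lemma zero_Ob: "z \<in> Ob C"
  using zero by (simp add: zero_object_def)

lemma from_zero: "f \<in> hom C z a \<Longrightarrow> g \<in> hom C z a \<Longrightarrow> f = g"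
  and to_zero: "f \<in> hom C a z \<Longrightarrow> g \<in> hom C a z \<Longrightarrow> f = g"
  using zero_unique[OF zero] by blast+

definition zero_in :: "'o \<Rightarrow> 'a" where "zero_in a = (THE f. f \<in> hom C z a)"
definition zero_out :: "'o \<Rightarrow> 'a" where "zero_out a = (THE f. f \<in> hom C a z)"

lemma zero_in:
  assumes "a \<in> Ob C" shows "zero_in a \<in> hom C z a" "monic C (zero_in a)"
proof -
  have "\<exists>!f. f \<in> hom C z a" using zero assms by (simp add: zero_object_def)
  then show *: "zero_in a \<in> hom C z a" unfolding zero_in_def by (rule theI')
  show "monic C (zero_in a)" by (rule monicI[OF *]) (rule to_zero)
qed

lemma zero_out:
  assumes "a \<in> Ob C" shows "zero_out a \<in> hom C a z" "epic C (zero_out a)"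
proof -
  have "\<exists>!f. f \<in> hom C a z" using zero assms by (simp add: zero_object_def)
  then show *: "zero_out a \<in> hom C a z" unfolding zero_out_def by (rule theI')
  show "epic C (zero_out a)" by (rule epicI[OF *]) (rule from_zero)
qed

section \<open>The category of flags and its isomorphisms\<close>

lemma flag_comp_hom:
  assumes s: "s \<in> hom (flag_cat C z n) D E" and t: "t \<in> hom (flag_cat C z n) E F"
  shows "t \<cdot>\<^bsub>flag_cat C z n\<^esub> s \<in> hom (flag_cat C z n) D F"
proof -
  note S = flag_homD[OF s] and T = flag_homD[OF t]
  have "is_transf C n (t \<cdot>\<^bsub>flag_cat C z n\<^esub> s)"
    unfolding is_transf_def
  proof (intro conjI allI impI)
    fix i j
    show "if i \<le> j \<and> j \<le> n then component (t \<cdot>\<^bsub>flag_cat C z n\<^esub> s) i j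
          \<in> hom C (vert (src (t \<cdot>\<^bsub>flag_cat C z n\<^esub> s)) i j) (vert (tgt (t \<cdot>\<^bsub>flag_cat C z n\<^esub> s)) i j)
        else component (t \<cdot>\<^bsub>flag_cat C z n\<^esub> s) i j = undefined"
      using comp_hom[OF S(6) T(6)] S(4,5) T(4,5) by (auto simp: flag_cat_def)
    show "component (t \<cdot>\<^bsub>flag_cat C z n\<^esub> s) i (j + 1) \<cdot> hor (src (t \<cdot>\<^bsub>flag_cat C z n\<^esub> s)) i j =
        hor (tgt (t \<cdot>\<^bsub>flag_cat C z n\<^esub> s)) i j \<cdot> component (t \<cdot>\<^bsub>flag_cat C z n\<^esub> s) i j" if "i \<le> j \<and> j < n"
      using square_paste[OF S(6) S(6) T(6) T(6) flag_hor[OF S(1)] flag_hor[OF S(2)] flag_hor[OF T(2)]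
          S(7) T(7), of i j] that S(4,5) T(4,5) by simp
    show "component (t \<cdot>\<^bsub>flag_cat C z n\<^esub> s) (i + 1) j \<cdot> ver (src (t \<cdot>\<^bsub>flag_cat C z n\<^esub> s)) i j =
        ver (tgt (t \<cdot>\<^bsub>flag_cat C z n\<^esub> s)) i j \<cdot> component (t \<cdot>\<^bsub>flag_cat C z n\<^esub> s) i j" if "i < j \<and> j \<le> n"
      using square_paste[OF S(6) S(6) T(6) T(6) flag_ver[OF S(1)] flag_ver[OF S(2)] flag_ver[OF T(2)]
          S(8) T(8), of i j] that S(4,5) T(4,5) by simp
  qed
  then show ?thesis using S(1,4,5) T(2,4,5) by (simp add: flag_hom_iff)
qed

lemma flag_id_hom:
  assumes "is_flag C z n D"
  shows "Idt (flag_cat C z n) D \<in> hom (flag_cat C z n) D D"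
proof -
  have "is_transf C n (Idt (flag_cat C z n) D)"
    unfolding is_transf_def
    using flag_vert[OF assms] comp_id[OF flag_hor[OF assms]] comp_id[OF flag_ver[OF assms]]
      id_comp[OF flag_hor[OF assms]] id_comp[OF flag_ver[OF assms]]
    by (auto simp: flag_cat_def id_hom)
  then show ?thesis using assms by (simp add: flag_hom_iff)
qed

lemma category_flag_cat: "category (flag_cat C z n)"
proof
  let ?F = "flag_cat C z n"
  show "Dom ?F f \<in> Ob ?F" "Cod ?F f \<in> Ob ?F" if "f \<in> Ar ?F" for f
    using that by (auto simp: flag_cat_def)
  show "Idt ?F a \<in> hom ?F a a" if "a \<in> Ob ?F" for a
    using that by (simp add: flag_id_hom)
  fix a b c d f g h assume f: "f \<in> hom ?F a b"
  note ia = flag_homD[OF flag_id_hom[OF flag_homD(1)[OF f]]]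
    and ib = flag_homD[OF flag_id_hom[OF flag_homD(2)[OF f]]]
  note F = flag_homD[OF f]
  note fi = flag_homD[OF flag_comp_hom[OF flag_id_hom[OF F(1)] f]]
    and bf = flag_homD[OF flag_comp_hom[OF f flag_id_hom[OF F(2)]]]
  show "f \<cdot>\<^bsub>?F\<^esub> Idt ?F a = f"
    by (rule transf_eqI[OF fi(3) F(3)]) (simp_all add: F(4) comp_id[OF F(6)])
  show "Idt ?F b \<cdot>\<^bsub>?F\<^esub> f = f"
    by (rule transf_eqI[OF bf(3) F(3)]) (simp_all add: F(5) id_comp[OF F(6)])
  assume g: "g \<in> hom ?F b c"
  show gf: "g \<cdot>\<^bsub>?F\<^esub> f \<in> hom ?F a c" by (rule flag_comp_hom[OF f g])
  assume h: "h \<in> hom ?F c d"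
  note G = flag_homD[OF g] and H = flag_homD[OF h]
  note l = flag_homD[OF flag_comp_hom[OF gf h]] and r = flag_homD[OF flag_comp_hom[OF f flag_comp_hom[OF g h]]]
  show "h \<cdot>\<^bsub>?F\<^esub> g \<cdot>\<^bsub>?F\<^esub> f = (h \<cdot>\<^bsub>?F\<^esub> g) \<cdot>\<^bsub>?F\<^esub> f"
    by (rule transf_eqI[OF l(3) r(3)]) (simp_all add: comp_assoc[OF F(6) G(6) H(6)])
qed

lemma groupoid_flag_grpd: "groupoid (flag_grpd C z n)"
  unfolding flag_grpd_def by (rule groupoid_core[OF category_flag_cat])

lemma flag_iso_component:
  assumes "t \<in> hom (flag_cat C z n) D D'" "is_iso (flag_cat C z n) t" "i \<le> j" "j \<le> n"
  shows "is_iso C (component t i j)"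
proof -
  note i = category.inv_arr[OF category_flag_cat assms(2,1)]
  note T = flag_homD[OF assms(1)] and I = flag_homD[OF i(1)]
  show ?thesis
  proof (rule is_isoI[OF T(6) I(6)])
    show "component (inv_arr (flag_cat C z n) t) i j \<cdot> component t i j = Idt C (vert D i j)"
      using arg_cong[OF i(2), of "\<lambda>t. component t i j"] assms(3,4) by simp
    show "component t i j \<cdot> component (inv_arr (flag_cat C z n) t) i j = Idt C (vert D' i j)"
      using arg_cong[OF i(3), of "\<lambda>t. component t i j"] assms(3,4) by simp
  qed (fact assms)+
qed

text \<open>Componentwise inverses commute with the arrows of the flags by
  \<open>inv_natural\<close>, so invertibility can be tested entry by entry.\<close>

lemma flag_isoI:
  assumes t: "t \<in> hom (flag_cat C z n) D D'"
    and iso: "\<And>i j. i \<le> j \<Longrightarrow> j \<le> n \<Longrightarrow> is_iso C (component t i j)"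
  shows "is_iso (flag_cat C z n) t"
proof -
  note T = flag_homD[OF t]
  define s where "s = \<lparr>src = D', tgt = D,
    component = (\<lambda>i j. if i \<le> j \<and> j \<le> n then inv_arr C (component t i j) else undefined)\<rparr>"
  note i = inv_arr[OF iso T(6)]
  have "is_transf C n s"
    unfolding is_transf_def
  proof (intro conjI allI impI)
    fix i j
    show "if i \<le> j \<and> j \<le> n then component s i j \<in> hom C (vert (src s) i j) (vert (tgt s) i j)
        else component s i j = undefined"
      using i(1) by (simp add: s_def)
    show "component s i (j + 1) \<cdot> hor (src s) i j = hor (tgt s) i j \<cdot> component s i j" if "i \<le> j \<and> j < n"
      using inv_natural[OF iso T(6) iso T(6) flag_hor[OF T(1)] flag_hor[OF T(2)] T(7), of i j] that
      by (simp add: s_def)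
    show "component s (i + 1) j \<cdot> ver (src s) i j = ver (tgt s) i j \<cdot> component s i j" if "i < j \<and> j \<le> n"
      using inv_natural[OF iso T(6) iso T(6) flag_ver[OF T(1)] flag_ver[OF T(2)] T(8), of i j] that
      by (simp add: s_def)
  qed
  then have s: "s \<in> hom (flag_cat C z n) D' D" using T by (simp add: flag_hom_iff s_def)
  show ?thesis
  proof (rule category.is_isoI[OF category_flag_cat t s])
    show "s \<cdot>\<^bsub>flag_cat C z n\<^esub> t = Idt (flag_cat C z n) D"
      by (rule transf_eqI[OF flag_homD(3)[OF flag_comp_hom[OF t s]] flag_homD(3)[OF flag_id_hom[OF T(1)]]])
        (use T i in \<open>auto simp: s_def\<close>)
    show "t \<cdot>\<^bsub>flag_cat C z n\<^esub> s = Idt (flag_cat C z n) D'"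
      by (rule transf_eqI[OF flag_homD(3)[OF flag_comp_hom[OF s t]] flag_homD(3)[OF flag_id_hom[OF T(2)]]])
        (use T i in \<open>auto simp: s_def\<close>)
  qed
qed

lemma flag_grpd_Ob [simp]: "D \<in> Ob (flag_grpd C z n) \<longleftrightarrow> is_flag C z n D"
  by (simp add: flag_grpd_def)

lemma flag_grpd_hom_iff:
  "t \<in> hom (flag_grpd C z n) D D' \<longleftrightarrow> t \<in> hom (flag_cat C z n) D D' \<and>
    (\<forall>i j. i \<le> j \<longrightarrow> j \<le> n \<longrightarrow> is_iso C (component t i j))"
  unfolding flag_grpd_def using flag_isoI flag_iso_component by auto

lemma flag_grpd_simps [simp]:
  "Idt (flag_grpd C z n) = Idt (flag_cat C z n)"
  "g \<cdot>\<^bsub>flag_grpd C z n\<^esub> f = g \<cdot>\<^bsub>flag_cat C z n\<^esub> f"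
  by (simp_all add: flag_grpd_def)

text \<open>The diagonal entries \<open>z\<close> carry no information, so flags and their morphisms are determined by,
  and constructed from, the data off the diagonal.\<close>

lemma flag_eqI:
  assumes D: "is_flag C z n D" and D': "is_flag C z n D'"
    and v: "\<And>i j. i < j \<Longrightarrow> j \<le> n \<Longrightarrow> vert D i j = vert D' i j"
    and h: "\<And>i j. i < j \<Longrightarrow> j < n \<Longrightarrow> hor D i j = hor D' i j"
    and w: "\<And>i j. Suc i < j \<Longrightarrow> j \<le> n \<Longrightarrow> ver D i j = ver D' i j"
  shows "D = D'"
proof (rule diagram.equality)
  have v': "vert D i j = vert D' i j" if "i \<le> j" "j \<le> n" for i j
    using v[of i j] flag_diag[OF D, of i] flag_diag[OF D', of i] that by (cases "i = j") auto
  show "vert D = vert D'"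
    using v' flag_vert_undefined[OF D] flag_vert_undefined[OF D'] by (intro ext) metis
  have h': "hor D i j = hor D' i j" if "i \<le> j" "j < n" for i j
  proof (cases "i = j")
    case True
    then show ?thesis
      using flag_hor[OF D that] flag_hor[OF D' that] flag_diag[OF D, of i] flag_diag[OF D', of i]
        v'[of i "Suc j"] that from_zero by auto
  qed (use h that in auto)
  show "hor D = hor D'"
    using h' flag_hor_undefined[OF D] flag_hor_undefined[OF D'] by (intro ext) metis
  have w': "ver D i j = ver D' i j" if "i < j" "j \<le> n" for i j
  proof (cases "j = Suc i")
    case True
    then show ?thesis
      using flag_ver[OF D that] flag_ver[OF D' that] flag_diag[OF D, of j] flag_diag[OF D', of j]
        v'[of i j] that to_zero by auto
  qed (use w that in auto)
  show "ver D = ver D'"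
    using w' flag_ver_undefined[OF D] flag_ver_undefined[OF D'] by (intro ext) metis
qed simp

lemma flag_hom_eqI:
  assumes t: "t \<in> hom (flag_cat C z n) D D'" and t': "t' \<in> hom (flag_cat C z n) D D'"
    and eq: "\<And>i j. i < j \<Longrightarrow> j \<le> n \<Longrightarrow> component t i j = component t' i j"
  shows "t = t'"
proof (rule transf_eqI)
  note T = flag_homD[OF t] and T' = flag_homD[OF t']
  show "is_transf C n t" "is_transf C n t'" "src t = src t'" "tgt t = tgt t'"
    using T T' by auto
  show "component t i j = component t' i j" if "i \<le> j" "j \<le> n" for i j
  proof (cases "i = j")
    case True
    then show ?thesis
      using T(6)[OF that] T'(6)[OF that] flag_diag[OF T(1), of i] flag_diag[OF T(2), of i] that from_zero by auto
  qed (use eq that in auto)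
qed

lemma flag_hom_exists:
  assumes D: "is_flag C z n D" and D': "is_flag C z n D'"
    and c: "\<And>i j. i < j \<Longrightarrow> j \<le> n \<Longrightarrow> c i j \<in> hom C (vert D i j) (vert D' i j)"
      "\<And>i j. i < j \<Longrightarrow> j \<le> n \<Longrightarrow> is_iso C (c i j)"
    and h: "\<And>i j. i < j \<Longrightarrow> j < n \<Longrightarrow> c i (Suc j) \<cdot> hor D i j = hor D' i j \<cdot> c i j"
    and w: "\<And>i j. Suc i < j \<Longrightarrow> j \<le> n \<Longrightarrow> c (Suc i) j \<cdot> ver D i j = ver D' i j \<cdot> c i j"
  obtains t where "t \<in> hom (flag_grpd C z n) D D'" "\<And>i j. i < j \<Longrightarrow> j \<le> n \<Longrightarrow> component t i j = c i j"
proof -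
  define t where "t = \<lparr>src = D, tgt = D', component = (\<lambda>i j. if i \<le> j \<and> j \<le> n
    then (if i = j then Idt C z else c i j) else undefined)\<rparr>"
  note d = flag_diag[OF D] and d' = flag_diag[OF D']
  have co: "component t i j \<in> hom C (vert D i j) (vert D' i j)" "is_iso C (component t i j)"
    if "i \<le> j" "j \<le> n" for i j
    using that c d d' id_hom[OF zero_Ob] is_iso_Idt[OF zero_Ob] by (auto simp: t_def)
  have "is_transf C n t"
    unfolding is_transf_def
  proof (intro conjI allI impI)
    fix i j
    show "if i \<le> j \<and> j \<le> n then component t i j \<in> hom C (vert (src t) i j) (vert (tgt t) i j)
        else component t i j = undefined"
      using co by (simp add: t_def)
    show "component t i (j + 1) \<cdot> hor (src t) i j = hor (tgt t) i j \<cdot> component t i j" if ij: "i \<le> j \<and> j < n"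
    \<comment> \<open>On the diagonal both composites start at \<open>z\<close>, so they agree.
      Dually, for the vertical arrows next to the diagonal both composites end at
      \<open>z\<close>.\<close>
    proof (cases "i = j")
      case True
      have "component t i (Suc j) \<cdot> hor D i j \<in> hom C (vert D i j) (vert D' i (Suc j))"
        "hor D' i j \<cdot> component t i j \<in> hom C (vert D i j) (vert D' i (Suc j))"
        using ij by (auto intro!: comp_hom[OF flag_hor[OF D] co(1)] comp_hom[OF co(1) flag_hor[OF D']])
      then show ?thesis using True ij d[of i] from_zero by (simp add: t_def)
    qed (use h ij in \<open>auto simp: t_def\<close>)
    show "component t (i + 1) j \<cdot> ver (src t) i j = ver (tgt t) i j \<cdot> component t i j" if ij: "i < j \<and> j \<le> n"
    proof (cases "j = Suc i")
      case True
      have "component t (Suc i) j \<cdot> ver D i j \<in> hom C (vert D i j) (vert D' (Suc i) j)"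
        "ver D' i j \<cdot> component t i j \<in> hom C (vert D i j) (vert D' (Suc i) j)"
        using ij by (auto intro!: comp_hom[OF flag_ver[OF D] co(1)] comp_hom[OF co(1) flag_ver[OF D']])
      then show ?thesis using True ij d'[of j] to_zero by (simp add: t_def)
    qed (use w ij in \<open>auto simp: t_def\<close>)
  qed
  then have "t \<in> hom (flag_grpd C z n) D D'"
    using D D' co(2) by (simp add: flag_grpd_hom_iff flag_hom_iff t_def)
  moreover have "component t i j = c i j" if "i < j" "j \<le> n" for i j
    using that by (simp add: t_def)
  ultimately show thesis using that by blast
qed

text \<open>The squares with a corner on the diagonal form a separate hypothesis, because
  \<open>V\<close>, \<open>H\<close> and \<open>W\<close> hold no data there: the two arrows at that
  corner are the unique arrows to and from \<open>z\<close>.\<close>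

lemma flag_exists:
  assumes V: "\<And>i j. i < j \<Longrightarrow> j \<le> n \<Longrightarrow> V i j \<in> Ob C"
    and H: "\<And>i j. i < j \<Longrightarrow> j < n \<Longrightarrow> H i j \<in> hom C (V i j) (V i (Suc j))"
      "\<And>i j. i < j \<Longrightarrow> j < n \<Longrightarrow> monic C (H i j)"
    and W: "\<And>i j. Suc i < j \<Longrightarrow> j \<le> n \<Longrightarrow> W i j \<in> hom C (V i j) (V (Suc i) j)"
      "\<And>i j. Suc i < j \<Longrightarrow> j \<le> n \<Longrightarrow> epic C (W i j)"
    and sq: "\<And>i j. Suc i < j \<Longrightarrow> j < n \<Longrightarrow> bicartesian C (H i j) (W i j) (W i (Suc j)) (H (Suc i) j)"
      "\<And>i. Suc i < n \<Longrightarrow> bicartesian C (H i (Suc i)) (zero_out (V i (Suc i))) (W i (Suc (Suc i)))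
        (zero_in (V (Suc i) (Suc (Suc i))))"
  obtains D where "is_flag C z n D" "\<And>i j. i < j \<Longrightarrow> j \<le> n \<Longrightarrow> vert D i j = V i j"
    "\<And>i j. i < j \<Longrightarrow> j < n \<Longrightarrow> hor D i j = H i j" "\<And>i j. Suc i < j \<Longrightarrow> j \<le> n \<Longrightarrow> ver D i j = W i j"
proof -
  define D where "D = \<lparr>vert = (\<lambda>i j. if i \<le> j \<and> j \<le> n then (if i = j then z else V i j) else undefined),
    hor = (\<lambda>i j. if i \<le> j \<and> j < n then (if i = j then zero_in (V i (Suc j)) else H i j) else undefined),
    ver = (\<lambda>i j. if i < j \<and> j \<le> n then (if j = Suc i then zero_out (V i j) else W i j) else undefined)\<rparr>"
  have "is_flag C z n D"
    unfolding is_flag_def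
  proof (intro conjI allI impI)
    fix i j
    show "if i \<le> j \<and> j \<le> n then vert D i j \<in> Ob C else vert D i j = undefined"
      by (simp add: D_def zero_Ob V)
    show "i \<le> n \<Longrightarrow> vert D i i = z" by (simp add: D_def)
    show "if i \<le> j \<and> j < n
       then hor D i j \<in> hom C (vert D i j) (vert D i (j + 1)) \<and> monic C (hor D i j)
       else hor D i j = undefined"
      by (simp add: D_def H zero_in V)
    show "if i < j \<and> j \<le> n
       then ver D i j \<in> hom C (vert D i j) (vert D (i + 1) j) \<and> epic C (ver D i j)
       else ver D i j = undefined"
      by (auto simp: D_def W zero_out V)
    show "bicartesian C (hor D i j) (ver D i j) (ver D i (j + 1)) (hor D (i + 1) j)" if "i < j \<and> j < n"
      using sq(1)[of i j] sq(2)[of i] that by (cases "j = Suc i") (auto simp: D_def)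
  qed
  moreover have "\<And>i j. i < j \<Longrightarrow> j \<le> n \<Longrightarrow> vert D i j = V i j"
    "\<And>i j. i < j \<Longrightarrow> j < n \<Longrightarrow> hor D i j = H i j" "\<And>i j. Suc i < j \<Longrightarrow> j \<le> n \<Longrightarrow> ver D i j = W i j"
    by (auto simp: D_def)
  ultimately show thesis using that by blast
qed

section \<open>The simplicial structure\<close>

lemma hor_path:
  assumes "is_flag C z n D" "i \<le> j" "j + k \<le> n"
  shows "hor_path C D i j k \<in> hom C (vert D i j) (vert D i (j + k))" "monic C (hor_path C D i j k)"
  using assms(3)
proof (induction k)
  case 0
  { case 1 show ?case using flag_vert[OF assms(1,2)] 1 by (simp add: id_hom) }
  { case 2 show ?case
      using flag_vert[OF assms(1,2)] 2 iso_monic[OF is_iso_Idt id_hom] by simp }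
next
  case (Suc k)
  { case 1 show ?case
      using comp_hom[OF Suc.IH(1) flag_hor[OF assms(1)]] assms(2) 1 by simp }
  { case 2 show ?case
      using monic_comp[OF Suc.IH(2) Suc.IH(1) flag_monic[OF assms(1)] flag_hor[OF assms(1)]] assms(2) 2 by simp }
qed

lemma ver_path:
  assumes "is_flag C z n D" "i + k \<le> j" "j \<le> n"
  shows "ver_path C D i j k \<in> hom C (vert D i j) (vert D (i + k) j)" "epic C (ver_path C D i j k)"
  using assms(2)
proof (induction k)
  case 0
  { case 1 show ?case using flag_vert[OF assms(1) _ assms(3)] 1 by (simp add: id_hom) }
  { case 2 show ?case
      using flag_vert[OF assms(1) _ assms(3)] 2 iso_epic[OF is_iso_Idt id_hom] by simp }
next
  case (Suc k)
  { case 1 show ?case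
      using comp_hom[OF Suc.IH(1) flag_ver[OF assms(1)]] assms(3) 1 by simp }
  { case 2 show ?case
      using epic_comp[OF Suc.IH(2) Suc.IH(1) flag_epic[OF assms(1)] flag_ver[OF assms(1)]] assms(3) 2 by simp }
qed

text \<open>A strip of height one, obtained by pasting unit squares horizontally. Stacking such
  strips gives the rectangles of \<open>bicartesian_path\<close>.\<close>

lemma bicartesian_strip:
  assumes "is_flag C z n D" "i < j" "j + k \<le> n"
  shows "bicartesian C (hor_path C D i j k) (ver D i j) (ver D i (j + k)) (hor_path C D (Suc i) j k)"
  using assms(3)
proof (induction k)
  case 0
  then show ?case
    using bicartesian_id_hor[OF flag_epic[OF assms(1,2)] flag_ver[OF assms(1,2)]] by simp
next
  case (Suc k)
  then show ?case
    using bicartesian_comp_hor[OF Suc.IH flag_bicartesian[OF assms(1), of i "j + k"]] assms(2) by simp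
qed

lemma bicartesian_path:
  assumes "is_flag C z n D" "i + l \<le> j" "j + k \<le> n"
  shows "bicartesian C (hor_path C D i j k) (ver_path C D i j l) (ver_path C D i (j + k) l)
    (hor_path C D (i + l) j k)"
  using assms(2)
proof (induction l)
  case 0
  then show ?case
    using bicartesian_id_ver[OF hor_path(2,1)[OF assms(1) _ assms(3)]] by simp
next
  case (Suc l)
  then show ?case
    using bicartesian_comp_ver[OF Suc.IH bicartesian_strip[OF assms(1) _ assms(3), of "i + l"]] by simp
qed

lemma flag_hom_hor_path:
  assumes "t \<in> hom (flag_cat C z n) D D'" "i \<le> j" "j + k \<le> n"
  shows "component t i (j + k) \<cdot> hor_path C D i j k = hor_path C D' i j k \<cdot> component t i j"
  using assms(3)
proof (induction k)
  case 0
  then show ?case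
    using comp_id[OF flag_hom_component[OF assms(1,2)]] id_comp[OF flag_hom_component[OF assms(1,2)]] by simp
next
  case (Suc k)
  note T = flag_homD[OF assms(1)]
  have 1: "hor_path C D i j k \<in> hom C (vert D i j) (vert D i (j + k))"
    "hor_path C D' i j k \<in> hom C (vert D' i j) (vert D' i (j + k))"
    using hor_path[OF T(1) assms(2)] hor_path[OF T(2) assms(2)] Suc.prems by auto
  have 2: "hor D i (j + k) \<in> hom C (vert D i (j + k)) (vert D i (Suc (j + k)))"
    "hor D' i (j + k) \<in> hom C (vert D' i (j + k)) (vert D' i (Suc (j + k)))"
    using flag_hor[OF T(1)] flag_hor[OF T(2)] Suc.prems assms(2) by auto
  have c: "component t i j \<in> hom C (vert D i j) (vert D' i j)"
    "component t i (j + k) \<in> hom C (vert D i (j + k)) (vert D' i (j + k))"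
    "component t i (Suc (j + k)) \<in> hom C (vert D i (Suc (j + k))) (vert D' i (Suc (j + k)))"
    using T(6) Suc.prems assms(2) by auto
  have e: "component t i (j + k) \<cdot> hor_path C D i j k = hor_path C D' i j k \<cdot> component t i j"
    "component t i (Suc (j + k)) \<cdot> hor D i (j + k) = hor D' i (j + k) \<cdot> component t i (j + k)"
    using Suc T(7)[of i "j + k"] assms(2) by auto
  show ?case
    using square_paste[OF 1(1) 1(2) 2(1) 2(2) c, OF e(1)[symmetric] e(2)[symmetric]] by simp
qed

lemma flag_hom_ver_path:
  assumes "t \<in> hom (flag_cat C z n) D D'" "i + k \<le> j" "j \<le> n"
  shows "component t (i + k) j \<cdot> ver_path C D i j k = ver_path C D' i j k \<cdot> component t i j"
  using assms(2)
proof (induction k)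
  case 0
  then show ?case
    using comp_id[OF flag_hom_component[OF assms(1) _ assms(3)]]
      id_comp[OF flag_hom_component[OF assms(1) _ assms(3)]] by simp
next
  case (Suc k)
  note T = flag_homD[OF assms(1)]
  have 1: "ver_path C D i j k \<in> hom C (vert D i j) (vert D (i + k) j)"
    "ver_path C D' i j k \<in> hom C (vert D' i j) (vert D' (i + k) j)"
    using ver_path[OF T(1) _ assms(3)] ver_path[OF T(2) _ assms(3)] Suc.prems by auto
  have 2: "ver D (i + k) j \<in> hom C (vert D (i + k) j) (vert D (Suc (i + k)) j)"
    "ver D' (i + k) j \<in> hom C (vert D' (i + k) j) (vert D' (Suc (i + k)) j)"
    using flag_ver[OF T(1)] flag_ver[OF T(2)] Suc.prems assms(3) by auto
  have c: "component t i j \<in> hom C (vert D i j) (vert D' i j)"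
    "component t (i + k) j \<in> hom C (vert D (i + k) j) (vert D' (i + k) j)"
    "component t (Suc (i + k)) j \<in> hom C (vert D (Suc (i + k)) j) (vert D' (Suc (i + k)) j)"
    using T(6) Suc.prems assms(3) by auto
  have e: "component t (i + k) j \<cdot> ver_path C D i j k = ver_path C D' i j k \<cdot> component t i j"
    "component t (Suc (i + k)) j \<cdot> ver D (i + k) j = ver D' (i + k) j \<cdot> component t (i + k) j"
    using Suc T(8)[of "i + k" j] assms(3) by auto
  show ?case
    using square_paste[OF 1(1) 1(2) 2(1) 2(2) c, OF e(1)[symmetric] e(2)[symmetric]] by simp
qed

definition monotone_map :: "nat \<Rightarrow> nat \<Rightarrow> (nat \<Rightarrow> nat) \<Rightarrow> bool" where
  "monotone_map m n \<theta> \<longleftrightarrow> (\<forall>i j. i \<le> j \<longrightarrow> j \<le> m \<longrightarrow> \<theta> i \<le> \<theta> j \<and> \<theta> j \<le> n)"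

text \<open>Each square of the new diagram is a rectangle of \<open>D\<close>, possibly of width or
  height zero, and all of these are bicartesian by \<open>bicartesian_path\<close>.\<close>

lemma is_flag_pull:
  assumes D: "is_flag C z n D" and \<theta>: "monotone_map m n \<theta>"
  shows "is_flag C z m (diagram_pull C m \<theta> D)"
proof -
  have m: "\<theta> i \<le> \<theta> j" "\<theta> j \<le> n" if "i \<le> j" "j \<le> m" for i j
    using \<theta> that by (auto simp: monotone_map_def)
  let ?P = "diagram_pull C m \<theta> D"
  have hp: "hor_path C D (\<theta> i) (\<theta> j) (\<theta> (Suc j) - \<theta> j) \<in> hom C (vert D (\<theta> i) (\<theta> j)) (vert D (\<theta> i) (\<theta> (Suc j)))"
    "monic C (hor_path C D (\<theta> i) (\<theta> j) (\<theta> (Suc j) - \<theta> j))" if "i \<le> j" "j < m" for i j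
    using hor_path[OF D, of "\<theta> i" "\<theta> j" "\<theta> (Suc j) - \<theta> j"] m[of i j] m[of j "Suc j"] that by simp_all
  have vp: "ver_path C D (\<theta> i) (\<theta> j) (\<theta> (Suc i) - \<theta> i) \<in> hom C (vert D (\<theta> i) (\<theta> j)) (vert D (\<theta> (Suc i)) (\<theta> j))"
    "epic C (ver_path C D (\<theta> i) (\<theta> j) (\<theta> (Suc i) - \<theta> i))" if "i < j" "j \<le> m" for i j
    using ver_path[OF D, of "\<theta> i" "\<theta> (Suc i) - \<theta> i" "\<theta> j"] m[of i "Suc i"] m[of "Suc i" j] that by simp_all
  show ?thesis
    unfolding is_flag_def
  proof (intro conjI allI impI)
    fix i j
    show "if i \<le> j \<and> j \<le> m then vert ?P i j \<in> Ob C else vert ?P i j = undefined"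
      using m flag_vert[OF D] by (auto simp: diagram_pull_def)
    show "i \<le> m \<Longrightarrow> vert ?P i i = z"
      using m(2)[of i i] flag_diag[OF D] by (simp add: diagram_pull_def)
    show "if i \<le> j \<and> j < m
       then hor ?P i j \<in> hom C (vert ?P i j) (vert ?P i (j + 1)) \<and> monic C (hor ?P i j)
       else hor ?P i j = undefined"
      using hp by (auto simp: diagram_pull_def)
    show "if i < j \<and> j \<le> m
       then ver ?P i j \<in> hom C (vert ?P i j) (vert ?P (i + 1) j) \<and> epic C (ver ?P i j)
       else ver ?P i j = undefined"
      using vp by (auto simp: diagram_pull_def)
    show "bicartesian C (hor ?P i j) (ver ?P i j) (ver ?P i (j + 1)) (hor ?P (i + 1) j)" if "i < j \<and> j < m"
      using bicartesian_path[OF D, of "\<theta> i" "\<theta> (Suc i) - \<theta> i" "\<theta> j" "\<theta> (Suc j) - \<theta> j"]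
        m[of i "Suc i"] m[of "Suc i" j] m[of j "Suc j"] that
      by (simp add: diagram_pull_def)
  qed
qed

lemma flag_pull_simps [simp]:
  "on_Ob (flag_pull C m \<theta>) D = diagram_pull C m \<theta> D"
  "i \<le> j \<Longrightarrow> j \<le> m \<Longrightarrow> component (on_Ar (flag_pull C m \<theta>) t) i j = component t (\<theta> i) (\<theta> j)"
  "src (on_Ar (flag_pull C m \<theta>) t) = diagram_pull C m \<theta> (src t)"
  "tgt (on_Ar (flag_pull C m \<theta>) t) = diagram_pull C m \<theta> (tgt t)"
  "i \<le> j \<Longrightarrow> j \<le> m \<Longrightarrow> vert (diagram_pull C m \<theta> D) i j = vert D (\<theta> i) (\<theta> j)"
  "i \<le> j \<Longrightarrow> j < m \<Longrightarrow> hor (diagram_pull C m \<theta> D) i j =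
    hor_path C D (\<theta> i) (\<theta> j) (\<theta> (Suc j) - \<theta> j)"
  "i < j \<Longrightarrow> j \<le> m \<Longrightarrow> ver (diagram_pull C m \<theta> D) i j =
    ver_path C D (\<theta> i) (\<theta> j) (\<theta> (Suc i) - \<theta> i)"
  by (simp_all add: flag_pull_def diagram_pull_def)

lemma flag_pull_hom:
  assumes t: "t \<in> hom (flag_cat C z n) D D'" and \<theta>: "monotone_map m n \<theta>"
  shows "on_Ar (flag_pull C m \<theta>) t \<in> hom (flag_cat C z m) (diagram_pull C m \<theta> D) (diagram_pull C m \<theta> D')"
proof -
  note T = flag_homD[OF t]
  have m: "\<theta> i \<le> \<theta> j" "\<theta> j \<le> n" if "i \<le> j" "j \<le> m" for i j
    using \<theta> that by (auto simp: monotone_map_def)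
  let ?t = "on_Ar (flag_pull C m \<theta>) t"
  have "is_transf C m ?t"
    unfolding is_transf_def
  proof (intro conjI allI impI)
    fix i j
    show "if i \<le> j \<and> j \<le> m then component ?t i j \<in> hom C (vert (src ?t) i j) (vert (tgt ?t) i j)
        else component ?t i j = undefined"
      using T(6) m T(4,5) by (auto simp: flag_pull_def diagram_pull_def)
    show "component ?t i (j + 1) \<cdot> hor (src ?t) i j = hor (tgt ?t) i j \<cdot> component ?t i j" if "i \<le> j \<and> j < m"
      using flag_hom_hor_path[OF t, of "\<theta> i" "\<theta> j" "\<theta> (Suc j) - \<theta> j"] m[of i j] m[of j "Suc j"] that T(4,5)
      by simp
    show "component ?t (i + 1) j \<cdot> ver (src ?t) i j = ver (tgt ?t) i j \<cdot> component ?t i j" if "i < j \<and> j \<le> m"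
      using flag_hom_ver_path[OF t, of "\<theta> i" "\<theta> (Suc i) - \<theta> i" "\<theta> j"] m[of i "Suc i"] m[of "Suc i" j] that T(4,5)
      by simp
  qed
  then show ?thesis
    using is_flag_pull[OF T(1) \<theta>] is_flag_pull[OF T(2) \<theta>] T(4,5) by (simp add: flag_hom_iff)
qed

lemma is_functor_flag_pull:
  assumes \<theta>: "monotone_map m n \<theta>"
  shows "is_functor (flag_grpd C z n) (flag_grpd C z m) (flag_pull C m \<theta>)"
  unfolding flag_grpd_def
proof (rule is_functor_core[OF category_flag_cat category_flag_cat is_functorI[OF category_flag_cat]])
  have m: "\<theta> i \<le> \<theta> j" "\<theta> j \<le> n" if "i \<le> j" "j \<le> m" for i j
    using \<theta> that by (auto simp: monotone_map_def)
  fix D E F s t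
  show "D \<in> Ob (flag_cat C z n) \<Longrightarrow> on_Ob (flag_pull C m \<theta>) D \<in> Ob (flag_cat C z m)"
    by (simp add: is_flag_pull[OF _ \<theta>])
  show "on_Ar (flag_pull C m \<theta>) (Idt (flag_cat C z n) D) = Idt (flag_cat C z m) (on_Ob (flag_pull C m \<theta>) D)"
    if "D \<in> Ob (flag_cat C z n)"
  proof -
    have D: "is_flag C z n D" using that by simp
    show ?thesis
      by (rule transf_eqI[OF flag_homD(3)[OF flag_pull_hom[OF flag_id_hom[OF D] \<theta>]]
            flag_homD(3)[OF flag_id_hom[OF is_flag_pull[OF D \<theta>, folded flag_pull_simps(1)]]]])
        (simp_all add: m)
  qed
  assume s: "s \<in> hom (flag_cat C z n) D E"
  show s': "on_Ar (flag_pull C m \<theta>) s \<in> hom (flag_cat C z m) (on_Ob (flag_pull C m \<theta>) D) (on_Ob (flag_pull C m \<theta>) E)"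
    using flag_pull_hom[OF s \<theta>] by simp
  assume t: "t \<in> hom (flag_cat C z n) E F"
  show "on_Ar (flag_pull C m \<theta>) (t \<cdot>\<^bsub>flag_cat C z n\<^esub> s) =
      on_Ar (flag_pull C m \<theta>) t \<cdot>\<^bsub>flag_cat C z m\<^esub> on_Ar (flag_pull C m \<theta>) s"
    by (rule transf_eqI[OF flag_homD(3)[OF flag_pull_hom[OF flag_comp_hom[OF s t] \<theta>]]
          flag_homD(3)[OF flag_comp_hom[OF flag_pull_hom[OF s \<theta>] flag_pull_hom[OF t \<theta>]]]])
      (simp_all add: m)
qed

end

text \<open>Enumerating the positions off the diagonal reduces statements about flags of length 2
  and 3 to finitely many entries.\<close>

lemma upper2: "i < j \<Longrightarrow> j \<le> (2::nat) \<Longrightarrow> i = 0 \<and> j = 1 \<or> i = 0 \<and> j = 2 \<or> i = 1 \<and> j = 2"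
  by arith

lemma upper2_lt: "i < j \<Longrightarrow> j < (2::nat) \<Longrightarrow> i = 0 \<and> j = 1"
  and upper2_Suc: "Suc i < j \<Longrightarrow> j \<le> (2::nat) \<Longrightarrow> i = 0 \<and> j = 2"
  by arith+

lemma upper3: "i < j \<Longrightarrow> j \<le> (3::nat) \<Longrightarrow> i = 0 \<and> j = 1 \<or> i = 0 \<and> j = 2 \<or> i = 0 \<and> j = 3 \<or>
    i = 1 \<and> j = 2 \<or> i = 1 \<and> j = 3 \<or> i = 2 \<and> j = 3"
  by arith

context flags
begin

section \<open>Edges and triangles of a flag\<close>

lemma monotone_nth2: "i \<le> j \<Longrightarrow> j \<le> n \<Longrightarrow> monotone_map 1 n ((!) [i, j])"
  by (auto simp: monotone_map_def nth_Cons' le_Suc_eq)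

lemma monotone_nth3: "i \<le> j \<Longrightarrow> j \<le> k \<Longrightarrow> k \<le> n \<Longrightarrow> monotone_map 2 n ((!) [i, j, k])"
  by (auto simp: monotone_map_def nth_Cons' le_Suc_eq numeral_2_eq_2)

lemma hor_path_1: "is_flag C z n D \<Longrightarrow> i \<le> j \<Longrightarrow> j < n \<Longrightarrow> hor_path C D i j (Suc 0) = hor D i j"
  using comp_id[OF flag_hor] by simp

lemma ver_path_1: "is_flag C z n D \<Longrightarrow> i < j \<Longrightarrow> j \<le> n \<Longrightarrow> ver_path C D i j (Suc 0) = ver D i j"
  using comp_id[OF flag_ver] by simp

lemma hor_path_2: "is_flag C z n D \<Longrightarrow> i \<le> j \<Longrightarrow> Suc j < n \<Longrightarrow>
    hor_path C D i j (Suc (Suc 0)) = hor D i (Suc j) \<cdot> hor D i j"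
  using comp_id[OF flag_hor] by simp

lemma ver_path_2: "is_flag C z n D \<Longrightarrow> Suc i < j \<Longrightarrow> j \<le> n \<Longrightarrow>
    ver_path C D i j (Suc (Suc 0)) = ver D (Suc i) j \<cdot> ver D i j"
  using comp_id[OF flag_ver] by simp

lemma flag_grpd_homD:
  assumes "t \<in> hom (flag_grpd C z n) D D'"
  shows "t \<in> hom (flag_cat C z n) D D'" "is_flag C z n D" "is_flag C z n D'"
    and flag_grpd_component: "i \<le> j \<Longrightarrow> j \<le> n \<Longrightarrow> component t i j \<in> hom C (vert D i j) (vert D' i j)"
    and flag_grpd_iso: "i \<le> j \<Longrightarrow> j \<le> n \<Longrightarrow> is_iso C (component t i j)"
  using assms by (auto simp: flag_grpd_hom_iff dest: flag_homD)

text \<open>The monotone map with values \<open>i\<close>, \<open>j\<close> is written as a list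
  lookup; only the indices 0 and 1 matter. Repeated vertices are allowed, so the triangles 001 and
  011 of an edge are its two degeneracies.\<close>

abbreviation edge :: "nat \<Rightarrow> nat \<Rightarrow> ('o, 'a) diagram \<Rightarrow> ('o, 'a) diagram" where
  "edge i j \<equiv> diagram_pull C 1 ((!) [i, j])"

abbreviation triangle :: "nat \<Rightarrow> nat \<Rightarrow> nat \<Rightarrow> ('o, 'a) diagram \<Rightarrow> ('o, 'a) diagram" where
  "triangle i j k \<equiv> diagram_pull C 2 ((!) [i, j, k])"

abbreviation triangle_Ar :: "nat \<Rightarrow> nat \<Rightarrow> nat \<Rightarrow> ('o, 'a) transf \<Rightarrow> ('o, 'a) transf" where
  "triangle_Ar i j k \<equiv> on_Ar (flag_pull C 2 ((!) [i, j, k]))"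

lemma triangle_hom:
  assumes D: "is_flag C z n D" "is_flag C z n D'" and le: "i \<le> j" "j \<le> k" "k \<le> n"
    and t: "t \<in> hom (flag_grpd C z 2) (triangle i j k D) (triangle i j k D')"
  shows "component t 0 1 \<in> hom C (vert D i j) (vert D' i j)" "is_iso C (component t 0 1)"
    "component t 0 2 \<in> hom C (vert D i k) (vert D' i k)" "is_iso C (component t 0 2)"
    "component t 1 2 \<in> hom C (vert D j k) (vert D' j k)" "is_iso C (component t 1 2)"
    "component t 0 2 \<cdot> hor_path C D i j (k - j) = hor_path C D' i j (k - j) \<cdot> component t 0 1"
    "component t 1 2 \<cdot> ver_path C D i k (j - i) = ver_path C D' i k (j - i) \<cdot> component t 0 2"
proof -
  note T = flag_grpd_homD[OF t]
  show "component t 0 1 \<in> hom C (vert D i j) (vert D' i j)" "is_iso C (component t 0 1)"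
    "component t 0 2 \<in> hom C (vert D i k) (vert D' i k)" "is_iso C (component t 0 2)"
    "component t 1 2 \<in> hom C (vert D j k) (vert D' j k)" "is_iso C (component t 1 2)"
    using T(4)[of 0 1] T(5)[of 0 1] T(4)[of 0 2] T(5)[of 0 2] T(4)[of 1 2] T(5)[of 1 2] by simp_all
  show "component t 0 2 \<cdot> hor_path C D i j (k - j) = hor_path C D' i j (k - j) \<cdot> component t 0 1"
    using flag_hom_hor[OF T(1), of 0 1] by (simp add: numeral_2_eq_2)
  show "component t 1 2 \<cdot> ver_path C D i k (j - i) = ver_path C D' i k (j - i) \<cdot> component t 0 2"
    using flag_hom_ver[OF T(1), of 0 2] by (simp add: numeral_2_eq_2)
qed

lemma triangle_eqI:
  assumes D: "is_flag C z n D" "is_flag C z 2 x" and le: "i \<le> j" "j \<le> k" "k \<le> n"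
    and "vert D i j = vert x 0 1" "vert D i k = vert x 0 2" "vert D j k = vert x 1 2"
    and "hor_path C D i j (k - j) = hor x 0 1" "ver_path C D i k (j - i) = ver x 0 2"
  shows "triangle i j k D = x"
proof (rule flag_eqI[OF is_flag_pull[OF D(1) monotone_nth3[OF le]] D(2)])
  fix a b :: nat
  show "vert (triangle i j k D) a b = vert x a b" if "a < b" "b \<le> 2"
    using upper2[OF that] assms by auto
  show "hor (triangle i j k D) a b = hor x a b" if "a < b" "b < 2"
    using upper2_lt[OF that] assms by auto
  show "ver (triangle i j k D) a b = ver x a b" if "Suc a < b" "b \<le> 2"
    using upper2_Suc[OF that] assms by auto
qed

lemma triangle_hom_exists:
  assumes D: "is_flag C z n D" "is_flag C z 2 x" and le: "i \<le> j" "j \<le> k" "k \<le> n"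
    and c1: "c1 \<in> hom C (vert D i j) (vert x 0 1)" "is_iso C c1"
    and c2: "c2 \<in> hom C (vert D i k) (vert x 0 2)" "is_iso C c2"
    and c3: "c3 \<in> hom C (vert D j k) (vert x 1 2)" "is_iso C c3"
    and eq: "c2 \<cdot> hor_path C D i j (k - j) = hor x 0 1 \<cdot> c1" "c3 \<cdot> ver_path C D i k (j - i) = ver x 0 2 \<cdot> c2"
  obtains t where "t \<in> hom (flag_grpd C z 2) (triangle i j k D) x"
    "component t 0 1 = c1" "component t 0 2 = c2" "component t 1 2 = c3"
proof -
  let ?c = "\<lambda>a b. if b = 1 then c1 else if a = 0 then c2 else c3"
  obtain t where t: "t \<in> hom (flag_grpd C z 2) (triangle i j k D) x"
    and c: "\<And>a b. a < b \<Longrightarrow> b \<le> 2 \<Longrightarrow> component t a b = ?c a b"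
  proof (rule flag_hom_exists[OF is_flag_pull[OF D(1) monotone_nth3[OF le]] D(2), where c = ?c])
    fix a b :: nat
    show "?c a b \<in> hom C (vert (triangle i j k D) a b) (vert x a b)" "is_iso C (?c a b)" if "a < b" "b \<le> 2"
      using upper2[OF that] c1 c2 c3 by auto
    show "?c a (Suc b) \<cdot> hor (triangle i j k D) a b = hor x a b \<cdot> ?c a b" if "a < b" "b < 2"
      using upper2_lt[OF that] eq by auto
    show "?c (Suc a) b \<cdot> ver (triangle i j k D) a b = ver x a b \<cdot> ?c a b" if "Suc a < b" "b \<le> 2"
      using upper2_Suc[OF that] eq by auto
  qed blast
  show thesis by (rule that[OF t]) (simp_all add: c)
qed

lemma triangle_Ar_eqI:
  assumes h: "h \<in> hom (flag_grpd C z n) D D'" and le: "i \<le> j" "j \<le> k" "k \<le> n"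
    and f: "f \<in> hom (flag_grpd C z 2) (triangle i j k D) (triangle i j k D')"
    and eq: "component h i j = component f 0 1" "component h i k = component f 0 2" "component h j k = component f 1 2"
  shows "triangle_Ar i j k h = f"
proof (rule flag_hom_eqI[OF flag_pull_hom[OF flag_grpd_homD(1)[OF h] monotone_nth3[OF le]] flag_grpd_homD(1)[OF f]])
  fix a b :: nat assume "a < b" "b \<le> 2"
  then show "component (triangle_Ar i j k h) a b = component f a b"
    using upper2[of a b] eq by auto
qed

lemma triangle_Ar_component:
  assumes "triangle_Ar i j k h = triangle_Ar i j k h'"
  shows "component h i j = component h' i j" "component h i k = component h' i k"
    "component h j k = component h' j k"
  using arg_cong[OF assms, of "\<lambda>t. component t 0 1"] arg_cong[OF assms, of "\<lambda>t. component t 0 2"]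
    arg_cong[OF assms, of "\<lambda>t. component t 1 2"] by simp_all

lemma flag3_hom_exists:
  assumes D: "is_flag C z 3 D" "is_flag C z 3 D'"
    and c01: "c01 \<in> hom C (vert D 0 1) (vert D' 0 1)" "is_iso C c01"
    and c02: "c02 \<in> hom C (vert D 0 2) (vert D' 0 2)" "is_iso C c02"
    and c03: "c03 \<in> hom C (vert D 0 3) (vert D' 0 3)" "is_iso C c03"
    and c12: "c12 \<in> hom C (vert D 1 2) (vert D' 1 2)" "is_iso C c12"
    and c13: "c13 \<in> hom C (vert D 1 3) (vert D' 1 3)" "is_iso C c13"
    and c23: "c23 \<in> hom C (vert D 2 3) (vert D' 2 3)" "is_iso C c23"
    and h: "c02 \<cdot> hor D 0 1 = hor D' 0 1 \<cdot> c01" "c03 \<cdot> hor D 0 2 = hor D' 0 2 \<cdot> c02"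
      "c13 \<cdot> hor D 1 2 = hor D' 1 2 \<cdot> c12"
    and v: "c12 \<cdot> ver D 0 2 = ver D' 0 2 \<cdot> c02" "c13 \<cdot> ver D 0 3 = ver D' 0 3 \<cdot> c03"
      "c23 \<cdot> ver D 1 3 = ver D' 1 3 \<cdot> c13"
  obtains t where "t \<in> hom (flag_grpd C z 3) D D'" "component t 0 1 = c01" "component t 0 2 = c02"
    "component t 0 3 = c03" "component t 1 2 = c12" "component t 1 3 = c13" "component t 2 3 = c23"
proof -
  let ?c = "\<lambda>i j. if i = 0 then (if j = 1 then c01 else if j = 2 then c02 else c03)
    else if i = 1 then (if j = 2 then c12 else c13) else c23"
  obtain t where t: "t \<in> hom (flag_grpd C z 3) D D'"
    and c: "\<And>i j. i < j \<Longrightarrow> j \<le> 3 \<Longrightarrow> component t i j = ?c i j"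
  proof (rule flag_hom_exists[OF D, where c = ?c])
    fix i j :: nat
    show "?c i j \<in> hom C (vert D i j) (vert D' i j)" "is_iso C (?c i j)" if "i < j" "j \<le> 3"
      using upper3[OF that] assms by auto
    show "?c i (Suc j) \<cdot> hor D i j = hor D' i j \<cdot> ?c i j" if "i < j" "j < 3"
      using upper3[OF that(1)] that h by auto
    show "?c (Suc i) j \<cdot> ver D i j = ver D' i j \<cdot> ?c i j" if "Suc i < j" "j \<le> 3"
      using upper3[of i j] that v by auto
  qed blast
  show thesis by (rule that[OF t]) (simp_all add: c)
qed

text \<open>Of the three squares in \<open>sq\<close> the first is the interior one, with no corner
  on the diagonal; the other two say that 012 and 123 are short exact.\<close>

lemma flag3_exists:
  assumes V: "v01 \<in> Ob C" "v12 \<in> Ob C" "v23 \<in> Ob C"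
    and H: "h01 \<in> hom C v01 v02" "monic C h01" "h02 \<in> hom C v02 v03" "monic C h02"
      "h12 \<in> hom C v12 v13" "monic C h12"
    and W: "w02 \<in> hom C v02 v12" "epic C w02" "w03 \<in> hom C v03 v13" "epic C w03"
      "w13 \<in> hom C v13 v23" "epic C w13"
    and sq: "bicartesian C h02 w02 w03 h12" "bicartesian C h01 (zero_out v01) w02 (zero_in v12)"
      "bicartesian C h12 (zero_out v12) w13 (zero_in v23)"
  obtains D where "is_flag C z 3 D" "vert D 0 1 = v01" "vert D 0 2 = v02" "vert D 0 3 = v03"
    "vert D 1 2 = v12" "vert D 1 3 = v13" "vert D 2 3 = v23"
    "hor D 0 1 = h01" "hor D 0 2 = h02" "hor D 1 2 = h12" "ver D 0 2 = w02" "ver D 0 3 = w03" "ver D 1 3 = w13"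
proof -
  let ?V = "\<lambda>i j. if i = 0 then (if j = 1 then v01 else if j = 2 then v02 else v03)
    else if i = 1 then (if j = 2 then v12 else v13) else v23"
  let ?H = "\<lambda>i j. if i = 0 then (if j = 1 then h01 else h02) else h12"
  let ?W = "\<lambda>i j. if i = 0 then (if j = 2 then w02 else w03) else w13"
  note O = V hom_Ob[OF H(1)] hom_Ob[OF H(3)] hom_Ob[OF H(5)]
  obtain D where D: "is_flag C z 3 D"
    and v: "\<And>i j. i < j \<Longrightarrow> j \<le> 3 \<Longrightarrow> vert D i j = ?V i j"
    and h: "\<And>i j. i < j \<Longrightarrow> j < 3 \<Longrightarrow> hor D i j = ?H i j"
    and w: "\<And>i j. Suc i < j \<Longrightarrow> j \<le> 3 \<Longrightarrow> ver D i j = ?W i j"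
  proof (rule flag_exists[where V = ?V and H = ?H and W = ?W and n = 3])
    fix i j :: nat
    show "?V i j \<in> Ob C" if "i < j" "j \<le> 3"
      using upper3[OF that] O by auto
    show "?H i j \<in> hom C (?V i j) (?V i (Suc j))" "monic C (?H i j)" if "i < j" "j < 3"
      using upper3[OF that(1)] that H by auto
    show "?W i j \<in> hom C (?V i j) (?V (Suc i) j)" "epic C (?W i j)" if "Suc i < j" "j \<le> 3"
      using upper3[of i j] that W by auto
    show "bicartesian C (?H i j) (?W i j) (?W i (Suc j)) (?H (Suc i) j)" if "Suc i < j" "j < 3"
      using upper3[of i j] that sq by auto
    show "bicartesian C (?H i (Suc i)) (zero_out (?V i (Suc i))) (?W i (Suc (Suc i)))
        (zero_in (?V (Suc i) (Suc (Suc i))))" if "Suc i < 3"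
    proof -
      have "i = 0 \<or> i = 1" using that by arith
      then show ?thesis using sq by auto
    qed
  qed blast
  show thesis by (rule that[OF D]) (simp_all add: v h w)
qed

section \<open>Gluing 3-flags from 2-flags\<close>

text \<open>The square of \<open>A\<^sub>0\<^sub>2, A\<^sub>0\<^sub>3, A\<^sub>1\<^sub>2, A\<^sub>1\<^sub>3\<close> being bicartesian, \<open>A\<^sub>1\<^sub>3\<close> is recovered as a pushout
  from the triangles 012 and 023, and \<open>A\<^sub>0\<^sub>2\<close> as a pullback from the triangles 123 and 013.\<close>

lemma flag3_squares:
  assumes "is_flag C z 3 D"
  shows "pushout_square C (hor D 0 2) (ver D 0 2) (ver D 0 3) (hor D 1 2)"
    "pullback_square C (hor D 0 2) (ver D 0 2) (ver D 0 3) (hor D 1 2)"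
  using bicartesianD(6,7)[OF flag_bicartesian[OF assms, of 0 2]] by (simp_all add: numeral_3_eq_3 numeral_2_eq_2)

lemma flag3_homs:
  assumes "is_flag C z 3 D"
  shows "hor D 0 1 \<in> hom C (vert D 0 1) (vert D 0 2)" "hor D 0 2 \<in> hom C (vert D 0 2) (vert D 0 3)"
    "hor D 1 2 \<in> hom C (vert D 1 2) (vert D 1 3)" "ver D 0 2 \<in> hom C (vert D 0 2) (vert D 1 2)"
    "ver D 0 3 \<in> hom C (vert D 0 3) (vert D 1 3)" "ver D 1 3 \<in> hom C (vert D 1 3) (vert D 2 3)"
    "epic C (ver D 0 3)" "monic C (hor D 0 2)"
  using flag_hor[OF assms, of 0 1] flag_hor[OF assms, of 0 2] flag_hor[OF assms, of 1 2]
    flag_ver[OF assms, of 0 2] flag_ver[OF assms, of 0 3] flag_ver[OF assms, of 1 3]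
    flag_epic[OF assms, of 0 3] flag_monic[OF assms, of 0 2]
  by (simp_all add: numeral_3_eq_3 numeral_2_eq_2)

text \<open>The differences on the left are not evaluated, because the lemmas on triangles produce
  path lengths of the form \<open>k - j\<close>.\<close>

lemma flag3_paths:
  assumes "is_flag C z 3 D"
  shows "hor_path C D 0 1 (2 - 1) = hor D 0 1" "ver_path C D 0 2 (1 - 0) = ver D 0 2"
    "hor_path C D 0 2 (3 - 2) = hor D 0 2" "ver_path C D 0 3 (2 - 0) = ver D 1 3 \<cdot> ver D 0 3"
    "hor_path C D 1 2 (3 - 2) = hor D 1 2" "ver_path C D 1 3 (2 - 1) = ver D 1 3"
    "hor_path C D 0 1 (3 - 1) = hor D 0 2 \<cdot> hor D 0 1" "ver_path C D 0 3 (1 - 0) = ver D 0 3"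
  using hor_path_1[OF assms, of 0 1] ver_path_1[OF assms, of 0 2] hor_path_1[OF assms, of 0 2]
    ver_path_2[OF assms, of 0 3] hor_path_1[OF assms, of 1 2] ver_path_1[OF assms, of 1 3]
    hor_path_2[OF assms, of 0 1] ver_path_1[OF assms, of 0 3]
  by (simp_all add: numeral_3_eq_3 numeral_2_eq_2)

text \<open>The two morphisms agree on the edge 02 and provide every component except the one at 13.
  That one is induced between the two pushouts.\<close>

lemma glue_pushout_full:
  assumes D: "is_flag C z 3 D" "is_flag C z 3 D'"
    and f: "f \<in> hom (flag_grpd C z 2) (triangle 0 1 2 D) (triangle 0 1 2 D')"
    and g: "g \<in> hom (flag_grpd C z 2) (triangle 0 2 3 D) (triangle 0 2 3 D')"
    and fg: "component g 0 1 = component f 0 2"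
  obtains h where "h \<in> hom (flag_grpd C z 3) D D'" "triangle_Ar 0 1 2 h = f" "triangle_Ar 0 2 3 h = g"
proof -
  note F = triangle_hom[OF D _ _ _ f, simplified flag3_paths[OF D(1)] flag3_paths[OF D(2)], simplified]
    and G = triangle_hom[OF D _ _ _ g, simplified flag3_paths[OF D(1)] flag3_paths[OF D(2)], simplified]
  note d = flag3_homs[OF D(1)] and d' = flag3_homs[OF D(2)]
  obtain v where v: "v \<in> hom C (vert D 1 3) (vert D' 1 3)" "is_iso C v"
    "v \<cdot> ver D 0 3 = ver D' 0 3 \<cdot> component g 0 2" "v \<cdot> hor D 1 2 = hor D' 1 2 \<cdot> component f 1 2"
    by (rule pushout_map_iso[OF flag3_squares(1)[OF D(1)] flag3_squares(1)[OF D(2)] d(2,4,5,3) d'(2,4,5,3),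
          where s = "component f 0 2" and t = "component g 0 2" and u = "component f 1 2"])
      (use F G fg in \<open>auto\<close>)
  \<comment> \<open>It is enough to compare after the epimorphism from \<open>A03\<close> to
    \<open>A13\<close>. There the equation is the naturality of \<open>g\<close>, whose vertical
    arrow is the composite from \<open>A03\<close> through \<open>A13\<close> to
    \<open>A23\<close>.\<close>
  have "component g 1 2 \<cdot> ver D 1 3 = ver D' 1 3 \<cdot> v"
  proof (rule epicD[OF d(7) d(5)])
    have G5: "component g 1 2 \<in> hom C (vert D 2 3) (vert D' 2 3)" and G3: "component g 0 2 \<in> hom C (vert D 0 3) (vert D' 0 3)"
      using G by auto
    show "component g 1 2 \<cdot> ver D 1 3 \<in> hom C (vert D 1 3) (vert D' 2 3)"
      by (rule comp_hom[OF d(6) G5])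
    show "ver D' 1 3 \<cdot> v \<in> hom C (vert D 1 3) (vert D' 2 3)"
      by (rule comp_hom[OF v(1) d'(6)])
    show "(component g 1 2 \<cdot> ver D 1 3) \<cdot> ver D 0 3 = (ver D' 1 3 \<cdot> v) \<cdot> ver D 0 3"
      using G(8) by (simp add: comp_assoc[OF d(5,6) G5, symmetric, simplified] comp_assoc[OF d(5) v(1) d'(6), symmetric, simplified]
          v(3)[simplified] comp_assoc[OF G3 d'(5,6), simplified])
  qed
  then obtain h where h: "h \<in> hom (flag_grpd C z 3) D D'" "component h 0 1 = component f 0 1"
    "component h 0 2 = component f 0 2" "component h 0 3 = component g 0 2"
    "component h 1 2 = component f 1 2" "component h 1 3 = v" "component h 2 3 = component g 1 2"
    by (rule flag3_hom_exists[OF D, where ?c01.0 = "component f 0 1" and ?c02.0 = "component f 0 2"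
          and ?c03.0 = "component g 0 2" and ?c12.0 = "component f 1 2" and ?c13.0 = v and ?c23.0 = "component g 1 2", rotated -2])
      (use F G v fg in auto)
  show thesis
  proof (rule that[OF h(1)])
    show "triangle_Ar 0 1 2 h = f" by (rule triangle_Ar_eqI[OF h(1) _ _ _ f]) (simp_all add: h[simplified])
    show "triangle_Ar 0 2 3 h = g" by (rule triangle_Ar_eqI[OF h(1) _ _ _ g]) (simp_all add: h[simplified] fg[simplified])
  qed
qed


text \<open>The arrows to and from the diagonal entry are the unique ones, which brings the square
  of a 2-flag into the form that \<open>flag3_exists\<close> expects.\<close>

lemma short_exact:
  assumes "is_flag C z 2 x"
  shows "bicartesian C (hor x 0 1) (zero_out (vert x 0 1)) (ver x 0 2) (zero_in (vert x 1 2))"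
proof -
  have "ver x 0 1 \<in> hom C (vert x 0 1) z" "hor x 1 1 \<in> hom C z (vert x 1 2)"
    using flag_ver[OF assms, of 0 1] flag_hor[OF assms, of 1 1] flag_diag[OF assms, of 1]
    by (simp_all add: numeral_2_eq_2)
  then have "ver x 0 1 = zero_out (vert x 0 1)" "hor x 1 1 = zero_in (vert x 1 2)"
    by (blast intro: to_zero[OF _ zero_out(1)[OF hom_Ob(1)]] from_zero[OF _ zero_in(1)[OF hom_Ob(2)]])+
  then show ?thesis
    using flag_bicartesian[OF assms, of 0 1] by (simp add: numeral_2_eq_2)
qed

text \<open>Only the component at 13 lies in neither triangle, and it is determined after the
  epimorphism from \<open>A03\<close> to \<open>A13\<close>.\<close>

lemma glue_pushout_faithful:
  assumes h: "h \<in> hom (flag_grpd C z 3) D D'" "h' \<in> hom (flag_grpd C z 3) D D'"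
    and eq: "triangle_Ar 0 1 2 h = triangle_Ar 0 1 2 h'" "triangle_Ar 0 2 3 h = triangle_Ar 0 2 3 h'"
  shows "h = h'"
proof -
  note H = flag_grpd_homD[OF h(1)] and H' = flag_grpd_homD[OF h(2)]
  note c = triangle_Ar_component[OF eq(1)] triangle_Ar_component[OF eq(2)]
  note d = flag3_homs[OF H(2)]
  have 1: "component k 1 3 \<cdot> ver D 0 3 = ver D' 0 3 \<cdot> component k 0 3"
    if "k \<in> hom (flag_grpd C z 3) D D'" for k
    using flag_hom_ver[OF flag_grpd_homD(1)[OF that], of 0 3] by simp
  have "component h 1 3 = component h' 1 3"
  proof (rule epicD[OF d(7) d(5)])
    show "component h 1 3 \<in> hom C (vert D 1 3) (vert D' 1 3)" "component h' 1 3 \<in> hom C (vert D 1 3) (vert D' 1 3)"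
      using H(4)[of 1 3] H'(4)[of 1 3] by simp_all
    show "component h 1 3 \<cdot> ver D 0 3 = component h' 1 3 \<cdot> ver D 0 3"
      unfolding 1[OF h(1)] 1[OF h(2)] by (simp add: c)
  qed
  then show ?thesis
    using c by (intro flag_hom_eqI[OF H(1) H'(1)]) (auto dest!: upper3)
qed

text \<open>Essential surjectivity for the cut along 02. The triangle \<open>x\<close> is reproduced
  exactly, and \<open>y\<close> up to an isomorphism that extends \<phi> by identities.\<close>

lemma glue_pushout_exists:
  assumes x: "is_flag C z 2 x" and y: "is_flag C z 2 y"
    and \<phi>: "\<phi> \<in> hom C (vert x 0 2) (vert y 0 1)" "is_iso C \<phi>"
  obtains D g where "is_flag C z 3 D" "triangle 0 1 2 D = x" "vert D 2 3 = vert y 1 2"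
    "g \<in> hom (flag_grpd C z 2) (triangle 0 2 3 D) y" "component g 0 1 = \<phi>"
    "component g 1 2 = Idt C (vert y 1 2)"
proof -
  have X: "vert x 0 1 \<in> Ob C" "vert x 0 2 \<in> Ob C" "vert x 1 2 \<in> Ob C"
    and Y: "vert y 0 1 \<in> Ob C" "vert y 0 2 \<in> Ob C" "vert y 1 2 \<in> Ob C"
    using flag_vert[OF x] flag_vert[OF y] by simp_all
  have xh: "hor x 0 1 \<in> hom C (vert x 0 1) (vert x 0 2)" "monic C (hor x 0 1)"
    "ver x 0 2 \<in> hom C (vert x 0 2) (vert x 1 2)" "epic C (ver x 0 2)"
    using flag_hor[OF x, of 0 1] flag_monic[OF x, of 0 1] flag_ver[OF x, of 0 2] flag_epic[OF x, of 0 2]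
    by (simp_all add: numeral_2_eq_2)
  have yh: "hor y 0 1 \<in> hom C (vert y 0 1) (vert y 0 2)" "monic C (hor y 0 1)"
    "ver y 0 2 \<in> hom C (vert y 0 2) (vert y 1 2)" "epic C (ver y 0 2)"
    using flag_hor[OF y, of 0 1] flag_monic[OF y, of 0 1] flag_ver[OF y, of 0 2] flag_epic[OF y, of 0 2]
    by (simp_all add: numeral_2_eq_2)
  note xsq = short_exact[OF x] and ysq = short_exact[OF y]
  \<comment> \<open>\<open>A02\<close> is taken from \<open>x\<close> and \<open>A03\<close> from
    \<open>y\<close>, so \<phi> is built into the inclusion between them. The pushout of
    \<open>m\<close> along \<open>ver x 0 2\<close> provides \<open>A13\<close>.\<close>
  define m where "m = hor y 0 1 \<cdot> \<phi>"
  have m: "m \<in> hom C (vert x 0 2) (vert y 0 2)" "monic C m"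
    unfolding m_def using comp_hom[OF \<phi>(1) yh(1)] monic_comp[OF iso_monic[OF \<phi>(2,1)] \<phi>(1) yh(2,1)] by auto
  obtain q g where po: "mono_epi_square C m (ver x 0 2) q g" "pushout_square C m (ver x 0 2) q g"
    using pushout_exists[OF m(2) xh(4)] m(1) xh(3) by (auto simp: homD)
  obtain E where q: "q \<in> hom C (vert y 0 2) E" and g: "g \<in> hom C (vert x 1 2) E"
    using pushout_comm[OF po(2)] m(1) xh(3) by (auto simp: comm_square_def hom_def)
  note zi = zero_in[OF Y(3)] and zo = zero_out[OF X(3)]
  \<comment> \<open>Pasting this square with that of \<open>y\<close> exhibits
    \<open>vert y 1 2\<close> as the cokernel of \<open>m\<close>.\<close>
  have "pushout_square C \<phi> (zero_out (vert x 0 2)) (zero_out (vert y 0 1)) (Idt C z)"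
  proof (rule pushout_iso_square[OF comm_squareI[OF \<phi>(1) zero_out(1)[OF X(2)] zero_out(1)[OF Y(1)] id_hom[OF zero_Ob]] \<phi>(2) is_iso_Idt[OF zero_Ob]])
    show "zero_out (vert y 0 1) \<cdot> \<phi> = Idt C z \<cdot> zero_out (vert x 0 2)"
      by (rule to_zero[OF comp_hom[OF \<phi>(1) zero_out(1)[OF Y(1)]] comp_hom[OF zero_out(1)[OF X(2)] id_hom[OF zero_Ob]]])
  qed
  from pushout_comp[OF this bicartesianD(6)[OF ysq]]
  have "pushout_square C m (zero_out (vert x 0 2)) (ver y 0 2) (zero_in (vert y 1 2))"
    by (simp add: m_def comp_id[OF zi(1), simplified])
  \<comment> \<open>Factoring through \<open>vert x 1 2\<close> makes \<open>po\<close> one half of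
    the outer pushout. Cancelling it will leave the square of the triangle 123.\<close>
  also have "zero_out (vert x 0 2) = zero_out (vert x 1 2) \<cdot> ver x 0 2"
    by (rule to_zero[OF zero_out(1)[OF X(2)] comp_hom[OF xh(3) zo(1)]])
  finally have outer: "pushout_square C m (zero_out (vert x 1 2) \<cdot> ver x 0 2) (ver y 0 2) (zero_in (vert y 1 2))" .
  have "ver y 0 2 \<cdot> m = (zero_in (vert y 1 2) \<cdot> zero_out (vert x 1 2)) \<cdot> ver x 0 2"
    using pushout_comm[OF outer] by (simp add: comm_square_def comp_assoc[OF xh(3) zo(1) zi(1), simplified])
  \<comment> \<open>\<open>w\<close> becomes the arrow from \<open>A13\<close> to
    \<open>A23\<close>. It is epic because its composite with \<open>q\<close> is
    \<open>ver y 0 2\<close>.\<close>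
  then obtain w where w: "w \<in> hom C E (vert y 1 2)" "w \<cdot> q = ver y 0 2"
    "w \<cdot> g = zero_in (vert y 1 2) \<cdot> zero_out (vert x 1 2)"
    by (rule pushout_induced[OF po(2) m(1) xh(3) q g yh(3) comp_hom[OF zo(1) zi(1)]])
  have we: "epic C w"
    by (rule epic_cancel[OF q w(1)]) (simp add: w(2) yh(4)[simplified])
  have inner: "pushout_square C g (zero_out (vert x 1 2)) w (zero_in (vert y 1 2))"
  proof (rule pushout_square_flip[OF pushout_cancel[OF pushout_square_flip[OF po(2)]]])
    show "pushout_square C (zero_out (vert x 1 2) \<cdot> ver x 0 2) m (zero_in (vert y 1 2)) (w \<cdot> q)"
      unfolding w(2) by (rule pushout_square_flip[OF outer])
    show "comm_square C (zero_out (vert x 1 2)) g (zero_in (vert y 1 2)) w"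
      by (rule comm_squareI[OF zo(1) g zi(1) w(1) w(3)[symmetric]])
  qed
  have qe: "epic C q" and gm: "monic C g" using po(1) by (auto simp: mono_epi_square_def)
  obtain D where D: "is_flag C z 3 D" "vert D 0 1 = vert x 0 1" "vert D 0 2 = vert x 0 2" "vert D 0 3 = vert y 0 2"
    "vert D 1 2 = vert x 1 2" "vert D 1 3 = E" "vert D 2 3 = vert y 1 2"
    "hor D 0 1 = hor x 0 1" "hor D 0 2 = m" "hor D 1 2 = g" "ver D 0 2 = ver x 0 2" "ver D 0 3 = q" "ver D 1 3 = w"
    by (rule flag3_exists[OF X(1,3) Y(3) xh(1,2) m g gm xh(3,4) q qe w(1) we bicartesianI[OF po(2) m(2) xh(4) qe gm]
          xsq bicartesianI[OF inner gm zo(2) we zi(2)]])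
  note p = flag3_paths[OF D(1), unfolded D]
  obtain k where k: "k \<in> hom (flag_grpd C z 2) (triangle 0 2 3 D) y" "component k 0 1 = \<phi>"
    "component k 1 2 = Idt C (vert y 1 2)"
  proof (rule triangle_hom_exists[OF D(1) y _ _ _ _ \<phi>(2) _ is_iso_Idt[OF Y(2)] _ is_iso_Idt[OF Y(3)], of 0 2 3])
    show "Idt C (vert y 0 2) \<cdot> hor_path C D 0 2 (3 - 2) = hor y 0 1 \<cdot> \<phi>"
      unfolding p(3) id_comp[OF m(1)] by (rule m_def)
    show "Idt C (vert y 1 2) \<cdot> ver_path C D 0 3 (2 - 0) = ver y 0 2 \<cdot> Idt C (vert y 0 2)"
      unfolding p(4) w(2) id_comp[OF yh(3)] comp_id[OF yh(3)] ..
  qed (use \<phi>(1) Y id_hom in \<open>auto simp: D[simplified]\<close>)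
  show thesis
  proof (rule that[OF D(1) triangle_eqI[OF D(1) x] D(7) k])
    show "hor_path C D 0 1 (2 - 1) = hor x 0 1" by (rule p(1))
    show "ver_path C D 0 2 (1 - 0) = ver x 0 2" by (rule p(2))
  qed (simp_all add: D[simplified])
qed

text \<open>Dual to the cut along 02: the triangles 123 and 013 miss only the component at 02, which
  is induced between the two pullbacks.\<close>

lemma glue_pullback_full:
  assumes D: "is_flag C z 3 D" "is_flag C z 3 D'"
    and f: "f \<in> hom (flag_grpd C z 2) (triangle 1 2 3 D) (triangle 1 2 3 D')"
    and g: "g \<in> hom (flag_grpd C z 2) (triangle 0 1 3 D) (triangle 0 1 3 D')"
    and fg: "component g 1 2 = component f 0 2"
  obtains h where "h \<in> hom (flag_grpd C z 3) D D'" "triangle_Ar 1 2 3 h = f" "triangle_Ar 0 1 3 h = g"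
proof -
  note F = triangle_hom[OF D _ _ _ f, simplified flag3_paths[OF D(1)] flag3_paths[OF D(2)], simplified]
    and G = triangle_hom[OF D _ _ _ g, simplified flag3_paths[OF D(1)] flag3_paths[OF D(2)], simplified]
  note d = flag3_homs[OF D(1)] and d' = flag3_homs[OF D(2)]
  obtain v where v: "v \<in> hom C (vert D 0 2) (vert D' 0 2)" "is_iso C v"
    "hor D' 0 2 \<cdot> v = component g 0 2 \<cdot> hor D 0 2" "ver D' 0 2 \<cdot> v = component f 0 1 \<cdot> ver D 0 2"
    by (rule pullback_map_iso[OF flag3_squares(2)[OF D(1)] flag3_squares(2)[OF D(2)] d(2,4,5,3) d'(2,4,5,3),
          where s = "component f 0 2" and t = "component g 0 2" and u = "component f 0 1"])
      (use F G fg in \<open>auto\<close>)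
  \<comment> \<open>Compared after the monomorphism from \<open>A02\<close> to \<open>A03\<close>,
    where the equation is the naturality of \<open>g\<close> along the composite inclusion of
    \<open>A01\<close> into \<open>A03\<close>.\<close>
  have nat: "v \<cdot> hor D 0 1 = hor D' 0 1 \<cdot> component g 0 1"
  proof (rule monicD[OF d'(8) d'(2)])
    have G1: "component g 0 1 \<in> hom C (vert D 0 1) (vert D' 0 1)" and G3: "component g 0 2 \<in> hom C (vert D 0 3) (vert D' 0 3)"
      using G by auto
    show "v \<cdot> hor D 0 1 \<in> hom C (vert D 0 1) (vert D' 0 2)"
      by (rule comp_hom[OF d(1) v(1)])
    show "hor D' 0 1 \<cdot> component g 0 1 \<in> hom C (vert D 0 1) (vert D' 0 2)"
      by (rule comp_hom[OF G1 d'(1)])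
    show "hor D' 0 2 \<cdot> (v \<cdot> hor D 0 1) = hor D' 0 2 \<cdot> (hor D' 0 1 \<cdot> component g 0 1)"
      using G(7) by (simp add: comp_assoc[OF d(1) v(1) d'(2), simplified] v(3)[simplified]
          comp_assoc[OF d(1,2) G3, symmetric, simplified] comp_assoc[OF G1 d'(1,2), simplified])
  qed
  obtain h where h: "h \<in> hom (flag_grpd C z 3) D D'" "component h 0 1 = component g 0 1"
    "component h 0 2 = v" "component h 0 3 = component g 0 2"
    "component h 1 2 = component f 0 1" "component h 1 3 = component f 0 2" "component h 2 3 = component f 1 2"
    by (rule flag3_hom_exists[OF D, where ?c01.0 = "component g 0 1" and ?c02.0 = v
          and ?c03.0 = "component g 0 2" and ?c12.0 = "component f 0 1" and ?c13.0 = "component f 0 2"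
          and ?c23.0 = "component f 1 2"])
      (use F G v fg nat in auto)
  show thesis
  proof (rule that[OF h(1)])
    show "triangle_Ar 1 2 3 h = f" by (rule triangle_Ar_eqI[OF h(1) _ _ _ f]) (simp_all add: h[simplified])
    show "triangle_Ar 0 1 3 h = g" by (rule triangle_Ar_eqI[OF h(1) _ _ _ g]) (simp_all add: h[simplified] fg[simplified])
  qed
qed

text \<open>The component at 02 lies in neither triangle and is determined by composing with the
  monomorphism from \<open>A02\<close> to \<open>A03\<close>.\<close>

lemma glue_pullback_faithful:
  assumes h: "h \<in> hom (flag_grpd C z 3) D D'" "h' \<in> hom (flag_grpd C z 3) D D'"
    and eq: "triangle_Ar 1 2 3 h = triangle_Ar 1 2 3 h'" "triangle_Ar 0 1 3 h = triangle_Ar 0 1 3 h'"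
  shows "h = h'"
proof -
  note H = flag_grpd_homD[OF h(1)] and H' = flag_grpd_homD[OF h(2)]
  note c = triangle_Ar_component[OF eq(1)] triangle_Ar_component[OF eq(2)]
  note d = flag3_homs[OF H(3)]
  have 1: "hor D' 0 2 \<cdot> component k 0 2 = component k 0 3 \<cdot> hor D 0 2"
    if "k \<in> hom (flag_grpd C z 3) D D'" for k
    using flag_hom_hor[OF flag_grpd_homD(1)[OF that], of 0 2] by (simp add: numeral_3_eq_3 numeral_2_eq_2)
  have "component h 0 2 = component h' 0 2"
  proof (rule monicD[OF d(8) d(2)])
    show "component h 0 2 \<in> hom C (vert D 0 2) (vert D' 0 2)" "component h' 0 2 \<in> hom C (vert D 0 2) (vert D' 0 2)"
      using H(4)[of 0 2] H'(4)[of 0 2] by simp_all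
    show "hor D' 0 2 \<cdot> component h 0 2 = hor D' 0 2 \<cdot> component h' 0 2"
      unfolding 1[OF h(1)] 1[OF h(2)] by (simp add: c)
  qed
  then show ?thesis
    using c by (intro flag_hom_eqI[OF H(1) H'(1)]) (auto dest!: upper3)
qed

text \<open>Essential surjectivity for the cut along 13. Again \<open>x\<close> is reproduced
  exactly, now as the triangle 123, and \<open>y\<close> up to an isomorphism that extends \<phi> by
  identities.\<close>

lemma glue_pullback_exists:
  assumes x: "is_flag C z 2 x" and y: "is_flag C z 2 y"
    and \<phi>: "\<phi> \<in> hom C (vert x 0 2) (vert y 1 2)" "is_iso C \<phi>"
  obtains D g where "is_flag C z 3 D" "triangle 1 2 3 D = x" "vert D 0 1 = vert y 0 1"
    "g \<in> hom (flag_grpd C z 2) (triangle 0 1 3 D) y" "component g 0 1 = Idt C (vert y 0 1)"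
    "component g 1 2 = \<phi>"
proof -
  have X: "vert x 0 1 \<in> Ob C" "vert x 0 2 \<in> Ob C" "vert x 1 2 \<in> Ob C"
    and Y: "vert y 0 1 \<in> Ob C" "vert y 0 2 \<in> Ob C" "vert y 1 2 \<in> Ob C"
    using flag_vert[OF x] flag_vert[OF y] by simp_all
  have xh: "hor x 0 1 \<in> hom C (vert x 0 1) (vert x 0 2)" "monic C (hor x 0 1)"
    "ver x 0 2 \<in> hom C (vert x 0 2) (vert x 1 2)" "epic C (ver x 0 2)"
    using flag_hor[OF x, of 0 1] flag_monic[OF x, of 0 1] flag_ver[OF x, of 0 2] flag_epic[OF x, of 0 2]
    by (simp_all add: numeral_2_eq_2)
  have yh: "hor y 0 1 \<in> hom C (vert y 0 1) (vert y 0 2)" "monic C (hor y 0 1)"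
    "ver y 0 2 \<in> hom C (vert y 0 2) (vert y 1 2)" "epic C (ver y 0 2)"
    using flag_hor[OF y, of 0 1] flag_monic[OF y, of 0 1] flag_ver[OF y, of 0 2] flag_epic[OF y, of 0 2]
    by (simp_all add: numeral_2_eq_2)
  note xsq = short_exact[OF x] and ysq = short_exact[OF y]
  note \<phi>i = inv_arr[OF \<phi>(2,1)] and \<phi>ii = is_iso_inv_arr[OF \<phi>(2)]
  \<comment> \<open>\<open>A13\<close> is taken from \<open>x\<close> and \<open>A03\<close> from
    \<open>y\<close>, so \<phi> must be inverted to map the second onto the first. The pullback of
    \<open>e\<close> along \<open>hor x 0 1\<close> provides \<open>A02\<close>.\<close>
  define e where "e = inv_arr C \<phi> \<cdot> ver y 0 2"
  have e: "e \<in> hom C (vert y 0 2) (vert x 0 2)" "epic C e"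
    unfolding e_def using comp_hom[OF yh(3) \<phi>i(1)] epic_comp[OF yh(4,3) iso_epic[OF \<phi>ii \<phi>i(1)] \<phi>i(1)] by auto
  obtain f p where pb: "mono_epi_square C f p e (hor x 0 1)" "pullback_square C f p e (hor x 0 1)"
    using pullback_exists[OF xh(2) e(2)] e(1) xh(1) by (auto simp: homD)
  obtain E where f: "f \<in> hom C E (vert y 0 2)" and p: "p \<in> hom C E (vert x 0 1)"
    using pb(2) e(1) xh(1) by (auto simp: pullback_square_def comm_square_def hom_def)
  note zi = zero_in[OF X(1)] and zo = zero_out[OF Y(1)]
  note zi2 = zero_in[OF X(2)] and ziy = zero_in[OF Y(3)]
  \<comment> \<open>Placed below the square of \<open>y\<close>, this square replaces
    \<open>vert y 1 2\<close> by \<open>vert x 0 2\<close>. Passing through bicartesian squares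
    turns pushouts into pullbacks, and the pasted square exhibits \<open>hor y 0 1\<close> as the
    kernel of \<open>e\<close>.\<close>
  have "pushout_square C (Idt C z) (zero_in (vert y 1 2)) (zero_in (vert x 0 2)) (inv_arr C \<phi>)"
  proof (rule pushout_iso_square[OF comm_squareI[OF id_hom[OF zero_Ob] ziy(1) zi2(1) \<phi>i(1)] is_iso_Idt[OF zero_Ob] \<phi>ii])
    show "zero_in (vert x 0 2) \<cdot> Idt C z = inv_arr C \<phi> \<cdot> zero_in (vert y 1 2)"
      by (rule from_zero[OF comp_hom[OF id_hom[OF zero_Ob] zi2(1)] comp_hom[OF ziy(1) \<phi>i(1)]])
  qed
  then have "bicartesian C (zero_in (vert y 1 2)) (Idt C z) (inv_arr C \<phi>) (zero_in (vert x 0 2))"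
    using iso_epic[OF is_iso_Idt id_hom] iso_epic[OF \<phi>ii \<phi>i(1)] zero_Ob zi2(2) ziy(2)
    by (intro bicartesianI[OF pushout_square_flip])
  from bicartesianD(7)[OF bicartesian_comp_ver[OF ysq this]]
  have "pullback_square C (hor y 0 1) (zero_out (vert y 0 1)) e (zero_in (vert x 0 2))"
    by (simp add: e_def id_comp[OF zo(1), simplified])
  \<comment> \<open>Factoring through \<open>vert x 0 1\<close> makes \<open>pb\<close> one half of
    the outer pullback; cancelling it will leave the square of the triangle 012.\<close>
  also have "zero_in (vert x 0 2) = hor x 0 1 \<cdot> zero_in (vert x 0 1)"
    by (rule from_zero[OF zi2(1) comp_hom[OF zi(1) xh(1)]])
  finally have outer: "pullback_square C (hor y 0 1) (zero_out (vert y 0 1)) e (hor x 0 1 \<cdot> zero_in (vert x 0 1))" .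
  have "e \<cdot> hor y 0 1 = hor x 0 1 \<cdot> (zero_in (vert x 0 1) \<cdot> zero_out (vert y 0 1))"
    using outer by (simp add: pullback_square_def comm_square_def comp_assoc[OF zo(1) zi(1) xh(1), simplified])
  \<comment> \<open>\<open>u\<close> becomes the arrow from \<open>A01\<close> to
    \<open>A02\<close>. It is monic because its composite with \<open>f\<close> is
    \<open>hor y 0 1\<close>.\<close>
  then obtain u where u: "u \<in> hom C (vert y 0 1) E" "f \<cdot> u = hor y 0 1"
    "p \<cdot> u = zero_in (vert x 0 1) \<cdot> zero_out (vert y 0 1)"
    by (rule pullback_induced[OF pb(2) f p e(1) xh(1) yh(1) comp_hom[OF zo(1) zi(1)]])
  have um: "monic C u"
    by (rule monic_cancel[OF u(1) f]) (simp add: u(2) yh(2)[simplified])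
  have inner: "pullback_square C u (zero_out (vert y 0 1)) p (zero_in (vert x 0 1))"
  proof (rule pullback_cancel[OF pb(2)])
    show "pullback_square C (f \<cdot> u) (zero_out (vert y 0 1)) e (hor x 0 1 \<cdot> zero_in (vert x 0 1))"
      unfolding u(2) by (rule outer)
    show "comm_square C u (zero_out (vert y 0 1)) p (zero_in (vert x 0 1))"
      by (rule comm_squareI[OF u(1) zo(1) p zi(1) u(3)])
  qed
  have pe: "epic C p" and fm: "monic C f" using pb(1) by (auto simp: mono_epi_square_def)
  obtain D where D: "is_flag C z 3 D" "vert D 0 1 = vert y 0 1" "vert D 0 2 = E" "vert D 0 3 = vert y 0 2"
    "vert D 1 2 = vert x 0 1" "vert D 1 3 = vert x 0 2" "vert D 2 3 = vert x 1 2"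
    "hor D 0 1 = u" "hor D 0 2 = f" "hor D 1 2 = hor x 0 1" "ver D 0 2 = p" "ver D 0 3 = e" "ver D 1 3 = ver x 0 2"
    by (rule flag3_exists[OF Y(1) X(1,3) u(1) um f fm xh(1,2) p pe e xh(3,4) bicartesianI_pullback[OF pb(2) fm pe e(2) xh(2)]
          bicartesianI_pullback[OF inner um zo(2) pe zi(2)] xsq])
  note path = flag3_paths[OF D(1), unfolded D]
  obtain k where k: "k \<in> hom (flag_grpd C z 2) (triangle 0 1 3 D) y" "component k 0 1 = Idt C (vert y 0 1)"
    "component k 1 2 = \<phi>"
  proof (rule triangle_hom_exists[OF D(1) y _ _ _ _ is_iso_Idt[OF Y(1)] _ is_iso_Idt[OF Y(2)] _ \<phi>(2), of 0 1 3])
    show "Idt C (vert y 0 2) \<cdot> hor_path C D 0 1 (3 - 1) = hor y 0 1 \<cdot> Idt C (vert y 0 1)"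
      unfolding path(7) u(2) id_comp[OF yh(1)] comp_id[OF yh(1)] ..
    show "\<phi> \<cdot> ver_path C D 0 3 (1 - 0) = ver y 0 2 \<cdot> Idt C (vert y 0 2)"
      unfolding path(8) e_def comp_inv_cancel(1)[OF \<phi>(2,1) yh(3)] comp_id[OF yh(3)] ..
  qed (use \<phi>(1) Y id_hom in \<open>auto simp: D[simplified]\<close>)
  show thesis
  proof (rule that[OF D(1) triangle_eqI[OF D(1) x] D(2) k])
    show "hor_path C D 1 2 (3 - 2) = hor x 0 1" by (rule path(5))
    show "ver_path C D 1 3 (2 - 1) = ver x 0 2" by (rule path(6))
  qed (simp_all add: D[simplified])
qed

section \<open>Degenerate flags\<close>

text \<open>If the subobject of a short exact sequence is zero, its epimorphism is a pushout of an
  isomorphism and hence an isomorphism. Its inverse after \<psi> is the component in the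
  middle.\<close>

lemma degenerate_left_exists:
  assumes a: "is_flag C z 1 a" and y: "is_flag C z 2 y"
    and \<phi>: "\<phi> \<in> hom C z (vert y 0 1)" "is_iso C \<phi>"
    and \<psi>: "\<psi> \<in> hom C (vert a 0 1) (vert y 1 2)" "is_iso C \<psi>"
  obtains g where "g \<in> hom (flag_grpd C z 2) (triangle 0 0 1 a) y" "component g 0 1 = \<phi>" "component g 1 2 = \<psi>"
proof -
  have Y: "vert y 0 1 \<in> Ob C" "vert y 1 2 \<in> Ob C" using flag_vert[OF y] by simp_all
  have vy: "ver y 0 2 \<in> hom C (vert y 0 2) (vert y 1 2)" and hy: "hor y 0 1 \<in> hom C (vert y 0 1) (vert y 0 2)"
    using flag_ver[OF y, of 0 2] flag_hor[OF y, of 0 1] by (simp_all add: numeral_2_eq_2)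
  \<comment> \<open>Arrows to \<open>z\<close> are unique, so the inverse of \<phi> is the zero
    arrow; this makes the zero arrow an isomorphism.\<close>
  have "zero_out (vert y 0 1) = inv_arr C \<phi>"
    by (rule to_zero[OF zero_out(1)[OF Y(1)] inv_arr(1)[OF \<phi>(2,1)]])
  then have iv: "is_iso C (ver y 0 2)"
    using pushout_iso_side[OF bicartesianD(6)[OF short_exact[OF y]]] is_iso_inv_arr[OF \<phi>(2)] by simp
  note i = inv_arr[OF iv vy]
  have a0: "vert a 0 0 = z" using flag_diag[OF a] by simp
  note c = comp_hom[OF \<psi>(1) i(1)]
  show thesis
  proof (rule triangle_hom_exists[where i = 0 and j = 0 and k = 1, OF a y _ _ _ _ \<phi>(2) c is_iso_comp[OF \<psi>(2,1) is_iso_inv_arr[OF iv] i(1)] _ \<psi>(2)])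
    have h: "hor_path C a 0 0 (1 - 0) \<in> hom C z (vert a 0 1)"
      using hor_path(1)[OF a, of 0 0 1] a0 by simp
    show "(inv_arr C (ver y 0 2) \<cdot> \<psi>) \<cdot> hor_path C a 0 0 (1 - 0) = hor y 0 1 \<cdot> \<phi>"
      by (rule from_zero[OF comp_hom[OF h c] comp_hom[OF \<phi>(1) hy]])
    show "\<psi> \<cdot> ver_path C a 0 1 (0 - 0) = ver y 0 2 \<cdot> (inv_arr C (ver y 0 2) \<cdot> \<psi>)"
      using comp_id[OF \<psi>(1)] comp_inv_cancel(1)[OF iv vy \<psi>(1)] by simp
  qed (use \<phi> \<psi> a0 that in auto)
qed

text \<open>If the quotient is zero, the monomorphism is a pullback of an isomorphism and hence an
  isomorphism; after \<phi> it gives the component in the middle.\<close>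

lemma degenerate_right_exists:
  assumes a: "is_flag C z 1 a" and y: "is_flag C z 2 y"
    and \<phi>: "\<phi> \<in> hom C (vert a 0 1) (vert y 0 1)" "is_iso C \<phi>"
    and \<psi>: "\<psi> \<in> hom C z (vert y 1 2)" "is_iso C \<psi>"
  obtains g where "g \<in> hom (flag_grpd C z 2) (triangle 0 1 1 a) y" "component g 0 1 = \<phi>" "component g 1 2 = \<psi>"
proof -
  have Y: "vert y 0 1 \<in> Ob C" "vert y 1 2 \<in> Ob C" using flag_vert[OF y] by simp_all
  have vy: "ver y 0 2 \<in> hom C (vert y 0 2) (vert y 1 2)" and hy: "hor y 0 1 \<in> hom C (vert y 0 1) (vert y 0 2)"
    using flag_ver[OF y, of 0 2] flag_hor[OF y, of 0 1] by (simp_all add: numeral_2_eq_2)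
  have \<psi>z: "zero_in (vert y 1 2) = \<psi>"
    by (rule from_zero[OF zero_in(1)[OF Y(2)] \<psi>(1)])
  then have ih: "is_iso C (hor y 0 1)"
    using pullback_iso_side[OF bicartesianD(7)[OF short_exact[OF y]]] \<psi>(2) by simp
  have a1: "vert a 1 1 = z" using flag_diag[OF a] by simp
  note c = comp_hom[OF \<phi>(1) hy] and zo = zero_out(1)[OF Y(1)]
  have sq: "ver y 0 2 \<cdot> hor y 0 1 = \<psi> \<cdot> zero_out (vert y 0 1)"
    using bicartesianD(1)[OF short_exact[OF y]] \<psi>z by (simp add: comm_square_def)
  show thesis
  proof (rule triangle_hom_exists[where i = 0 and j = 1 and k = 1, OF a y _ _ _ \<phi> c is_iso_comp[OF \<phi>(2,1) ih hy] _ \<psi>(2)])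
    show "(hor y 0 1 \<cdot> \<phi>) \<cdot> hor_path C a 0 1 (1 - 1) = hor y 0 1 \<cdot> \<phi>"
      using comp_id[OF c] by simp
    have v: "ver_path C a 0 1 (1 - 0) \<in> hom C (vert a 0 1) z"
      using ver_path(1)[OF a, of 0 1 1] a1 by simp
    have "zero_out (vert y 0 1) \<cdot> \<phi> = ver_path C a 0 1 (1 - 0)"
      by (rule to_zero[OF comp_hom[OF \<phi>(1) zo] v])
    then show "\<psi> \<cdot> ver_path C a 0 1 (1 - 0) = ver y 0 2 \<cdot> (hor y 0 1 \<cdot> \<phi>)"
      using comp_assoc[OF \<phi>(1) hy vy] comp_assoc[OF \<phi>(1) zo \<psi>(1)] sq by simp
  qed (use \<psi> a1 that in auto)
qed

text \<open>In the triangle 001 the arrow from the middle entry to the quotient is an identity, so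
  the component at the quotient determines the middle one. The remaining component starts at
  \<open>z\<close>.\<close>

lemma degenerate_left_full:
  assumes f: "f \<in> hom (flag_grpd C z 1) a b"
    and g: "g \<in> hom (flag_grpd C z 2) (triangle 0 0 1 a) (triangle 0 0 1 b)"
    and fg: "component g 1 2 = component f 0 1"
  shows "triangle_Ar 0 0 1 f = g"
proof (rule triangle_Ar_eqI[OF f _ _ _ g])
  note F = flag_grpd_homD[OF f]
  note G = triangle_hom[OF F(2,3) _ _ _ g, simplified]
  show "component f 0 0 = component g 0 1"
    using F(4)[of 0 0] G(1) flag_diag[OF F(2), of 0] from_zero by simp
  show "component f 0 1 = component g 0 2"
    using G(8) comp_id[OF G(5)] id_comp[OF G(3)] fg by simp
qed (use fg in auto)

lemma degenerate_right_full:
  assumes f: "f \<in> hom (flag_grpd C z 1) a b"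
    and g: "g \<in> hom (flag_grpd C z 2) (triangle 0 1 1 a) (triangle 0 1 1 b)"
    and fg: "component g 0 1 = component f 0 1"
  shows "triangle_Ar 0 1 1 f = g"
proof (rule triangle_Ar_eqI[OF f _ _ _ g])
  note F = flag_grpd_homD[OF f]
  note G = triangle_hom[OF F(2,3) _ _ _ g, simplified]
  show "component f 1 1 = component g 1 2"
    using F(4)[of 1 1] G(5) flag_diag[OF F(2), of 1] from_zero by simp
  show "component f 0 1 = component g 0 2"
    using G(7) comp_id[OF G(3)] id_comp[OF G(1)] fg by simp
qed (use fg in auto)

end

section \<open>The algebra structure\<close>

text \<open>Only the values up to \<open>m\<close> matter, so \<open>vertex_incl\<close>, which
  counts elements, may be exchanged for a list lookup.\<close>

lemma flag_pull_cong:
  assumes "\<And>i. i \<le> m \<Longrightarrow> \<theta> i = \<theta>' i"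
  shows "flag_pull C m \<theta> = flag_pull C m \<theta>'"
proof -
  have "diagram_pull C m \<theta> D = diagram_pull C m \<theta>' D" for D
    using assms by (auto simp: diagram_pull_def fun_eq_iff)
  then show ?thesis using assms by (auto simp: flag_pull_def fun_eq_iff)
qed

lemma vertex_incl_012:
  "vertex_incl {0, 1} {0, 1, 2} 0 = 0" "vertex_incl {0, 1} {0, 1, 2} 1 = 1"
  "vertex_incl {1, 2} {0, 1, 2} 0 = 1" "vertex_incl {1, 2} {0, 1, 2} 1 = 2"
  "vertex_incl {0, 2} {0, 1, 2} 0 = 0" "vertex_incl {0, 2} {0, 1, 2} 1 = 2"
proof -
  have "{x \<in> {0, 1, 2}. x < (0::nat)} = {}" "{x \<in> {0, 1, 2}. x < (1::nat)} = {0}"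
    "{x \<in> {0, 1, 2}. x < (2::nat)} = {0, 1}" by auto
  then show "vertex_incl {0, 1} {0, 1, 2} 0 = 0" "vertex_incl {0, 1} {0, 1, 2} 1 = 1"
    "vertex_incl {1, 2} {0, 1, 2} 0 = 1" "vertex_incl {1, 2} {0, 1, 2} 1 = 2"
    "vertex_incl {0, 2} {0, 1, 2} 0 = 0" "vertex_incl {0, 2} {0, 1, 2} 1 = 2"
    unfolding vertex_incl_def by (simp_all del: Collect_conj_eq One_nat_def)
qed

lemma S_restrict_edge:
  "card I = 2 \<Longrightarrow> vertex_incl I J 0 = i \<Longrightarrow> vertex_incl I J 1 = j \<Longrightarrow>
    S_restrict C J I = small_func (flag_pull C 1 ((!) [i, j]))"
  unfolding S_restrict_def
  by (simp, rule arg_cong[where f = small_func], rule flag_pull_cong) (auto simp: le_Suc_eq)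

context flags
begin

section \<open>The groupoids of flags in the universe and their restriction functors\<close>

abbreviation S :: "nat \<Rightarrow> ('o, 'a) flag_atom ucat" where "S n \<equiv> small_cat (flag_grpd C z n)"

text \<open>The length of the flag does not occur: the same functions act on flags of every length
  that has these vertices. The same holds for \<open>T\<close>.\<close>

abbreviation E :: "nat \<Rightarrow> nat \<Rightarrow> ('o, 'a) flag_atom ufunc" where
  "E i j \<equiv> small_func (flag_pull C 1 ((!) [i, j]))"

abbreviation T :: "nat \<Rightarrow> nat \<Rightarrow> nat \<Rightarrow> ('o, 'a) flag_atom ufunc" where
  "T i j k \<equiv> small_func (flag_pull C 2 ((!) [i, j, k]))"

abbreviation edge_Ar :: "nat \<Rightarrow> nat \<Rightarrow> ('o, 'a) transf \<Rightarrow> ('o, 'a) transf" where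
  "edge_Ar i j \<equiv> on_Ar (flag_pull C 1 ((!) [i, j]))"

lemma groupoid_S: "groupoid (S n)" "category (S n)"
  using groupoid_small[OF groupoid_flag_grpd] by (auto intro: groupoid.axioms(1))

lemma functor_E: "i \<le> j \<Longrightarrow> j \<le> n \<Longrightarrow> is_functor (S n) (S 1) (E i j)"
  by (intro is_functor_small is_functor_flag_pull monotone_nth2 groupoid.axioms(1)[OF groupoid_flag_grpd])

lemma functor_T: "i \<le> j \<Longrightarrow> j \<le> k \<Longrightarrow> k \<le> n \<Longrightarrow> is_functor (S n) (S 2) (T i j k)"
  by (intro is_functor_small is_functor_flag_pull monotone_nth3 groupoid.axioms(1)[OF groupoid_flag_grpd])

lemma mult_span_eq:
  "mult_span C z = \<lparr>apex = S 2, lleg = pair_func (E 0 1) (E 1 2), rleg = E 0 2\<rparr>"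
proof -
  have "card {0, 1, 2::nat} - 1 = 2" "card {0, 1::nat} = 2" "card {1, 2::nat} = 2" "card {0, 2::nat} = 2" by simp_all
  then show ?thesis
    unfolding mult_span_def S_on_def
    by (simp only: S_restrict_edge vertex_incl_012)
qed

lemma is_span_mult: "is_span (prod_grpd (S 1) (S 1)) (S 1) (mult_span C z)"
  by (simp add: is_span_def mult_span_eq groupoid_S functor_E is_functor_pair del: One_nat_def)

text \<open>A 1-flag is its single entry off the diagonal. Hence comparing legs, which are edges of
  flags, amounts to comparing objects of the category, and the comparison functors commute
  strictly.\<close>

lemma flag1_eqI:
  assumes "is_flag C z 1 a" "is_flag C z 1 b" "vert a 0 1 = vert b 0 1"
  shows "a = b"
  by (rule flag_eqI[OF assms(1,2)]) (use assms(3) in \<open>auto simp: le_Suc_eq\<close>)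

lemma flag1_hom_eqI:
  assumes "t \<in> hom (flag_grpd C z 1) a b" "t' \<in> hom (flag_grpd C z 1) a b" "component t 0 1 = component t' 0 1"
  shows "t = t'"
  by (rule flag_hom_eqI[OF flag_grpd_homD(1)[OF assms(1)] flag_grpd_homD(1)[OF assms(2)]])
    (use assms(3) in \<open>auto simp: le_Suc_eq\<close>)

lemma edge_flag: "is_flag C z n D \<Longrightarrow> i \<le> j \<Longrightarrow> j \<le> n \<Longrightarrow> is_flag C z 1 (edge i j D)"
  by (rule is_flag_pull[OF _ monotone_nth2])

lemma edge_Ar_hom: "t \<in> hom (flag_grpd C z n) D D' \<Longrightarrow> i \<le> j \<Longrightarrow> j \<le> n \<Longrightarrow>
    edge_Ar i j t \<in> hom (flag_grpd C z 1) (edge i j D) (edge i j D')"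
  using functor_hom[OF is_functor_flag_pull[OF monotone_nth2]] by simp

lemma triangle_flag: "is_flag C z n D \<Longrightarrow> i \<le> j \<Longrightarrow> j \<le> k \<Longrightarrow> k \<le> n \<Longrightarrow> is_flag C z 2 (triangle i j k D)"
  by (rule is_flag_pull[OF _ monotone_nth3])

lemma triangle_Ar_hom: "t \<in> hom (flag_grpd C z n) D D' \<Longrightarrow> i \<le> j \<Longrightarrow> j \<le> k \<Longrightarrow> k \<le> n \<Longrightarrow>
    triangle_Ar i j k t \<in> hom (flag_grpd C z 2) (triangle i j k D) (triangle i j k D')"
  using functor_hom[OF is_functor_flag_pull[OF monotone_nth3]] by simp

lemma edge_eqI:
  assumes "is_flag C z n D" "i \<le> j" "j \<le> n" "is_flag C z 1 a" "vert D i j = vert a 0 1"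
  shows "edge i j D = a"
  using assms by (intro flag1_eqI edge_flag) auto

lemma edge_Ar_eqI:
  assumes "t \<in> hom (flag_grpd C z n) D D'" "i \<le> j" "j \<le> n"
    "s \<in> hom (flag_grpd C z 1) (edge i j D) (edge i j D')" "component t i j = component s 0 1"
  shows "edge_Ar i j t = s"
  using assms by (intro flag1_hom_eqI[OF edge_Ar_hom[OF assms(1-3)]]) auto

lemma edge_triangle:
  assumes "is_flag C z n D" "i \<le> j" "j \<le> k" "k \<le> n"
  shows "edge 0 1 (triangle i j k D) = edge i j D" "edge 0 2 (triangle i j k D) = edge i k D"
    "edge 1 2 (triangle i j k D) = edge j k D"
  using assms edge_flag[OF assms(1), of i j] edge_flag[OF assms(1), of i k] edge_flag[OF assms(1), of j k]
  by (intro edge_eqI[OF triangle_flag[OF assms]]; simp)+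

lemma edge_Ar_triangle_Ar:
  assumes t: "t \<in> hom (flag_grpd C z n) D D'" and le: "i \<le> j" "j \<le> k" "k \<le> n"
  shows "edge_Ar 0 1 (triangle_Ar i j k t) = edge_Ar i j t" "edge_Ar 0 2 (triangle_Ar i j k t) = edge_Ar i k t"
    "edge_Ar 1 2 (triangle_Ar i j k t) = edge_Ar j k t"
proof -
  note e = edge_triangle[OF flag_grpd_homD(2)[OF t] le] edge_triangle[OF flag_grpd_homD(3)[OF t] le]
  show "edge_Ar 0 1 (triangle_Ar i j k t) = edge_Ar i j t"
    by (rule edge_Ar_eqI[OF triangle_Ar_hom[OF t le]]) (use edge_Ar_hom[OF t, of i j] le e in auto)
  show "edge_Ar 0 2 (triangle_Ar i j k t) = edge_Ar i k t"
    by (rule edge_Ar_eqI[OF triangle_Ar_hom[OF t le]]) (use edge_Ar_hom[OF t, of i k] le e in auto)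
  show "edge_Ar 1 2 (triangle_Ar i j k t) = edge_Ar j k t"
    by (rule edge_Ar_eqI[OF triangle_Ar_hom[OF t le]]) (use edge_Ar_hom[OF t, of j k] le e in auto)
qed

section \<open>Associativity\<close>

definition triple_span :: "('o, 'a) flag_atom span" where
  "triple_span = \<lparr>apex = S 3, lleg = pair_func (pair_func (E 0 1) (E 1 2)) (E 2 3), rleg = E 0 3\<rparr>"

lemma is_span_triple: "is_span (prod_grpd (prod_grpd (S 1) (S 1)) (S 1)) (S 1) triple_span"
  by (simp add: is_span_def triple_span_def groupoid_S functor_E is_functor_pair del: One_nat_def)

lemma S1_comp_hom:
  "f \<in> hom (flag_grpd C z n) a b \<Longrightarrow> g \<in> hom (flag_grpd C z n) b c \<Longrightarrow>
    g \<cdot>\<^bsub>flag_cat C z n\<^esub> f \<in> hom (flag_grpd C z n) a c"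
  using category.comp_hom[OF groupoid.axioms(1)[OF groupoid_flag_grpd]] by simp

lemma flag_grpd_Idt_hom: "is_flag C z n a \<Longrightarrow> Idt (flag_cat C z n) a \<in> hom (flag_grpd C z n) a a"
  using category.id_hom[OF groupoid.axioms(1)[OF groupoid_flag_grpd]] by simp

text \<open>The cone sends a 3-flag to the triangle 012 with the edge 23, and to the triangle 023.
  The two sides agree over the edges 02 and 23.\<close>

lemma assoc_left:
  "span_equiv (prod_grpd (prod_grpd (S 1) (S 1)) (S 1)) (S 1) triple_span
    (span_comp (prod_grpd (S 1) (S 1)) (mult_span C z) (span_prod (mult_span C z) (func_span (S 1) id_func)))"
proof (rule span_equiv_comp_strict[where P = "pair_func (T 0 1 2) (E 2 3)" and Q = "T 0 2 3"])
  note [simp del] = One_nat_def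
  let ?P = "pair_func (T 0 1 2) (E 2 3) :: ('o, 'a) flag_atom ufunc" and ?Q = "T 0 2 3 :: ('o, 'a) flag_atom ufunc" and ?\<mu> = "mult_span C z"
  let ?R = triple_span
  let ?\<mu>1 = "span_prod ?\<mu> (func_span (S 1) id_func)"
  show "groupoid (prod_grpd (prod_grpd (S 1) (S 1)) (S 1))" "groupoid (prod_grpd (S 1) (S 1))" "groupoid (S 1)"
    by (intro groupoid_prod groupoid_S)+
  show "is_span (prod_grpd (prod_grpd (S 1) (S 1)) (S 1)) (prod_grpd (S 1) (S 1)) ?\<mu>1"
    by (intro is_span_prod is_span_mult is_span_func groupoid_S is_functor_id)
  show "is_span (prod_grpd (S 1) (S 1)) (S 1) ?\<mu>" by (rule is_span_mult)
  show "is_span (prod_grpd (prod_grpd (S 1) (S 1)) (S 1)) (S 1) ?R" by (rule is_span_triple)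
  show "is_functor (apex ?R) (apex ?\<mu>1) ?P"
    by (simp add: triple_span_def mult_span_eq is_functor_pair groupoid_S functor_E functor_T)
  show "is_functor (apex ?R) (apex ?\<mu>) ?Q"
    by (simp add: triple_span_def mult_span_eq functor_T)
  show "on_Ob (lleg ?\<mu>1) (on_Ob ?P u) = on_Ob (lleg ?R) u"
    "on_Ob (rleg ?\<mu>) (on_Ob ?Q u) = on_Ob (rleg ?R) u"
    "on_Ob (lleg ?\<mu>) (on_Ob ?Q u) = on_Ob (rleg ?\<mu>1) (on_Ob ?P u)"
    if "u \<in> Ob (apex ?R)" for u
    using that by (auto simp: triple_span_def mult_span_eq edge_triangle elim!: small_ObE)
  show "on_Ar (lleg ?\<mu>1) (on_Ar ?P h) = on_Ar (lleg ?R) h"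
    "on_Ar (rleg ?\<mu>) (on_Ar ?Q h) = on_Ar (rleg ?R) h"
    "on_Ar (lleg ?\<mu>) (on_Ar ?Q h) = on_Ar (rleg ?\<mu>1) (on_Ar ?P h)"
    if "h \<in> hom (apex ?R) u v" for u v h
    using that by (auto simp: triple_span_def mult_span_eq edge_Ar_triangle_Ar elim!: small_homE)
  show "\<exists>h. h \<in> hom (apex ?R) u v \<and> on_Ar ?P h = f \<and> on_Ar ?Q h = g"
    if u: "u \<in> Ob (apex ?R)" and v: "v \<in> Ob (apex ?R)"
      and f: "f \<in> hom (apex ?\<mu>1) (on_Ob ?P u) (on_Ob ?P v)"
      and g: "g \<in> hom (apex ?\<mu>) (on_Ob ?Q u) (on_Ob ?Q v)"
      and eq: "on_Ar (lleg ?\<mu>) g = on_Ar (rleg ?\<mu>1) f" for u v f g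
  proof -
    obtain D D' where D: "u = obj D" "is_flag C z 3 D" "v = obj D'" "is_flag C z 3 D'"
      using u v by (auto simp: triple_span_def elim!: small_ObE)
    obtain f1 f2 where f: "f = Tup (arr f1) (arr f2)"
      "f1 \<in> hom (flag_grpd C z 2) (triangle 0 1 2 D) (triangle 0 1 2 D')"
      using f by (auto simp: mult_span_eq D elim!: prod_homE small_homE)
    obtain g1 where g: "g = arr g1" "g1 \<in> hom (flag_grpd C z 2) (triangle 0 2 3 D) (triangle 0 2 3 D')"
      using g by (auto simp: mult_span_eq D elim!: small_homE)
    have eq1: "edge_Ar 0 1 g1 = edge_Ar 0 2 f1" and eq2: "edge_Ar 1 2 g1 = f2"
      using eq by (auto simp: mult_span_eq f g)
    have "component g1 0 1 = component f1 0 2"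
      using arg_cong[OF eq1, of "\<lambda>t. component t 0 1"] by simp
    then obtain h where h: "h \<in> hom (flag_grpd C z 3) D D'" "triangle_Ar 0 1 2 h = f1" "triangle_Ar 0 2 3 h = g1"
      by (rule glue_pushout_full[OF D(2,4) f(2) g(2)])
    have "edge_Ar 2 3 h = f2"
      using edge_Ar_triangle_Ar(3)[OF h(1), of 0 2 3] h(3) eq2 by simp
    then show ?thesis
      using h by (intro exI[of _ "arr h"]) (simp add: triple_span_def D f g)
  qed
  show "h = h'" if "h \<in> hom (apex ?R) u v" "h' \<in> hom (apex ?R) u v"
    "on_Ar ?P h = on_Ar ?P h'"
    "on_Ar ?Q h = on_Ar ?Q h'" for u v h h'
    using that by (auto simp: triple_span_def elim!: small_homE intro: glue_pushout_faithful)
  show "\<exists>u f g. u \<in> Ob (apex ?R) \<and> f \<in> hom (apex ?\<mu>1) (on_Ob ?P u) x \<and>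
      g \<in> hom (apex ?\<mu>) (on_Ob ?Q u) y \<and>
      on_Ar (lleg ?\<mu>) g = \<phi> \<cdot>\<^bsub>prod_grpd (S 1) (S 1)\<^esub> on_Ar (rleg ?\<mu>1) f"
    if x: "x \<in> Ob (apex ?\<mu>1)" and y: "y \<in> Ob (apex ?\<mu>)"
      and \<phi>: "\<phi> \<in> hom (prod_grpd (S 1) (S 1)) (on_Ob (rleg ?\<mu>1) x) (on_Ob (lleg ?\<mu>) y)" for x y \<phi>
  proof -
    obtain x1 a where x: "x = Tup (obj x1) (obj a)" "is_flag C z 2 x1" "is_flag C z 1 a"
      using x by (auto simp: mult_span_eq elim!: prod_ObE small_ObE)
    obtain y1 where y: "y = obj y1" "is_flag C z 2 y1"
      using y by (auto simp: mult_span_eq elim!: small_ObE)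
    obtain \<phi>1 \<phi>2 where \<phi>: "\<phi> = Tup (arr \<phi>1) (arr \<phi>2)"
      "\<phi>1 \<in> hom (flag_grpd C z 1) (edge 0 2 x1) (edge 0 1 y1)" "\<phi>2 \<in> hom (flag_grpd C z 1) a (edge 1 2 y1)"
      using \<phi> by (auto simp: mult_span_eq x y elim!: prod_homE small_homE)
    have c: "component \<phi>1 0 1 \<in> hom C (vert x1 0 2) (vert y1 0 1)" "is_iso C (component \<phi>1 0 1)"
      using flag_grpd_component[OF \<phi>(2), of 0 1] flag_grpd_iso[OF \<phi>(2), of 0 1] by simp_all
    obtain D g where D: "is_flag C z 3 D" "triangle 0 1 2 D = x1" "vert D 2 3 = vert y1 1 2"
      "g \<in> hom (flag_grpd C z 2) (triangle 0 2 3 D) y1" "component g 0 1 = component \<phi>1 0 1"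
      "component g 1 2 = Idt C (vert y1 1 2)"
      by (rule glue_pushout_exists[OF x(2) y(2) c])
    \<comment> \<open>Gluing takes the last entry from \<open>y1\<close>, and a 1-flag is determined
      by its entry, so the edges are equal and not merely isomorphic.\<close>
    have D23: "edge 2 3 D = edge 1 2 y1"
      by (rule edge_eqI[OF D(1)]) (simp_all add: D(3) edge_flag[OF y(2)])
    have D02: "edge 0 2 D = edge 0 2 x1" using edge_triangle(2)[OF D(1), of 0 1 2] D(2) by simp
    note t = edge_triangle[OF D(1), of 0 2 3, simplified]
    note \<phi>i = category.inv_arr[OF groupoid.axioms(1)[OF groupoid_flag_grpd] groupoid.iso[OF groupoid_flag_grpd \<phi>(3)] \<phi>(3), simplified]
    \<comment> \<open>The last edge of \<open>D\<close> is that of \<open>y1\<close> and not the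
      given \<open>a\<close>, so it is compared with \<open>a\<close> by the inverse of
      \<open>\<phi>2\<close>. The triangle needs only an identity.\<close>
    let ?i = "inv_arr (flag_grpd C z 1) \<phi>2"
    note id = flag_grpd_Idt_hom[OF x(2)]
    note ei = edge_Ar_hom[OF id, of 0 2, simplified]
    have 1: "edge_Ar 0 1 g = \<phi>1 \<cdot>\<^bsub>flag_cat C z 1\<^esub> edge_Ar 0 2 (Idt (flag_cat C z 2) x1)"
    proof (rule edge_Ar_eqI[OF D(4)])
      show "\<phi>1 \<cdot>\<^bsub>flag_cat C z 1\<^esub> edge_Ar 0 2 (Idt (flag_cat C z 2) x1) \<in>
          hom (flag_grpd C z 1) (edge 0 1 (triangle 0 2 3 D)) (edge 0 1 y1)"
        using S1_comp_hom[OF ei \<phi>(2)] by (simp add: t D02)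
      show "component g 0 1 = component (\<phi>1 \<cdot>\<^bsub>flag_cat C z 1\<^esub> edge_Ar 0 2 (Idt (flag_cat C z 2) x1)) 0 1"
        using comp_id[OF c(1)] D(5) by simp
    qed simp_all
    have 2: "edge_Ar 1 2 g = \<phi>2 \<cdot>\<^bsub>flag_cat C z 1\<^esub> ?i"
      unfolding \<phi>i(3)
      by (rule edge_Ar_eqI[OF D(4)]) (use flag_grpd_Idt_hom[OF edge_flag[OF y(2), of 1 2]] in \<open>simp_all add: t D23 D(6)\<close>)
    show ?thesis
      using id \<phi>i(1) D 1 2
      by (intro exI[of _ "obj D"] exI[of _ "Tup (arr (Idt (flag_cat C z 2) x1)) (arr ?i)"] exI[of _ "arr g"])
        (simp add: triple_span_def mult_span_eq x y \<phi>(1) D23)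
  qed
qed

definition assoc_inv :: "'x ufunc" where
  "assoc_inv = pair_func (pair_func fst_func (fst_func \<circ>\<^sub>F snd_func)) (snd_func \<circ>\<^sub>F snd_func)"

lemma assoc_simps [simp]:
  "on_Ob assoc_inv (Tup a (Tup b c)) = Tup (Tup a b) c" "on_Ar assoc_inv (Tup a (Tup b c)) = Tup (Tup a b) c"
  "on_Ob assoc_func (Tup (Tup a b) c) = Tup a (Tup b c)" "on_Ar assoc_func (Tup (Tup a b) c) = Tup a (Tup b c)"
  by (simp_all add: assoc_inv_def assoc_func_def)

lemma is_functor_assoc:
  assumes "groupoid A" "groupoid B" "groupoid D"
  shows "is_functor (prod_grpd (prod_grpd A B) D) (prod_grpd A (prod_grpd B D)) assoc_func"
    "is_functor (prod_grpd A (prod_grpd B D)) (prod_grpd (prod_grpd A B) D) assoc_inv"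
  using assms by (auto intro!: is_functorI groupoid.axioms(1) groupoid_prod elim!: prod_homE prod_ObE)

text \<open>Represents the product of the identity with the multiplication, precomposed with the
  associator. The associator is invertible, so rebracketing the left leg replaces a further
  2-pullback.\<close>

definition mult_right_span :: "('o, 'a) flag_atom span" where
  "mult_right_span = \<lparr>apex = prod_grpd (S 1) (S 2),
    lleg = assoc_inv \<circ>\<^sub>F prod_func id_func (pair_func (E 0 1) (E 1 2)), rleg = prod_func id_func (E 0 2)\<rparr>"

lemma mult_right_span_eq:
  "mult_right_span = \<lparr>apex = apex (span_prod (func_span (S 1) id_func) (mult_span C z)),
    lleg = assoc_inv \<circ>\<^sub>F lleg (span_prod (func_span (S 1) id_func) (mult_span C z)),
    rleg = rleg (span_prod (func_span (S 1) id_func) (mult_span C z))\<rparr>"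
  by (simp add: mult_right_span_def mult_span_eq)

lemma is_span_id_mult:
  "is_span (prod_grpd (S 1) (prod_grpd (S 1) (S 1))) (prod_grpd (S 1) (S 1)) (span_prod (func_span (S 1) id_func) (mult_span C z))"
  by (intro is_span_prod is_span_mult is_span_func groupoid_S is_functor_id)

lemma is_span_mult_right: "is_span (prod_grpd (prod_grpd (S 1) (S 1)) (S 1)) (prod_grpd (S 1) (S 1)) mult_right_span"
  unfolding mult_right_span_eq
  using is_spanD[OF is_span_id_mult] is_functor_comp[OF is_spanD(2,3)[OF is_span_id_mult] is_functor_assoc(2)[OF groupoid_S(1) groupoid_S(1) groupoid_S(1)]]
  by (simp add: is_span_def)

lemma mult_right_equiv:
  "span_equiv (prod_grpd (prod_grpd (S 1) (S 1)) (S 1)) (prod_grpd (S 1) (S 1)) mult_right_span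
    (span_comp (prod_grpd (S 1) (prod_grpd (S 1) (S 1))) (span_prod (func_span (S 1) id_func) (mult_span C z))
      (func_span (prod_grpd (prod_grpd (S 1) (S 1)) (S 1)) assoc_func))"
  unfolding mult_right_span_eq
  by (rule span_equiv_comp_func_span[OF _ _ _ is_functor_assoc _ _ _ _ is_span_id_mult])
    (auto intro!: groupoid_prod groupoid_S elim!: prod_ObE prod_homE)

text \<open>Here the cone consists of the edge 01 with the triangle 123, and of the triangle 013.
  The two sides agree over the edges 01 and 13.\<close>

lemma assoc_right:
  "span_equiv (prod_grpd (prod_grpd (S 1) (S 1)) (S 1)) (S 1) triple_span
    (span_comp (prod_grpd (S 1) (S 1)) (mult_span C z) mult_right_span)"
proof (rule span_equiv_comp_strict[where P = "pair_func (E 0 1) (T 1 2 3)" and Q = "T 0 1 3"])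
  note [simp del] = One_nat_def
  let ?P = "pair_func (E 0 1) (T 1 2 3) :: ('o, 'a) flag_atom ufunc" and ?Q = "T 0 1 3 :: ('o, 'a) flag_atom ufunc" and ?\<mu> = "mult_span C z"
  let ?R = triple_span
  let ?\<mu>1 = mult_right_span
  show "groupoid (prod_grpd (prod_grpd (S 1) (S 1)) (S 1))" "groupoid (prod_grpd (S 1) (S 1))" "groupoid (S 1)"
    by (intro groupoid_prod groupoid_S)+
  show "is_span (prod_grpd (prod_grpd (S 1) (S 1)) (S 1)) (prod_grpd (S 1) (S 1)) ?\<mu>1"
    by (rule is_span_mult_right)
  show "is_span (prod_grpd (S 1) (S 1)) (S 1) ?\<mu>" by (rule is_span_mult)
  show "is_span (prod_grpd (prod_grpd (S 1) (S 1)) (S 1)) (S 1) ?R" by (rule is_span_triple)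
  show "is_functor (apex ?R) (apex ?\<mu>1) ?P"
    by (simp add: triple_span_def mult_right_span_def is_functor_pair groupoid_S functor_E functor_T)
  show "is_functor (apex ?R) (apex ?\<mu>) ?Q"
    by (simp add: triple_span_def mult_span_eq functor_T)
  show "on_Ob (lleg ?\<mu>1) (on_Ob ?P u) = on_Ob (lleg ?R) u"
    "on_Ob (rleg ?\<mu>) (on_Ob ?Q u) = on_Ob (rleg ?R) u"
    "on_Ob (lleg ?\<mu>) (on_Ob ?Q u) = on_Ob (rleg ?\<mu>1) (on_Ob ?P u)"
    if "u \<in> Ob (apex ?R)" for u
    using that by (auto simp: triple_span_def mult_span_eq mult_right_span_def edge_triangle elim!: small_ObE)
  show "on_Ar (lleg ?\<mu>1) (on_Ar ?P h) = on_Ar (lleg ?R) h"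
    "on_Ar (rleg ?\<mu>) (on_Ar ?Q h) = on_Ar (rleg ?R) h"
    "on_Ar (lleg ?\<mu>) (on_Ar ?Q h) = on_Ar (rleg ?\<mu>1) (on_Ar ?P h)"
    if "h \<in> hom (apex ?R) u v" for u v h
    using that by (auto simp: triple_span_def mult_span_eq mult_right_span_def edge_Ar_triangle_Ar elim!: small_homE)
  show "\<exists>h. h \<in> hom (apex ?R) u v \<and> on_Ar ?P h = f \<and> on_Ar ?Q h = g"
    if u: "u \<in> Ob (apex ?R)" and v: "v \<in> Ob (apex ?R)"
      and f: "f \<in> hom (apex ?\<mu>1) (on_Ob ?P u) (on_Ob ?P v)"
      and g: "g \<in> hom (apex ?\<mu>) (on_Ob ?Q u) (on_Ob ?Q v)"
      and eq: "on_Ar (lleg ?\<mu>) g = on_Ar (rleg ?\<mu>1) f" for u v f g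
  proof -
    obtain D D' where D: "u = obj D" "is_flag C z 3 D" "v = obj D'" "is_flag C z 3 D'"
      using u v by (auto simp: triple_span_def elim!: small_ObE)
    obtain f1 f2 where f: "f = Tup (arr f2) (arr f1)"
      "f1 \<in> hom (flag_grpd C z 2) (triangle 1 2 3 D) (triangle 1 2 3 D')"
      using f by (auto simp: mult_right_span_def D elim!: prod_homE small_homE)
    obtain g1 where g: "g = arr g1" "g1 \<in> hom (flag_grpd C z 2) (triangle 0 1 3 D) (triangle 0 1 3 D')"
      using g by (auto simp: mult_span_eq D elim!: small_homE)
    have eq1: "edge_Ar 1 2 g1 = edge_Ar 0 2 f1" and eq2: "edge_Ar 0 1 g1 = f2"
      using eq by (auto simp: mult_span_eq mult_right_span_def f g)
    have "component g1 1 2 = component f1 0 2"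
      using arg_cong[OF eq1, of "\<lambda>t. component t 0 1"] by simp
    then obtain h where h: "h \<in> hom (flag_grpd C z 3) D D'" "triangle_Ar 1 2 3 h = f1" "triangle_Ar 0 1 3 h = g1"
      by (rule glue_pullback_full[OF D(2,4) f(2) g(2)])
    have "edge_Ar 0 1 h = f2"
      using edge_Ar_triangle_Ar(1)[OF h(1), of 0 1 3] h(3) eq2 by simp
    then show ?thesis
      using h by (intro exI[of _ "arr h"]) (simp add: triple_span_def D f g)
  qed
  show "h = h'" if "h \<in> hom (apex ?R) u v" "h' \<in> hom (apex ?R) u v"
    "on_Ar ?P h = on_Ar ?P h'"
    "on_Ar ?Q h = on_Ar ?Q h'" for u v h h'
    using that by (auto simp: triple_span_def elim!: small_homE intro: glue_pullback_faithful)
  show "\<exists>u f g. u \<in> Ob (apex ?R) \<and> f \<in> hom (apex ?\<mu>1) (on_Ob ?P u) x \<and>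
      g \<in> hom (apex ?\<mu>) (on_Ob ?Q u) y \<and>
      on_Ar (lleg ?\<mu>) g = \<phi> \<cdot>\<^bsub>prod_grpd (S 1) (S 1)\<^esub> on_Ar (rleg ?\<mu>1) f"
    if x: "x \<in> Ob (apex ?\<mu>1)" and y: "y \<in> Ob (apex ?\<mu>)"
      and \<phi>: "\<phi> \<in> hom (prod_grpd (S 1) (S 1)) (on_Ob (rleg ?\<mu>1) x) (on_Ob (lleg ?\<mu>) y)" for x y \<phi>
  proof -
    obtain x1 a where x: "x = Tup (obj a) (obj x1)" "is_flag C z 2 x1" "is_flag C z 1 a"
      using x by (auto simp: mult_right_span_def elim!: prod_ObE small_ObE)
    obtain y1 where y: "y = obj y1" "is_flag C z 2 y1"
      using y by (auto simp: mult_span_eq elim!: small_ObE)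
    obtain \<phi>1 \<phi>2 where \<phi>: "\<phi> = Tup (arr \<phi>2) (arr \<phi>1)"
      "\<phi>1 \<in> hom (flag_grpd C z 1) (edge 0 2 x1) (edge 1 2 y1)" "\<phi>2 \<in> hom (flag_grpd C z 1) a (edge 0 1 y1)"
      using \<phi> by (auto simp: mult_span_eq mult_right_span_def x y elim!: prod_homE small_homE)
    have c: "component \<phi>1 0 1 \<in> hom C (vert x1 0 2) (vert y1 1 2)" "is_iso C (component \<phi>1 0 1)"
      using flag_grpd_component[OF \<phi>(2), of 0 1] flag_grpd_iso[OF \<phi>(2), of 0 1] by simp_all
    obtain D g where D: "is_flag C z 3 D" "triangle 1 2 3 D = x1" "vert D 0 1 = vert y1 0 1"
      "g \<in> hom (flag_grpd C z 2) (triangle 0 1 3 D) y1" "component g 0 1 = Idt C (vert y1 0 1)"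
      "component g 1 2 = component \<phi>1 0 1"
      by (rule glue_pullback_exists[OF x(2) y(2) c])
    have D01: "edge 0 1 D = edge 0 1 y1"
      by (rule edge_eqI[OF D(1)]) (simp_all add: D(3) edge_flag[OF y(2)])
    have D13: "edge 1 3 D = edge 0 2 x1" using edge_triangle(2)[OF D(1), of 1 2 3] D(2) by simp
    note t = edge_triangle[OF D(1), of 0 1 3, simplified]
    note \<phi>i = category.inv_arr[OF groupoid.axioms(1)[OF groupoid_flag_grpd] groupoid.iso[OF groupoid_flag_grpd \<phi>(3)] \<phi>(3), simplified]
    let ?i = "inv_arr (flag_grpd C z 1) \<phi>2"
    note id = flag_grpd_Idt_hom[OF x(2)]
    note ei = edge_Ar_hom[OF id, of 0 2, simplified]
    have 1: "edge_Ar 1 2 g = \<phi>1 \<cdot>\<^bsub>flag_cat C z 1\<^esub> edge_Ar 0 2 (Idt (flag_cat C z 2) x1)"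
    proof (rule edge_Ar_eqI[OF D(4)])
      show "\<phi>1 \<cdot>\<^bsub>flag_cat C z 1\<^esub> edge_Ar 0 2 (Idt (flag_cat C z 2) x1) \<in>
          hom (flag_grpd C z 1) (edge 1 2 (triangle 0 1 3 D)) (edge 1 2 y1)"
        using S1_comp_hom[OF ei \<phi>(2)] by (simp add: t D13)
      show "component g 1 2 = component (\<phi>1 \<cdot>\<^bsub>flag_cat C z 1\<^esub> edge_Ar 0 2 (Idt (flag_cat C z 2) x1)) 0 1"
        using comp_id[OF c(1)] D(6) by simp
    qed simp_all
    have 2: "edge_Ar 0 1 g = \<phi>2 \<cdot>\<^bsub>flag_cat C z 1\<^esub> ?i"
      unfolding \<phi>i(3)
      by (rule edge_Ar_eqI[OF D(4)]) (use flag_grpd_Idt_hom[OF edge_flag[OF y(2), of 0 1]] in \<open>simp_all add: t D01 D(5)\<close>)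
    show ?thesis
      using id \<phi>i(1) D 1 2
      by (intro exI[of _ "obj D"] exI[of _ "Tup (arr ?i) (arr (Idt (flag_cat C z 2) x1))"] exI[of _ "arr g"])
        (simp add: triple_span_def mult_span_eq mult_right_span_def x y \<phi>(1) D01)
  qed
qed


section \<open>Unit laws\<close>

definition flag0 :: "('o, 'a) diagram" where "flag0 = (SOME D. is_flag C z 0 D)"

lemma is_flag0: "is_flag C z 0 flag0"
proof -
  obtain D where "is_flag C z 0 D"
    by (rule flag_exists[of 0 "\<lambda>_ _. z" "\<lambda>_ _. zero_in z" "\<lambda>_ _. zero_out z"]) auto
  then show ?thesis unfolding flag0_def by (rule someI)
qed

lemma flag0_unique: "is_flag C z 0 D \<Longrightarrow> D = flag0"
  by (rule flag_eqI[OF _ is_flag0]) auto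

lemma flag0_hom_unique:
  assumes "t \<in> hom (flag_grpd C z 0) D D'" "t' \<in> hom (flag_grpd C z 0) D D'"
  shows "t = t'"
  by (rule flag_hom_eqI[OF flag_grpd_homD(1)[OF assms(1)] flag_grpd_homD(1)[OF assms(2)]]) auto

abbreviation zero_edge :: "('o, 'a) diagram \<Rightarrow> ('o, 'a) diagram" where
  "zero_edge \<equiv> diagram_pull C 1 (\<lambda>_. 0)"

abbreviation zero_edge_Ar :: "('o, 'a) transf \<Rightarrow> ('o, 'a) transf" where
  "zero_edge_Ar \<equiv> on_Ar (flag_pull C 1 (\<lambda>_. 0))"

lemma is_functor_degeneracy: "is_functor (flag_grpd C z 0) (flag_grpd C z 1) (flag_pull C 1 (\<lambda>_. 0))"
  by (rule is_functor_flag_pull) (simp add: monotone_map_def)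

lemma zero_edge_flag0: "is_flag C z 1 (zero_edge flag0)" "vert (zero_edge flag0) 0 1 = z"
  using functor_Ob[OF is_functor_degeneracy, of flag0] is_flag0 flag_diag[OF is_flag0, of 0] by simp_all

text \<open>Inserts the only object of the groupoid of 0-flags, identifying the monoidal unit with
  the apex of \<open>unit_span\<close>.\<close>

definition const_func :: "('o, 'a) flag_atom ufunc" where
  "const_func = \<lparr>on_Ob = (\<lambda>_. obj flag0), on_Ar = (\<lambda>_. arr (Idt (flag_cat C z 0) flag0))\<rparr>"

lemma const_func_simps [simp]:
  "on_Ob const_func u = obj flag0" "on_Ar const_func h = arr (Idt (flag_cat C z 0) flag0)"
  by (simp_all add: const_func_def)

lemma is_functor_const: "is_functor unit_grpd (S 0) const_func"
proof (rule is_functorI)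
  show "category unit_grpd" by (rule groupoid.axioms(1)[OF groupoid_unit])
  have i: "Idt (flag_cat C z 0) flag0 \<in> hom (flag_grpd C z 0) flag0 flag0"
    by (rule flag_grpd_Idt_hom[OF is_flag0])
  fix a b c f g
  show "on_Ob const_func a \<in> Ob (S 0)" "on_Ar const_func f \<in> hom (S 0) (on_Ob const_func a) (on_Ob const_func b)"
    "on_Ar const_func (Idt unit_grpd a) = Idt (S 0) (on_Ob const_func a)"
    using i is_flag0 by simp_all
  show "on_Ar const_func (g \<cdot>\<^bsub>unit_grpd\<^esub> f) = on_Ar const_func g \<cdot>\<^bsub>S 0\<^esub> on_Ar const_func f"
    using flag0_hom_unique[OF i S1_comp_hom[OF i i]] by simp
qed

lemma is_span_unit: "is_span unit_grpd (S 1) (unit_span C z)"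
  unfolding is_span_def unit_span_def
  using groupoid_S is_functor_to_unit[OF groupoid_S(2)[of 0]]
    is_functor_small[OF groupoid.axioms(1)[OF groupoid_flag_grpd] is_functor_degeneracy]
  by simp

lemma edge_degenerate:
  assumes "is_flag C z 1 a"
  shows "edge 0 1 (triangle 0 0 1 a) = zero_edge flag0" "edge 1 2 (triangle 0 1 1 a) = zero_edge flag0"
    "edge 0 2 (triangle 0 0 1 a) = a" "edge 1 2 (triangle 0 0 1 a) = a"
    "edge 0 1 (triangle 0 1 1 a) = a" "edge 0 2 (triangle 0 1 1 a) = a"
proof -
  note z = zero_edge_flag0 flag_diag[OF assms]
  show "edge 0 1 (triangle 0 0 1 a) = zero_edge flag0"
    by (rule edge_eqI[OF triangle_flag[OF assms]]) (use z in auto)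
  show "edge 1 2 (triangle 0 1 1 a) = zero_edge flag0"
    by (rule edge_eqI[OF triangle_flag[OF assms]]) (use z in auto)
  show "edge 0 2 (triangle 0 0 1 a) = a" "edge 1 2 (triangle 0 0 1 a) = a"
    by (rule edge_eqI[OF triangle_flag[OF assms]]; use assms in simp)+
  show "edge 0 1 (triangle 0 1 1 a) = a" "edge 0 2 (triangle 0 1 1 a) = a"
    by (rule edge_eqI[OF triangle_flag[OF assms]]; use assms in simp)+
qed

lemma edge_Ar_degenerate:
  assumes t: "t \<in> hom (flag_grpd C z 1) a b"
  shows "edge_Ar 0 1 (triangle_Ar 0 0 1 t) = zero_edge_Ar (Idt (flag_cat C z 0) flag0)"
    "edge_Ar 1 2 (triangle_Ar 0 1 1 t) = zero_edge_Ar (Idt (flag_cat C z 0) flag0)"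
    "edge_Ar 0 2 (triangle_Ar 0 0 1 t) = t" "edge_Ar 1 2 (triangle_Ar 0 0 1 t) = t"
    "edge_Ar 0 1 (triangle_Ar 0 1 1 t) = t" "edge_Ar 0 2 (triangle_Ar 0 1 1 t) = t"
proof -
  note a = flag_grpd_homD(2)[OF t] and b = flag_grpd_homD(3)[OF t]
  note e = edge_degenerate[OF a] edge_degenerate[OF b]
  \<comment> \<open>The diagonal components are endomorphisms of \<open>z\<close>, hence
    identities.\<close>
  have c: "component t 0 0 = Idt C (vert flag0 0 0)" "component t 1 1 = Idt C (vert flag0 0 0)"
    using flag_grpd_component[OF t, of 0 0] flag_grpd_component[OF t, of 1 1]
      flag_diag[OF a, of 0] flag_diag[OF b, of 0] flag_diag[OF a, of 1] flag_diag[OF b, of 1]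
      flag_diag[OF is_flag0, of 0] id_hom[OF zero_Ob] from_zero by auto
  have i: "zero_edge_Ar (Idt (flag_cat C z 0) flag0) \<in> hom (flag_grpd C z 1) (zero_edge flag0) (zero_edge flag0)"
    using functor_hom[OF is_functor_degeneracy flag_grpd_Idt_hom[OF is_flag0]] by simp
  note l = triangle_Ar_hom[OF t, of 0 0 1] and r = triangle_Ar_hom[OF t, of 0 1 1]
  show "edge_Ar 0 1 (triangle_Ar 0 0 1 t) = zero_edge_Ar (Idt (flag_cat C z 0) flag0)"
    by (rule edge_Ar_eqI[OF l]; (unfold e)?; use i c in simp)
  show "edge_Ar 1 2 (triangle_Ar 0 1 1 t) = zero_edge_Ar (Idt (flag_cat C z 0) flag0)"
    by (rule edge_Ar_eqI[OF r]; (unfold e)?; use i c in simp)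
  show "edge_Ar 0 2 (triangle_Ar 0 0 1 t) = t" "edge_Ar 1 2 (triangle_Ar 0 0 1 t) = t"
    by (rule edge_Ar_eqI[OF l]; (unfold e)?; use t in simp)+
  show "edge_Ar 0 1 (triangle_Ar 0 1 1 t) = t" "edge_Ar 0 2 (triangle_Ar 0 1 1 t) = t"
    by (rule edge_Ar_eqI[OF r]; (unfold e)?; use t in simp)+
qed

text \<open>An object \<open>a\<close> is compared with the 0-flag paired with \<open>a\<close> and
  with the triangle 001 of \<open>a\<close>. Essential surjectivity is the fact that a short exact
  sequence with zero subobject is isomorphic to such a triangle.\<close>

lemma unit_left:
  "span_equiv (prod_grpd unit_grpd (S 1)) (S 1) (func_span (prod_grpd unit_grpd (S 1)) snd_func)
    (span_comp (prod_grpd (S 1) (S 1)) (mult_span C z) (span_prod (unit_span C z) (func_span (S 1) id_func)))"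
proof (rule span_equiv_comp_strict[where P = "prod_func const_func id_func" and Q = "T 0 0 1 \<circ>\<^sub>F snd_func"])
  note [simp del] = One_nat_def
  let ?P = "prod_func const_func id_func :: ('o, 'a) flag_atom ufunc" and ?Q = "T 0 0 1 \<circ>\<^sub>F snd_func :: ('o, 'a) flag_atom ufunc" and ?\<mu> = "mult_span C z"
  let ?e1 = "span_prod (unit_span C z) (func_span (S 1) id_func)"
  let ?R = "func_span (prod_grpd unit_grpd (S 1)) snd_func :: ('o, 'a) flag_atom span"
  have gr: "groupoid (prod_grpd unit_grpd (S 1))" by (intro groupoid_prod groupoid_S groupoid_unit)
  show "groupoid (prod_grpd unit_grpd (S 1))" "groupoid (prod_grpd (S 1) (S 1))" "groupoid (S 1)"
    by (intro groupoid_prod groupoid_S groupoid_unit)+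
  show "is_span (prod_grpd unit_grpd (S 1)) (prod_grpd (S 1) (S 1)) ?e1"
    by (intro is_span_prod is_span_unit is_span_func groupoid_S is_functor_id)
  show "is_span (prod_grpd (S 1) (S 1)) (S 1) ?\<mu>" by (rule is_span_mult)
  show "is_span (prod_grpd unit_grpd (S 1)) (S 1) ?R"
    by (intro is_span_func gr is_functor_snd groupoid_S groupoid_unit)
  show "is_functor (apex ?R) (apex ?e1) ?P"
    using is_functor_prod[OF groupoid_unit groupoid_S(1) is_functor_const is_functor_id[OF groupoid_S(2)]]
    by (simp add: unit_span_def)
  show "is_functor (apex ?R) (apex ?\<mu>) ?Q"
    using is_functor_comp[OF groupoid.axioms(1)[OF gr] is_functor_snd[OF groupoid_unit groupoid_S(1)] functor_T]
    by (simp add: mult_span_eq)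
  show "on_Ob (lleg ?e1) (on_Ob ?P u) = on_Ob (lleg ?R) u"
    "on_Ob (rleg ?\<mu>) (on_Ob ?Q u) = on_Ob (rleg ?R) u"
    "on_Ob (lleg ?\<mu>) (on_Ob ?Q u) =
      on_Ob (rleg ?e1) (on_Ob ?P u)"
    if "u \<in> Ob (apex ?R)" for u
    using that by (auto simp: unit_span_def mult_span_eq edge_degenerate elim!: prod_ObE small_ObE)
  show "on_Ar (lleg ?e1) (on_Ar ?P h) = on_Ar (lleg ?R) h"
    "on_Ar (rleg ?\<mu>) (on_Ar ?Q h) = on_Ar (rleg ?R) h"
    "on_Ar (lleg ?\<mu>) (on_Ar ?Q h) =
      on_Ar (rleg ?e1) (on_Ar ?P h)"
    if "h \<in> hom (apex ?R) u v" for u v h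
    using that by (auto simp: unit_span_def mult_span_eq edge_Ar_degenerate elim!: prod_homE small_homE)
  show "\<exists>h. h \<in> hom (apex ?R) u v \<and> on_Ar ?P h = f \<and> on_Ar ?Q h = g"
    if u: "u \<in> Ob (apex ?R)" and v: "v \<in> Ob (apex ?R)"
      and f: "f \<in> hom (apex ?e1) (on_Ob ?P u) (on_Ob ?P v)"
      and g: "g \<in> hom (apex ?\<mu>) (on_Ob ?Q u) (on_Ob ?Q v)"
      and eq: "on_Ar (lleg ?\<mu>) g = on_Ar (rleg ?e1) f" for u v f g
  proof -
    obtain a b where a: "u = Tup Star (obj a)" "v = Tup Star (obj b)"
      using u v by (auto elim!: prod_ObE small_ObE)
    obtain f1 f2 where f: "f = Tup (arr f1) (arr f2)" "f1 \<in> hom (flag_grpd C z 0) flag0 flag0"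
      "f2 \<in> hom (flag_grpd C z 1) a b"
      using f by (auto simp: unit_span_def a elim!: prod_homE small_homE)
    obtain g1 where g: "g = arr g1" "g1 \<in> hom (flag_grpd C z 2) (triangle 0 0 1 a) (triangle 0 0 1 b)"
      using g by (auto simp: mult_span_eq a elim!: small_homE)
    have eq2: "edge_Ar 1 2 g1 = f2"
      using eq by (auto simp: mult_span_eq unit_span_def f g)
    have "component g1 1 2 = component f2 0 1"
      using arg_cong[OF eq2, of "\<lambda>t. component t 0 1"] by simp
    then have "triangle_Ar 0 0 1 f2 = g1" by (rule degenerate_left_full[OF f(3) g(2)])
    \<comment> \<open>0-flags have no entries off the diagonal, so this factor is forced and
      \<open>f2\<close> alone is the preimage.\<close>
    moreover have "f1 = Idt (flag_cat C z 0) flag0"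
      by (rule flag0_hom_unique[OF f(2) flag_grpd_Idt_hom[OF is_flag0]])
    ultimately show ?thesis
      using f by (intro exI[of _ "Tup Star (arr f2)"]) (simp add: a f(1) g(1))
  qed
  show "h = h'" if "h \<in> hom (apex ?R) u v" "h' \<in> hom (apex ?R) u v"
    "on_Ar ?P h = on_Ar ?P h'" for u v h h'
    using that by (auto elim!: prod_homE)
  show "\<exists>u f g. u \<in> Ob (apex ?R) \<and> f \<in> hom (apex ?e1) (on_Ob ?P u) x \<and>
      g \<in> hom (apex ?\<mu>) (on_Ob ?Q u) y \<and>
      on_Ar (lleg ?\<mu>) g = \<phi> \<cdot>\<^bsub>prod_grpd (S 1) (S 1)\<^esub> on_Ar (rleg ?e1) f"
    if x: "x \<in> Ob (apex ?e1)" and y: "y \<in> Ob (apex ?\<mu>)"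
      and \<phi>: "\<phi> \<in> hom (prod_grpd (S 1) (S 1)) (on_Ob (rleg ?e1) x) (on_Ob (lleg ?\<mu>) y)" for x y \<phi>
  proof -
    obtain a where x: "x = Tup (obj flag0) (obj a)" "is_flag C z 1 a"
      using x by (auto simp: unit_span_def dest!: flag0_unique elim!: prod_ObE small_ObE)
    obtain y1 where y: "y = obj y1" "is_flag C z 2 y1"
      using y by (auto simp: mult_span_eq elim!: small_ObE)
    obtain \<phi>1 \<phi>2 where \<phi>: "\<phi> = Tup (arr \<phi>1) (arr \<phi>2)"
      "\<phi>1 \<in> hom (flag_grpd C z 1) (zero_edge flag0) (edge 0 1 y1)" "\<phi>2 \<in> hom (flag_grpd C z 1) a (edge 1 2 y1)"
      using \<phi> by (auto simp: mult_span_eq unit_span_def x y elim!: prod_homE small_homE)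
    have c: "component \<phi>1 0 1 \<in> hom C z (vert y1 0 1)" "is_iso C (component \<phi>1 0 1)"
      "component \<phi>2 0 1 \<in> hom C (vert a 0 1) (vert y1 1 2)" "is_iso C (component \<phi>2 0 1)"
      using flag_grpd_component[OF \<phi>(2), of 0 1] flag_grpd_iso[OF \<phi>(2), of 0 1] zero_edge_flag0(2)
        flag_grpd_component[OF \<phi>(3), of 0 1] flag_grpd_iso[OF \<phi>(3), of 0 1] by simp_all
    obtain g where g: "g \<in> hom (flag_grpd C z 2) (triangle 0 0 1 a) y1"
      "component g 0 1 = component \<phi>1 0 1" "component g 1 2 = component \<phi>2 0 1"
      by (rule degenerate_left_exists[OF x(2) y(2) c])
    note e = edge_degenerate[OF x(2)]
    note i0 = functor_hom[OF is_functor_degeneracy flag_grpd_Idt_hom[OF is_flag0], unfolded flag_pull_simps(1)]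
    note ia = flag_grpd_Idt_hom[OF x(2)]
    have z0: "vert flag0 0 0 = z" using flag_diag[OF is_flag0, of 0] by simp
    have 1: "edge_Ar 0 1 g = \<phi>1 \<cdot>\<^bsub>flag_cat C z 1\<^esub> zero_edge_Ar (Idt (flag_cat C z 0) flag0)"
      by (rule edge_Ar_eqI[OF g(1)]; (unfold e)?; use S1_comp_hom[OF i0 \<phi>(2)] comp_id[OF c(1)] g(2) z0 in simp)
    have 2: "edge_Ar 1 2 g = \<phi>2 \<cdot>\<^bsub>flag_cat C z 1\<^esub> Idt (flag_cat C z 1) a"
      by (rule edge_Ar_eqI[OF g(1)]; (unfold e)?; use S1_comp_hom[OF ia \<phi>(3)] comp_id[OF c(3)] g(3) in simp)
    show ?thesis
      using x(2) g(1) 1 2 flag_grpd_Idt_hom[OF is_flag0] ia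
      by (intro exI[of _ "Tup Star (obj a)"] exI[of _ "Tup (arr (Idt (flag_cat C z 0) flag0)) (arr (Idt (flag_cat C z 1) a))"]
          exI[of _ "arr g"]) (simp add: mult_span_eq unit_span_def x(1) y(1) \<phi>(1))
  qed
qed

text \<open>As on the left, with the triangle 011 of \<open>a\<close> and a short exact sequence
  whose quotient is zero.\<close>

lemma unit_right:
  "span_equiv (prod_grpd (S 1) unit_grpd) (S 1) (func_span (prod_grpd (S 1) unit_grpd) fst_func)
    (span_comp (prod_grpd (S 1) (S 1)) (mult_span C z) (span_prod (func_span (S 1) id_func) (unit_span C z)))"
proof (rule span_equiv_comp_strict[where P = "prod_func id_func const_func" and Q = "T 0 1 1 \<circ>\<^sub>F fst_func"])
  note [simp del] = One_nat_def
  let ?P = "prod_func id_func const_func :: ('o, 'a) flag_atom ufunc" and ?Q = "T 0 1 1 \<circ>\<^sub>F fst_func :: ('o, 'a) flag_atom ufunc" and ?\<mu> = "mult_span C z"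
  let ?e1 = "span_prod (func_span (S 1) id_func) (unit_span C z)"
  let ?R = "func_span (prod_grpd (S 1) unit_grpd) fst_func :: ('o, 'a) flag_atom span"
  have gr: "groupoid (prod_grpd (S 1) unit_grpd)" by (intro groupoid_prod groupoid_S groupoid_unit)
  show "groupoid (prod_grpd (S 1) unit_grpd)" "groupoid (prod_grpd (S 1) (S 1))" "groupoid (S 1)"
    by (intro groupoid_prod groupoid_S groupoid_unit)+
  show "is_span (prod_grpd (S 1) unit_grpd) (prod_grpd (S 1) (S 1)) ?e1"
    by (intro is_span_prod is_span_unit is_span_func groupoid_S is_functor_id)
  show "is_span (prod_grpd (S 1) (S 1)) (S 1) ?\<mu>" by (rule is_span_mult)
  show "is_span (prod_grpd (S 1) unit_grpd) (S 1) ?R"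
    by (intro is_span_func gr is_functor_fst groupoid_S groupoid_unit)
  show "is_functor (apex ?R) (apex ?e1) ?P"
    using is_functor_prod[OF groupoid_S(1) groupoid_unit is_functor_id[OF groupoid_S(2)] is_functor_const]
    by (simp add: unit_span_def)
  show "is_functor (apex ?R) (apex ?\<mu>) ?Q"
    using is_functor_comp[OF groupoid.axioms(1)[OF gr] is_functor_fst[OF groupoid_S(1) groupoid_unit] functor_T]
    by (simp add: mult_span_eq)
  show "on_Ob (lleg ?e1) (on_Ob ?P u) = on_Ob (lleg ?R) u"
    "on_Ob (rleg ?\<mu>) (on_Ob ?Q u) = on_Ob (rleg ?R) u"
    "on_Ob (lleg ?\<mu>) (on_Ob ?Q u) =
      on_Ob (rleg ?e1) (on_Ob ?P u)"
    if "u \<in> Ob (apex ?R)" for u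
    using that by (auto simp: unit_span_def mult_span_eq edge_degenerate elim!: prod_ObE small_ObE)
  show "on_Ar (lleg ?e1) (on_Ar ?P h) = on_Ar (lleg ?R) h"
    "on_Ar (rleg ?\<mu>) (on_Ar ?Q h) = on_Ar (rleg ?R) h"
    "on_Ar (lleg ?\<mu>) (on_Ar ?Q h) =
      on_Ar (rleg ?e1) (on_Ar ?P h)"
    if "h \<in> hom (apex ?R) u v" for u v h
    using that by (auto simp: unit_span_def mult_span_eq edge_Ar_degenerate elim!: prod_homE small_homE)
  show "\<exists>h. h \<in> hom (apex ?R) u v \<and> on_Ar ?P h = f \<and> on_Ar ?Q h = g"
    if u: "u \<in> Ob (apex ?R)" and v: "v \<in> Ob (apex ?R)"
      and f: "f \<in> hom (apex ?e1) (on_Ob ?P u) (on_Ob ?P v)"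
      and g: "g \<in> hom (apex ?\<mu>) (on_Ob ?Q u) (on_Ob ?Q v)"
      and eq: "on_Ar (lleg ?\<mu>) g = on_Ar (rleg ?e1) f" for u v f g
  proof -
    obtain a b where a: "u = Tup (obj a) Star" "v = Tup (obj b) Star"
      using u v by (auto elim!: prod_ObE small_ObE)
    obtain f1 f2 where f: "f = Tup (arr f2) (arr f1)" "f1 \<in> hom (flag_grpd C z 0) flag0 flag0"
      "f2 \<in> hom (flag_grpd C z 1) a b"
      using f by (auto simp: unit_span_def a elim!: prod_homE small_homE)
    obtain g1 where g: "g = arr g1" "g1 \<in> hom (flag_grpd C z 2) (triangle 0 1 1 a) (triangle 0 1 1 b)"
      using g by (auto simp: mult_span_eq a elim!: small_homE)
    have eq2: "edge_Ar 0 1 g1 = f2"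
      using eq by (auto simp: mult_span_eq unit_span_def f g)
    have "component g1 0 1 = component f2 0 1"
      using arg_cong[OF eq2, of "\<lambda>t. component t 0 1"] by simp
    then have "triangle_Ar 0 1 1 f2 = g1" by (rule degenerate_right_full[OF f(3) g(2)])
    moreover have "f1 = Idt (flag_cat C z 0) flag0"
      by (rule flag0_hom_unique[OF f(2) flag_grpd_Idt_hom[OF is_flag0]])
    ultimately show ?thesis
      using f by (intro exI[of _ "Tup (arr f2) Star"]) (simp add: a f(1) g(1))
  qed
  show "h = h'" if "h \<in> hom (apex ?R) u v" "h' \<in> hom (apex ?R) u v"
    "on_Ar ?P h = on_Ar ?P h'" for u v h h'
    using that by (auto elim!: prod_homE)
  show "\<exists>u f g. u \<in> Ob (apex ?R) \<and> f \<in> hom (apex ?e1) (on_Ob ?P u) x \<and>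
      g \<in> hom (apex ?\<mu>) (on_Ob ?Q u) y \<and>
      on_Ar (lleg ?\<mu>) g = \<phi> \<cdot>\<^bsub>prod_grpd (S 1) (S 1)\<^esub> on_Ar (rleg ?e1) f"
    if x: "x \<in> Ob (apex ?e1)" and y: "y \<in> Ob (apex ?\<mu>)"
      and \<phi>: "\<phi> \<in> hom (prod_grpd (S 1) (S 1)) (on_Ob (rleg ?e1) x) (on_Ob (lleg ?\<mu>) y)" for x y \<phi>
  proof -
    obtain a where x: "x = Tup (obj a) (obj flag0)" "is_flag C z 1 a"
      using x by (auto simp: unit_span_def dest!: flag0_unique elim!: prod_ObE small_ObE)
    obtain y1 where y: "y = obj y1" "is_flag C z 2 y1"
      using y by (auto simp: mult_span_eq elim!: small_ObE)
    obtain \<phi>1 \<phi>2 where \<phi>: "\<phi> = Tup (arr \<phi>2) (arr \<phi>1)"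
      "\<phi>1 \<in> hom (flag_grpd C z 1) (zero_edge flag0) (edge 1 2 y1)" "\<phi>2 \<in> hom (flag_grpd C z 1) a (edge 0 1 y1)"
      using \<phi> by (auto simp: mult_span_eq unit_span_def x y elim!: prod_homE small_homE)
    have c: "component \<phi>2 0 1 \<in> hom C (vert a 0 1) (vert y1 0 1)" "is_iso C (component \<phi>2 0 1)"
      "component \<phi>1 0 1 \<in> hom C z (vert y1 1 2)" "is_iso C (component \<phi>1 0 1)"
      using flag_grpd_component[OF \<phi>(2), of 0 1] flag_grpd_iso[OF \<phi>(2), of 0 1] zero_edge_flag0(2)
        flag_grpd_component[OF \<phi>(3), of 0 1] flag_grpd_iso[OF \<phi>(3), of 0 1] by simp_all
    obtain g where g: "g \<in> hom (flag_grpd C z 2) (triangle 0 1 1 a) y1"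
      "component g 0 1 = component \<phi>2 0 1" "component g 1 2 = component \<phi>1 0 1"
      by (rule degenerate_right_exists[OF x(2) y(2) c])
    note e = edge_degenerate[OF x(2)]
    note i0 = functor_hom[OF is_functor_degeneracy flag_grpd_Idt_hom[OF is_flag0], unfolded flag_pull_simps(1)]
    note ia = flag_grpd_Idt_hom[OF x(2)]
    have z0: "vert flag0 0 0 = z" using flag_diag[OF is_flag0, of 0] by simp
    have 1: "edge_Ar 1 2 g = \<phi>1 \<cdot>\<^bsub>flag_cat C z 1\<^esub> zero_edge_Ar (Idt (flag_cat C z 0) flag0)"
      by (rule edge_Ar_eqI[OF g(1)]; (unfold e)?; use S1_comp_hom[OF i0 \<phi>(2)] comp_id[OF c(3)] g(3) z0 in simp)
    have 2: "edge_Ar 0 1 g = \<phi>2 \<cdot>\<^bsub>flag_cat C z 1\<^esub> Idt (flag_cat C z 1) a"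
      by (rule edge_Ar_eqI[OF g(1)]; (unfold e)?; use S1_comp_hom[OF ia \<phi>(3)] comp_id[OF c(1)] g(2) in simp)
    show ?thesis
      using x(2) g(1) 1 2 flag_grpd_Idt_hom[OF is_flag0] ia
      by (intro exI[of _ "Tup (obj a) Star"] exI[of _ "Tup (arr (Idt (flag_cat C z 1) a)) (arr (Idt (flag_cat C z 0) flag0))"]
          exI[of _ "arr g"]) (simp add: mult_span_eq unit_span_def x(1) y(1) \<phi>(1))
  qed
qed

text \<open>Each equation between morphisms becomes an equivalence of representing spans, because
  composites and products of classes are represented by composites and products of
  representatives.\<close>

lemma algebra_object_S1:
  "algebra_object span_grpd (S 1) (span_mor (prod_grpd (S 1) (S 1)) (S 1) (mult_span C z))
    (span_mor unit_grpd (S 1) (unit_span C z))"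
proof -
  note [simp del] = One_nat_def
  let ?SS = "prod_grpd (S 1) (S 1)"
  let ?id = "func_span (S 1) id_func"
  let ?\<mu> = "mult_span C z" and ?e = "unit_span C z"
  note g1 = groupoid_S(1)[of 1] and gu = groupoid_unit
  note g2 = groupoid_prod[OF g1 g1]
  note g3 = groupoid_prod[OF g2 g1] and g3' = groupoid_prod[OF g1 g2]
  note gl = groupoid_prod[OF gu g1] and gr = groupoid_prod[OF g1 gu]
  note \<mu> = is_span_mult and e = is_span_unit and id = is_span_func[OF g1 is_functor_id[OF groupoid_S(2)]]
  note \<alpha> = is_span_func[OF g3 is_functor_assoc(1)[OF g1 g1 g1]]
  note \<mu>1 = is_span_prod[OF \<mu> id] and \<mu>2 = is_span_prod[OF id \<mu>]
  note e1 = is_span_prod[OF e id] and e2 = is_span_prod[OF id e]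
  note r = is_span_triple
  have "span_mor_comp (span_mor ?SS (S 1) ?\<mu>) (span_mor_prod (span_mor ?SS (S 1) ?\<mu>) (span_mor (S 1) (S 1) ?id)) =
      span_mor (prod_grpd ?SS (S 1)) (S 1) (span_comp ?SS ?\<mu> (span_prod ?\<mu> ?id))"
    by (simp add: span_mor_prod_span_mor[OF g2 g1 g1 g1 \<mu> id] span_mor_comp_span_mor[OF g3 g2 g1 \<mu>1 \<mu>])
  \<comment> \<open>The two bracketings meet in the span of 3-flags.\<close>
  also have "\<dots> = span_mor (prod_grpd ?SS (S 1)) (S 1) triple_span"
    by (rule span_mor_eqI[symmetric, OF g3 g1 r is_span_comp[OF g2 \<mu>1 \<mu>] assoc_left])
  also have "\<dots> = span_mor (prod_grpd ?SS (S 1)) (S 1) (span_comp ?SS ?\<mu> mult_right_span)"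
    by (rule span_mor_eqI[OF g3 g1 r is_span_comp[OF g2 is_span_mult_right \<mu>] assoc_right])
  also have "\<dots> = span_mor_comp (span_mor ?SS (S 1) ?\<mu>) (span_mor (prod_grpd ?SS (S 1)) ?SS mult_right_span)"
    by (rule span_mor_comp_span_mor[symmetric, OF g3 g2 g1 is_span_mult_right \<mu>])
  \<comment> \<open>This rewrites the inner factor of the composite reached so far, replacing the
    rebracketed span by the actual composite with the associator.\<close>
  also have "span_mor (prod_grpd ?SS (S 1)) ?SS mult_right_span = span_mor (prod_grpd ?SS (S 1)) ?SS
      (span_comp (prod_grpd (S 1) ?SS) (span_prod ?id ?\<mu>) (func_span (prod_grpd ?SS (S 1)) assoc_func))"
    by (rule span_mor_eqI[OF g3 g2 is_span_mult_right is_span_comp[OF g3' \<alpha> \<mu>2] mult_right_equiv])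
  also have "\<dots> = span_mor_comp (span_mor_prod (span_mor (S 1) (S 1) ?id) (span_mor ?SS (S 1) ?\<mu>))
      (span_mor (prod_grpd ?SS (S 1)) (prod_grpd (S 1) ?SS) (func_span (prod_grpd ?SS (S 1)) assoc_func))"
    by (simp add: span_mor_prod_span_mor[OF g1 g1 g2 g1 id \<mu>] span_mor_comp_span_mor[OF g3 g3' g2 \<alpha> \<mu>2])
  finally have assoc: "span_mor_comp (span_mor ?SS (S 1) ?\<mu>) (span_mor_prod (span_mor ?SS (S 1) ?\<mu>) (span_mor (S 1) (S 1) ?id)) =
      span_mor_comp (span_mor ?SS (S 1) ?\<mu>) (span_mor_comp (span_mor_prod (span_mor (S 1) (S 1) ?id) (span_mor ?SS (S 1) ?\<mu>))
      (span_mor (prod_grpd ?SS (S 1)) (prod_grpd (S 1) ?SS) (func_span (prod_grpd ?SS (S 1)) assoc_func)))" .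
  have left: "span_mor_comp (span_mor ?SS (S 1) ?\<mu>) (span_mor_prod (span_mor unit_grpd (S 1) ?e) (span_mor (S 1) (S 1) ?id)) =
      span_mor (prod_grpd unit_grpd (S 1)) (S 1) (func_span (prod_grpd unit_grpd (S 1)) snd_func)"
    unfolding span_mor_prod_span_mor[OF gu g1 g1 g1 e id] span_mor_comp_span_mor[OF gl g2 g1 e1 \<mu>]
    by (rule span_mor_eqI[symmetric, OF gl g1 is_span_func[OF gl is_functor_snd[OF gu g1]] is_span_comp[OF g2 e1 \<mu>] unit_left])
  have right: "span_mor_comp (span_mor ?SS (S 1) ?\<mu>) (span_mor_prod (span_mor (S 1) (S 1) ?id) (span_mor unit_grpd (S 1) ?e)) =
      span_mor (prod_grpd (S 1) unit_grpd) (S 1) (func_span (prod_grpd (S 1) unit_grpd) fst_func)"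
    unfolding span_mor_prod_span_mor[OF g1 g1 gu g1 id e] span_mor_comp_span_mor[OF gr g2 g1 e2 \<mu>]
    by (rule span_mor_eqI[symmetric, OF gr g1 is_span_func[OF gr is_functor_fst[OF g1 gu]] is_span_comp[OF g2 e2 \<mu>] unit_right])
  have "span_mor ?SS (S 1) ?\<mu> \<in> hom span_grpd ?SS (S 1)" "span_mor unit_grpd (S 1) ?e \<in> hom span_grpd unit_grpd (S 1)"
    using g1 g2 gu \<mu> e by (auto simp: hom_def span_grpd_def span_mor_def)
  with assoc left right g1 show ?thesis
    by (simp add: algebra_object_def span_grpd_def)
qed

end

theorem theorem2p11:
  fixes C :: "('o, 'a) cat" and z :: 'o
  assumes "proto_abelian C" and "zero_object C z"
  shows "algebra_object span_grpd (small_cat (flag_grpd C z 1))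
    (span_mor (prod_grpd (S_on C z {0, 1}) (S_on C z {1, 2})) (S_on C z {0, 2}) (mult_span C z))
    (span_mor unit_grpd (small_cat (flag_grpd C z 1)) (unit_span C z))"
proof -
  interpret flags C z
    using assms by (intro flags.intro flags_axioms.intro)
  \<comment> \<open>The groupoid attached to an index set depends only on its cardinality, and all
    three sets have two elements.\<close>
  have "S_on C z {0, 1} = S 1" "S_on C z {1, 2} = S 1" "S_on C z {0, 2} = S 1"
    by (simp_all add: S_on_def)
  then show ?thesis using algebra_object_S1 by simp
qed

end
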